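(* Let $(b,c)$ be a weighted graph over $V$ which is locally finite (each $x\in V$ has only finitely many $y$ with $b(x,y)>0$) and satisfies $n(x)>0$ for all $x$, let $m$ be a measure on $V$ and $L=L_{b,c,m}$. Assume $\alpha_{b,c,n}(V)>0$. Then $\sigma_{\mathrm{ess}}(L)=\emptyset$ if and only if $d_{\partial V}=\infty$.
   Context: Let $V$ be a countably infinite set. A weighted graph over $V$ is a pair $(b,c)$ of maps $b:V\times V\to[0,\infty)$ and $c:V\to[0,\infty)$ with $b(x,x)=0$, $b(x,y)=b(y,x)$ and $\sum_{y\in V}b(x,y)<\infty$ for all $x,y\in V$. A measure on $V$ is a map $m:V\to(0,\infty)$. Define $Q^{\max}(u)=\frac12\sum_{x,y}b(x,y)(u(x)-u(y))^2+\sum_x c(x)u(x)^2$; $Q_{b,c,m}$ is the closure in $\ell^2(V,m)$ of the restriction of $Q^{\max}$ to finitely supported functions and $L_{b,c,m}$ its associated nonnegative selfadjoint operator. Let $n(x)=\sum_y b(x,y)+c(x)$, $d(x)=n(x)/m(x)$, $d_U=\inf_{x\in U}d(x)$. For finite $W$ let $|\partial W|=\sum_{x\in W,y\notin W}b(x,y)+\sum_{x\in W}c(x)$, $n(W)=\sum_{x\in W}n(x)$, $\alpha_{b,c,n}(U)=\inf\{|\partial W|/n(W):\ W\subseteq U\text{ finite, nonempty}\}$. With $\mathcal K$ the net of finite subsets of $V$ directed by inclusion, $d_{\partial V}=\lim_{K\in\mathcal K}d_{V\setminus K}$ (a monotone limit in $[0,\infty]$). *)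

theory Defs
  imports "HOL-Analysis.Analysis"
begin

definition weighted_graph :: "('v \<Rightarrow> 'v \<Rightarrow> real) \<Rightarrow> ('v \<Rightarrow> real) \<Rightarrow> bool" where
  "weighted_graph b c \<longleftrightarrow>
     (\<forall>x y. b x y \<ge> 0) \<and> (\<forall>x. c x \<ge> 0) \<and> (\<forall>x. b x x = 0) \<and>
     (\<forall>x y. b x y = b y x) \<and> (\<forall>x. (\<lambda>y. b x y) summable_on UNIV)"

definition pos_measure :: "('v \<Rightarrow> real) \<Rightarrow> bool" where
  "pos_measure m \<longleftrightarrow> (\<forall>x. m x > 0)"

definition locally_finite :: "('v \<Rightarrow> 'v \<Rightarrow> real) \<Rightarrow> bool" where
  "locally_finite b \<longleftrightarrow> (\<forall>x. finite {y. b x y > 0})"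

definition gdeg :: "('v \<Rightarrow> 'v \<Rightarrow> real) \<Rightarrow> ('v \<Rightarrow> real) \<Rightarrow> 'v \<Rightarrow> real" where
  "gdeg b c x = (\<Sum>\<^sub>\<infinity>y. b x y) + c x"

definition wdeg :: "('v \<Rightarrow> 'v \<Rightarrow> real) \<Rightarrow> ('v \<Rightarrow> real) \<Rightarrow> ('v \<Rightarrow> real) \<Rightarrow> 'v \<Rightarrow> real" where
  "wdeg b c m x = gdeg b c x / m x"

definition wdeg_inf :: "('v \<Rightarrow> 'v \<Rightarrow> real) \<Rightarrow> ('v \<Rightarrow> real) \<Rightarrow> ('v \<Rightarrow> real) \<Rightarrow> 'v set \<Rightarrow> ereal" where
  "wdeg_inf b c m U = (INF x\<in>U. ereal (wdeg b c m x))"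

definition wdeg_boundary :: "('v \<Rightarrow> 'v \<Rightarrow> real) \<Rightarrow> ('v \<Rightarrow> real) \<Rightarrow> ('v \<Rightarrow> real) \<Rightarrow> ereal" where
  "wdeg_boundary b c m = Lim (finite_subsets_at_top UNIV) (\<lambda>K. wdeg_inf b c m (UNIV - K))"

definition bdry_size :: "('v \<Rightarrow> 'v \<Rightarrow> real) \<Rightarrow> ('v \<Rightarrow> real) \<Rightarrow> 'v set \<Rightarrow> real" where
  "bdry_size b c W = (\<Sum>x\<in>W. \<Sum>\<^sub>\<infinity>y\<in>UNIV - W. b x y) + (\<Sum>x\<in>W. c x)"

definition cheeger :: "('v \<Rightarrow> 'v \<Rightarrow> real) \<Rightarrow> ('v \<Rightarrow> real) \<Rightarrow> 'v set \<Rightarrow> real" where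
  "cheeger b c U = Inf {bdry_size b c W / (\<Sum>x\<in>W. gdeg b c x) | W. W \<subseteq> U \<and> finite W \<and> W \<noteq> {}}"

definition l2 :: "('v \<Rightarrow> real) \<Rightarrow> ('v \<Rightarrow> complex) set" where
  "l2 m = {u. (\<lambda>x. m x * (cmod (u x))\<^sup>2) summable_on UNIV}"

definition l2norm :: "('v \<Rightarrow> real) \<Rightarrow> ('v \<Rightarrow> complex) \<Rightarrow> real" where
  "l2norm m u = sqrt (\<Sum>\<^sub>\<infinity>x. m x * (cmod (u x))\<^sup>2)"

definition l2inner :: "('v \<Rightarrow> real) \<Rightarrow> ('v \<Rightarrow> complex) \<Rightarrow> ('v \<Rightarrow> complex) \<Rightarrow> complex" where
  "l2inner m u v = (\<Sum>\<^sub>\<infinity>x. complex_of_real (m x) * u x * cnj (v x))"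

definition fin_supp :: "('v \<Rightarrow> complex) \<Rightarrow> bool" where
  "fin_supp u \<longleftrightarrow> finite {x. u x \<noteq> 0}"

definition qmax :: "('v \<Rightarrow> 'v \<Rightarrow> real) \<Rightarrow> ('v \<Rightarrow> real) \<Rightarrow> ('v \<Rightarrow> complex) \<Rightarrow> ('v \<Rightarrow> complex) \<Rightarrow> complex" where
  "qmax b c u v =
     (\<Sum>\<^sub>\<infinity>(x,y). complex_of_real (b x y / 2) * (u x - u y) * cnj (v x - v y))
     + (\<Sum>\<^sub>\<infinity>x. complex_of_real (c x) * u x * cnj (v x))"

definition Qmax :: "('v \<Rightarrow> 'v \<Rightarrow> real) \<Rightarrow> ('v \<Rightarrow> real) \<Rightarrow> ('v \<Rightarrow> complex) \<Rightarrow> real" where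
  "Qmax b c u =
     (\<Sum>\<^sub>\<infinity>(x,y). b x y / 2 * (cmod (u x - u y))\<^sup>2) + (\<Sum>\<^sub>\<infinity>x. c x * (cmod (u x))\<^sup>2)"

text \<open>phi is a sequence of finitely supported functions converging to u in l^2 and
  Cauchy with respect to Q^max (i.e. Cauchy in the form norm)\<close>
definition approx_seq :: "('v \<Rightarrow> 'v \<Rightarrow> real) \<Rightarrow> ('v \<Rightarrow> real) \<Rightarrow> ('v \<Rightarrow> real) \<Rightarrow>
    (nat \<Rightarrow> 'v \<Rightarrow> complex) \<Rightarrow> ('v \<Rightarrow> complex) \<Rightarrow> bool" where
  "approx_seq b c m \<phi> u \<longleftrightarrow>
     (\<forall>k. fin_supp (\<phi> k)) \<and>
     (\<lambda>k. l2norm m (\<lambda>x. \<phi> k x - u x)) \<longlonglongrightarrow> 0 \<and>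
     (\<forall>\<epsilon>>0. \<exists>N. \<forall>k\<ge>N. \<forall>l\<ge>N. Qmax b c (\<lambda>x. \<phi> k x - \<phi> l x) < \<epsilon>)"

definition formdom :: "('v \<Rightarrow> 'v \<Rightarrow> real) \<Rightarrow> ('v \<Rightarrow> real) \<Rightarrow> ('v \<Rightarrow> real) \<Rightarrow> ('v \<Rightarrow> complex) set" where
  "formdom b c m = {u \<in> l2 m. \<exists>\<phi>. approx_seq b c m \<phi> u}"

text \<open>the closed form Q_{b,c,m}(u,v) (well defined for u, v in formdom)\<close>
definition Qform :: "('v \<Rightarrow> 'v \<Rightarrow> real) \<Rightarrow> ('v \<Rightarrow> real) \<Rightarrow> ('v \<Rightarrow> real) \<Rightarrow>
    ('v \<Rightarrow> complex) \<Rightarrow> ('v \<Rightarrow> complex) \<Rightarrow> complex" where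
  "Qform b c m u v = (THE z. \<forall>\<phi> \<psi>. approx_seq b c m \<phi> u \<and> approx_seq b c m \<psi> v \<longrightarrow>
        (\<lambda>k. qmax b c (\<phi> k) (\<psi> k)) \<longlonglongrightarrow> z)"

definition opdom :: "('v \<Rightarrow> 'v \<Rightarrow> real) \<Rightarrow> ('v \<Rightarrow> real) \<Rightarrow> ('v \<Rightarrow> real) \<Rightarrow> ('v \<Rightarrow> complex) set" where
  "opdom b c m = {u \<in> formdom b c m. \<exists>f\<in>l2 m. \<forall>v\<in>formdom b c m. Qform b c m u v = l2inner m f v}"

definition Lop :: "('v \<Rightarrow> 'v \<Rightarrow> real) \<Rightarrow> ('v \<Rightarrow> real) \<Rightarrow> ('v \<Rightarrow> real) \<Rightarrow> ('v \<Rightarrow> complex) \<Rightarrow> ('v \<Rightarrow> complex)" where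
  "Lop b c m u = (SOME f. f \<in> l2 m \<and> (\<forall>v\<in>formdom b c m. Qform b c m u v = l2inner m f v))"

definition spectrum_L :: "('v \<Rightarrow> 'v \<Rightarrow> real) \<Rightarrow> ('v \<Rightarrow> real) \<Rightarrow> ('v \<Rightarrow> real) \<Rightarrow> complex set" where
  "spectrum_L b c m = {z. \<not> (bij_betw (\<lambda>u x. Lop b c m u x - z * u x) (opdom b c m) (l2 m) \<and>
       (\<exists>C. \<forall>u\<in>opdom b c m. l2norm m u \<le> C * l2norm m (\<lambda>x. Lop b c m u x - z * u x)))}"

definition eigenspace_L :: "('v \<Rightarrow> 'v \<Rightarrow> real) \<Rightarrow> ('v \<Rightarrow> real) \<Rightarrow> ('v \<Rightarrow> real) \<Rightarrow> complex \<Rightarrow> ('v \<Rightarrow> complex) set" where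
  "eigenspace_L b c m z = {u \<in> opdom b c m. (\<forall>x. Lop b c m u x = z * u x)}"

definition disc_spectrum_L :: "('v \<Rightarrow> 'v \<Rightarrow> real) \<Rightarrow> ('v \<Rightarrow> real) \<Rightarrow> ('v \<Rightarrow> real) \<Rightarrow> complex set" where
  "disc_spectrum_L b c m = {z \<in> spectrum_L b c m.
       (\<exists>\<epsilon>>0. ball z \<epsilon> \<inter> spectrum_L b c m = {z}) \<and>
       (\<exists>S. finite S \<and> (\<forall>u\<in>eigenspace_L b c m z. \<exists>a. u = (\<lambda>x. \<Sum>s\<in>S. a s * s x)))}"

definition ess_spectrum_L :: "('v \<Rightarrow> 'v \<Rightarrow> real) \<Rightarrow> ('v \<Rightarrow> real) \<Rightarrow> ('v \<Rightarrow> real) \<Rightarrow> complex set" where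
  "ess_spectrum_L b c m = spectrum_L b c m - disc_spectrum_L b c m"

end

theory Submission
  imports Defs "HOL-Library.Diagonal_Subsequence"
begin

text \<open>
  Put \<open>k = n + m\<close> and \<open>\<theta> = sqrt (m / k) = 1 / sqrt (d + 1)\<close>. In the unweighted space of square-summable
  functions, with \<open>u\<close> represented by \<open>sqrt m u\<close>, the resolvent is \<open>(L + 1)\<^sup>-\<^sup>1 = R = S G\<^sup>-\<^sup>1 S\<close>, where \<open>S\<close>
  is multiplication by \<open>\<theta>\<close> and \<open>G\<close> is the identity minus the adjacency matrix with entries
  \<open>b x y / sqrt (k x k y)\<close>. Cheeger's inequality \<open>Q(u) \<ge> \<alpha>\<^sup>2/2 \<Sum> n |u|\<^sup>2\<close> makes \<open>G\<close> bounded, coercive and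
  hence invertible, so \<open>R\<close> and \<open>S\<^sup>2\<close> are comparable.

  If \<open>d\<close> tends to infinity then \<open>\<theta>\<close> tends to \<open>0\<close>, so \<open>S\<close> and \<open>R\<close> are compact and the spectrum of \<open>L\<close> is
  discrete. If \<open>d \<le> C\<close> infinitely often, the form of \<open>R\<close> is at least \<open>1 / (2 (C + 1))\<close> on infinitely many
  unit coordinate vectors, which yields a singular sequence for some \<open>\<mu> > 0\<close>; were \<open>1/\<mu> - 1\<close> an isolated
  point of the spectrum of \<open>L\<close>, it would be an eigenvalue of infinite multiplicity.
\<close>

section \<open>Self-adjoint operators on real Hilbert spaces\<close>

text \<open>\<open>Lop\<close> is unbounded and given only through the closure of a form. The weight
  k is chosen so that this closure disappears: Q plus the squared \<open>m\<close>-norm is bounded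
  in \<open>k\<close>-coordinates by a Schur test (n \<le> k) and bounded below on the n-part of k
  by Cheeger and on the m-part for free, so the form domain is exactly \<open>l2 k\<close> and
  \<open>G\<close> is a bounded operator on the whole space. The spectral parameter enters through
  (L - z) (L + 1)^-1 = 1 - (z + 1) R. This pencil is treated for all complex parameters at once,
  with no exception at z = -1, where R - 1/(z + 1) would make no sense. The delicate step is that an
  isolated point carrying a singular sequence is an eigenvalue of infinite multiplicity. Instead of
  spectral projections, an infimum argument with a quartic polynomial in A = R - \<mu> shows that A
  is bounded below on the orthogonal complement of its kernel. An approximate null sequence of A is
  then asymptotic to its kernel components, and being weakly null it cannot stay near a
  finite-dimensional kernel. The comparison constants have different origins: G \<le> 2 bounds R
  from below by S^2/2, while G \<ge> \<kappa> bounds the inverse of G.\<close>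

lemma orthogonal_projection_exists:
  fixes X :: "'a::{real_inner,complete_space} set"
  assumes X: "subspace X" "closed X"
  shows "\<exists>p\<in>X. \<forall>x\<in>X. inner (f - p) x = 0"
proof -
  define D where "D = (INF x\<in>X. (norm (f - x))\<^sup>2)"
  have X0: "0 \<in> X" using X(1) by (rule subspace_0)
  have bdd: "bdd_below ((\<lambda>x. (norm (f - x))\<^sup>2) ` X)" by (auto intro!: bdd_belowI[of _ 0])
  have D_le: "D \<le> (norm (f - x))\<^sup>2" if "x \<in> X" for x
    unfolding D_def using bdd that by (rule cINF_lower)
  have "\<exists>x\<in>X. (norm (f - x))\<^sup>2 < D + inverse (real (Suc n))" for n
    using cINF_less_iff[OF _ bdd, of "D + inverse (real (Suc n))"] X0 unfolding D_def by auto
  then obtain x where xX: "\<And>n. x n \<in> X" and xD: "\<And>n. (norm (f - x n))\<^sup>2 < D + inverse (real (Suc n))"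
    by metis
  \<comment> \<open>Parallelogram law: the midpoint of \<open>x n\<close> and \<open>x k\<close>
    lies in \<open>X\<close>, so its squared distance from \<open>f\<close> is at least
    \<open>D\<close>; near-minimisers are therefore close to each other.\<close>
  have par: "(norm (x n - x k))\<^sup>2 \<le> 2 * inverse (real (Suc n)) + 2 * inverse (real (Suc k))" for n k
  proof -
    have "(1/2) *\<^sub>R (x n + x k) \<in> X" using X(1) xX by (simp add: subspace_add subspace_scale)
    from D_le[OF this] have "4 * D \<le> 4 * (norm (f - (1/2) *\<^sub>R (x n + x k)))\<^sup>2" by simp
    also have "\<dots> = 2 * (norm (f - x n))\<^sup>2 + 2 * (norm (f - x k))\<^sup>2 - (norm (x n - x k))\<^sup>2"
      by (simp add: power2_norm_eq_inner inner_diff_left inner_diff_right inner_add_left inner_add_right inner_commute algebra_simps)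
    finally show ?thesis using xD[of n] xD[of k] by linarith
  qed
  have "Cauchy x"
  proof (rule metric_CauchyI)
    fix e :: real assume "e > 0"
    then have "e\<^sup>2/4 > 0" by simp
    from reals_Archimedean[OF this] obtain N where N: "inverse (real (Suc N)) < e\<^sup>2/4" by blast
    have "dist (x n) (x k) < e" if "n \<ge> N" "k \<ge> N" for n k
    proof -
      have "inverse (real (Suc n)) \<le> inverse (real (Suc N))" "inverse (real (Suc k)) \<le> inverse (real (Suc N))"
        using that by (auto intro!: le_imp_inverse_le)
      with par[of n k] N have "(norm (x n - x k))\<^sup>2 < e\<^sup>2" by linarith
      then show ?thesis using \<open>e > 0\<close> by (simp add: dist_norm power2_less_imp_less)
    qed
    then show "\<exists>M. \<forall>m\<ge>M. \<forall>n\<ge>M. dist (x m) (x n) < e" by blast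
  qed
  then obtain p where p: "x \<longlonglongrightarrow> p" using Cauchy_convergent_iff convergent_def by blast
  have pX: "p \<in> X" using X(2) xX p closed_sequentially by blast
  have "(\<lambda>n. (norm (f - x n))\<^sup>2) \<longlonglongrightarrow> (norm (f - p))\<^sup>2" by (intro tendsto_intros p)
  moreover have "(\<lambda>n. D + inverse (real (Suc n))) \<longlonglongrightarrow> D + 0"
    by (intro tendsto_intros LIMSEQ_inverse_real_of_nat)
  ultimately have pD: "(norm (f - p))\<^sup>2 \<le> D"
    using xD by (intro LIMSEQ_le[of _ _ "\<lambda>n. D + inverse (real (Suc n))"]) (auto intro: less_imp_le)
  have "inner (f - p) y = 0" if y: "y \<in> X" for y
  proof (cases "y = 0")
    case False
    \<comment> \<open>The minimiser of the distance from \<open>f\<close> along the line p + t y;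
      minimality of \<open>p\<close> then leaves no room for a nonzero inner product.\<close>
    define t where "t = inner (f - p) y / inner y y"
    have yy: "inner y y > 0" using False by simp
    have "p + t *\<^sub>R y \<in> X" using X(1) pX y by (simp add: subspace_add subspace_scale)
    from order_trans[OF pD D_le[OF this]]
    have "(norm (f - p))\<^sup>2 \<le> (norm ((f - p) - t *\<^sub>R y))\<^sup>2" by (simp only: diff_diff_eq)
    also have "\<dots> = (norm (f - p))\<^sup>2 - 2 * t * inner (f - p) y + t\<^sup>2 * inner y y"
      unfolding power2_norm_eq_inner
      by (simp add: inner_diff_left inner_diff_right inner_commute algebra_simps power2_eq_square)
    also have "\<dots> = (norm (f - p))\<^sup>2 - (inner (f - p) y)\<^sup>2 / inner y y"
      unfolding t_def using yy False by (simp add: field_simps power2_eq_square)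
    finally have "(inner (f - p) y)\<^sup>2 / inner y y \<le> 0" by simp
    then show ?thesis using yy by (simp add: divide_le_0_iff)
  qed simp
  with pX show ?thesis by blast
qed

text \<open>The lower bound makes the range closed, and a vector orthogonal to the range is killed
  by the adjoint \<open>T'\<close>, hence zero. The adjoint is a separate map because the pencil at
  w has the pencil at \<open>cnj w\<close> as its adjoint.\<close>

lemma bounded_below_imp_surj:
  fixes T T' :: "'a::{real_inner,complete_space} \<Rightarrow> 'a"
  assumes T: "bounded_linear T" and adj: "\<And>u v. inner (T u) v = inner u (T' v)"
    and c: "c > 0" "\<And>u. c * norm u \<le> norm (T u)" and inj: "\<And>v. T' v = 0 \<Longrightarrow> v = 0"
  shows "surj T"
proof -
  have "complete (T ` UNIV)"
    by (rule complete_isometric_image[OF c(1) subspace_UNIV T]) (use c complete_UNIV in auto)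
  then have cl: "closed (range T)" by (rule complete_imp_closed)
  have sub: "subspace (range T)"
    using T by (intro linear_subspace_image subspace_UNIV bounded_linear.linear)
  have "f \<in> range T" for f
  proof -
    from orthogonal_projection_exists[OF sub cl, of f] obtain p
      where p: "p \<in> range T" "\<And>x. x \<in> range T \<Longrightarrow> inner (f - p) x = 0" by blast
    have "inner (T' (f - p)) (T' (f - p)) = 0"
      using p(2)[of "T (T' (f - p))"] adj[of "T' (f - p)" "f - p"] by (simp add: inner_commute)
    then have "f - p = 0" by (simp only: inj inner_eq_zero_iff)
    with p(1) show ?thesis by simp
  qed
  then show ?thesis by blast
qed

text \<open>Test nonnegativity of the form at \<open>u - B u / M\<close>.\<close>
lemma nonneg_form_norm_bound:
  fixes B :: "'a::real_inner \<Rightarrow> 'a"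
  assumes B: "linear B" and sym: "\<And>u v. inner (B u) v = inner u (B v)"
    and nonneg: "\<And>u. 0 \<le> inner (B u) u"
    and M: "M > 0" "\<And>u. norm (B u) \<le> M * norm u"
  shows "(norm (B u))\<^sup>2 \<le> M * inner (B u) u"
proof -
  interpret B: linear B by fact
  have "inner (B (B u)) (B u) \<le> norm (B (B u)) * norm (B u)" by (rule norm_cauchy_schwarz)
  also have "\<dots> \<le> M * norm (B u) * norm (B u)" by (intro mult_right_mono M) auto
  finally have 1: "inner (B (B u)) (B u) \<le> M * (norm (B u))\<^sup>2" by (simp add: power2_eq_square algebra_simps)
  have "0 \<le> inner (B (u - (1/M) *\<^sub>R B u)) (u - (1/M) *\<^sub>R B u)" by (rule nonneg)
  also have "\<dots> = inner (B u) u - 2 / M * (norm (B u))\<^sup>2 + 1 / M\<^sup>2 * inner (B (B u)) (B u)"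
    using sym[of "B u" u] unfolding power2_norm_eq_inner
    by (simp add: B.diff B.scaleR inner_diff_left inner_diff_right power2_eq_square algebra_simps)
  also have "\<dots> \<le> inner (B u) u - 2 / M * (norm (B u))\<^sup>2 + 1 / M\<^sup>2 * (M * (norm (B u))\<^sup>2)"
    by (intro add_left_mono mult_left_mono 1) auto
  also have "\<dots> = inner (B u) u - (norm (B u))\<^sup>2 / M" using M(1) by (simp add: field_simps power2_eq_square)
  finally show ?thesis using M(1) by (simp add: field_simps)
qed

text \<open>Otherwise the bottom \<open>-\<delta>\<close> of the form of \<open>A\<^sup>4 - \<epsilon>\<^sup>2 A\<^sup>2\<close> is negative, and
  \<open>A\<^sup>4 - \<epsilon>\<^sup>2 A\<^sup>2 + \<delta>\<close> factors into \<open>A \<plusminus> a\<close>, \<open>A \<plusminus> b\<close> with \<open>0 < b \<le> a < \<epsilon>\<close>, hence is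
  bounded below, contradicting the choice of \<open>\<delta>\<close>.\<close>
lemma spectral_gap_around_zero:
  fixes A :: "'a::real_inner \<Rightarrow> 'a"
  assumes A: "bounded_linear A" and sym: "\<And>u v. inner (A u) v = inner u (A v)"
    and eps: "\<epsilon> > 0"
    and gap: "\<And>s. 0 < \<bar>s\<bar> \<Longrightarrow> \<bar>s\<bar> < \<epsilon> \<Longrightarrow> \<exists>c>0. \<forall>u. c * norm u \<le> norm (A u - s *\<^sub>R u)"
  shows "\<epsilon> * norm (A u) \<le> norm (A (A u))"
proof (rule ccontr)
  interpret A: bounded_linear A by fact
  assume "\<not> ?thesis"
  then have neg: "norm (A (A u)) < \<epsilon> * norm (A u)" by simp
  then have u0: "u \<noteq> 0" using A.zero by auto
  define q where "q v = (norm (A (A v)))\<^sup>2 - \<epsilon>\<^sup>2 * (norm (A v))\<^sup>2" for v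
  define \<delta> where "\<delta> = - (INF v\<in>{v. norm v = 1}. q v)"
  have q_scale: "q (r *\<^sub>R v) = r\<^sup>2 * q v" for r v
    by (simp add: q_def A.scaleR power_mult_distrib algebra_simps)
  \<comment> \<open>\<open>q\<close> is the form of A^4 - \<epsilon>^2 A^2; completing it to the
    square of A^2 - \<epsilon>^2/2 bounds it from below.\<close>
  have q_low: "- (\<epsilon>^4 / 4) * (norm v)\<^sup>2 \<le> q v" for v
  proof -
    have "0 \<le> (norm (A (A v) - (\<epsilon>\<^sup>2/2) *\<^sub>R v))\<^sup>2" by simp
    also have "\<dots> = q v + \<epsilon>^4/4 * (norm v)\<^sup>2"
      using sym[of "A v" v] unfolding q_def power2_norm_eq_inner
      by (simp add: inner_diff_left inner_diff_right inner_commute power2_eq_square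
          power4_eq_xxxx algebra_simps)
    finally show ?thesis by simp
  qed
  have bdd: "bdd_below (q ` {v. norm v = 1})"
  proof (intro bdd_belowI[of _ "- (\<epsilon>^4 / 4)"], elim imageE)
    show "- (\<epsilon>^4 / 4) \<le> y" if "y = q v" "v \<in> {v. norm v = 1}" for y v
      using q_low[of v] that by simp
  qed
  have \<delta>_le: "- \<delta> \<le> q v" if "norm v = 1" for v
    unfolding \<delta>_def using cINF_lower[OF bdd, of v] that by simp
  have form: "- \<delta> * (norm v)\<^sup>2 \<le> q v" for v
  proof (cases "v = 0")
    case True then show ?thesis by (simp add: q_def A.zero)
  next
    case False
    have "- \<delta> \<le> q ((1 / norm v) *\<^sub>R v)" using False by (intro \<delta>_le) simp
    then show ?thesis unfolding q_scale using False by (simp add: field_simps)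
  qed
  have un: "norm ((1 / norm u) *\<^sub>R u) = 1" using u0 by simp
  have "(norm (A (A u)))\<^sup>2 < (\<epsilon> * norm (A u))\<^sup>2" using neg by (intro power_strict_mono) auto
  then have "q u < 0" unfolding q_def by (simp add: power_mult_distrib)
  with form[of u] have "0 < \<delta> * (norm u)\<^sup>2" by simp
  then have \<delta>_pos: "\<delta> > 0" by (simp add: zero_less_mult_iff)
  have \<delta>_up: "\<delta> \<le> \<epsilon>^4/4"
    unfolding \<delta>_def
  proof -
    have "- (\<epsilon>^4/4) \<le> (INF v\<in>{v. norm v = 1}. q v)"
    proof (rule cINF_greatest)
      show "{v::'a. norm v = 1} \<noteq> {}" using un by blast
      show "- (\<epsilon>^4/4) \<le> q v" if "v \<in> {v. norm v = 1}" for v using q_low[of v] that by simp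
    qed
    then show "- (INF v\<in>{v. norm v = 1}. q v) \<le> \<epsilon>^4/4" by linarith
  qed
  \<comment> \<open>The roots of t^2 - \<epsilon>^2 t + \<delta> are \<epsilon>^2/2 + r and
    \<epsilon>^2/2 - r. They are real because \<delta> \<le> \<epsilon>^4/4 and lie strictly between
    0 and \<epsilon>^2 because \<delta> > 0; their square roots are a and b.\<close>
  define r where "r = sqrt (\<epsilon>^4/4 - \<delta>)"
  have r2: "r\<^sup>2 = \<epsilon>^4/4 - \<delta>" and r0: "r \<ge> 0" unfolding r_def using \<delta>_up by auto
  have r_less: "r < \<epsilon>\<^sup>2/2"
  proof (rule power2_less_imp_less)
    show "r\<^sup>2 < (\<epsilon>\<^sup>2/2)\<^sup>2" unfolding r2 using \<delta>_pos by (simp add: power_divide flip: power_mult)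
  qed simp
  define a where "a = sqrt (\<epsilon>\<^sup>2/2 + r)"
  define b where "b = sqrt (\<epsilon>\<^sup>2/2 - r)"
  have a2: "a\<^sup>2 = \<epsilon>\<^sup>2/2 + r" and b2: "b\<^sup>2 = \<epsilon>\<^sup>2/2 - r" unfolding a_def b_def using r0 r_less by auto
  have a0: "a > 0" and b0: "b > 0" unfolding a_def b_def using r0 r_less eps
    by (auto intro!: add_pos_nonneg)
  have a1: "a < \<epsilon>" and b1: "b < \<epsilon>"
    using a2 b2 r0 r_less eps by (auto intro!: power2_less_imp_less[of _ \<epsilon>]) 
  have ab: "a\<^sup>2 + b\<^sup>2 = \<epsilon>\<^sup>2" "a\<^sup>2 * b\<^sup>2 = \<delta>"
    using r2 unfolding a2 b2 by (auto simp: algebra_simps power2_eq_square power4_eq_xxxx)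
  define E where "E s v = A v - s *\<^sub>R v" for s v
  have "\<exists>c>0. \<forall>u. c * norm u \<le> norm (E s u)" if "s \<in> {a, -a, b, -b}" for s
    unfolding E_def using that a0 b0 a1 b1 by (intro gap) auto
  then obtain c where c: "\<And>s. s \<in> {a, -a, b, -b} \<Longrightarrow> c s > 0"
     "\<And>s v. s \<in> {a, -a, b, -b} \<Longrightarrow> c s * norm v \<le> norm (E s v)" by metis
  define B where "B v = A (A (A (A v))) - \<epsilon>\<^sup>2 *\<^sub>R A (A v) + \<delta> *\<^sub>R v" for v
  define C where "C = c a * (c (-a) * (c b * c (-b)))"
  have C0: "C > 0" unfolding C_def using c(1) by simp
  have B_factor: "B v = E a (E (-a) (E b (E (-b) v)))" for v
    unfolding B_def E_def ab[symmetric]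
    by (simp add: A.add A.diff A.scaleR algebra_simps power2_eq_square)
  have "C * norm v \<le> norm (B v)" for v
  proof -
    have "C * norm v = c a * (c (-a) * (c b * (c (-b) * norm v)))" by (simp add: C_def)
    also have "\<dots> \<le> c a * (c (-a) * (c b * norm (E (-b) v)))"
      using c by (intro mult_left_mono) (auto intro: less_imp_le)
    also have "\<dots> \<le> c a * (c (-a) * norm (E b (E (-b) v)))"
      using c by (intro mult_left_mono) (auto intro: less_imp_le)
    also have "\<dots> \<le> c a * norm (E (-a) (E b (E (-b) v)))"
      using c by (intro mult_left_mono) (auto intro: less_imp_le)
    also have "\<dots> \<le> norm (B v)" unfolding B_factor using c by auto
    finally show ?thesis .
  qed
  note C_low = this
  have Bform: "inner (B v) v = q v + \<delta> * (norm v)\<^sup>2" for v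
    using sym[of v v] sym[of "A (A (A v))" v] sym[of "A (A v)" "A v"] sym[of "A v" v]
    unfolding B_def q_def
    by (simp add: power2_norm_eq_inner inner_diff_left inner_add_left)
  have Bbl: "bounded_linear B" unfolding B_def
    by (intro bounded_linear_add bounded_linear_sub bounded_linear_compose[OF A]
        bounded_linear_const_scaleR bounded_linear_ident)
  then obtain M where M0: "M > 0" and BM: "\<And>v. norm (B v) \<le> M * norm v"
    using bounded_linear.pos_bounded by (metis mult.commute)
  have M: "(norm (B v))\<^sup>2 \<le> M * inner (B v) v" for v
  proof (rule nonneg_form_norm_bound)
    show "linear B" using Bbl by (rule bounded_linear.linear)
    show "inner (B v) w = inner v (B w)" for v w
      unfolding B_def by (simp add: inner_diff_left inner_add_left inner_diff_right inner_add_right sym)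
    show "0 \<le> inner (B v) v" for v unfolding Bform using form[of v] by simp
  qed (fact M0, fact BM)
  \<comment> \<open>A near-minimiser v of \<open>q\<close> makes \<open>inner (B v) v\<close> = q v
    + \<delta> smaller than C^2/M, whereas the lower bound on \<open>B\<close> together with
    \<open>M\<close> forces it to be at least C^2/M.\<close>
  have "- \<delta> < - \<delta> + C\<^sup>2 / M" using C0 M0 by simp
  moreover have "{v::'a. norm v = 1} \<noteq> {}" using un by blast
  ultimately obtain v where v: "norm v = 1" "q v < - \<delta> + C\<^sup>2 / M"
    using cINF_less_iff[OF _ bdd, of "- \<delta> + C\<^sup>2 / M"] unfolding \<delta>_def by auto
  have "C\<^sup>2 \<le> (norm (B v))\<^sup>2" using C_low[of v] C0 v by (intro power_mono) auto
  also have "\<dots> \<le> M * (q v + \<delta>)" using M[of v] unfolding Bform by (simp add: v)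
  also have "\<dots> < M * (C\<^sup>2 / M)" using v(2) M0 by (intro mult_strict_left_mono) auto
  finally show False using M0 by simp
qed

lemma subspace_closure:
  fixes X :: "'a::real_normed_vector set"
  assumes "subspace X" shows "subspace (closure X)"
proof (rule subspaceI)
  show "0 \<in> closure X" using assms closure_subset subspace_0 by blast
  fix x y assume "x \<in> closure X" "y \<in> closure X"
  then obtain f g where "\<And>n. f n \<in> X" "f \<longlonglongrightarrow> x" "\<And>n. g n \<in> X" "g \<longlonglongrightarrow> y"
    by (auto simp: closure_sequential)
  then show "x + y \<in> closure X"
    unfolding closure_sequential using assms
    by (intro exI[of _ "\<lambda>n. f n + g n"]) (auto intro: subspace_add tendsto_add)
next
  fix c x assume "x \<in> closure X"
  then obtain f where "\<And>n. f n \<in> X" "f \<longlonglongrightarrow> x" by (auto simp: closure_sequential)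
  then show "c *\<^sub>R x \<in> closure X"
    unfolding closure_sequential using assms
    by (intro exI[of _ "\<lambda>n. c *\<^sub>R f n"]) (auto intro: subspace_scale tendsto_scaleR)
qed

text \<open>The gap persists on the closure of \<open>range A\<close>, which contains everything
  orthogonal to the kernel. So the kernel components of \<open>f n\<close> differ from
  \<open>f n\<close> by a null sequence, and weak convergence to 0 makes them escape every
  finite-dimensional subspace: one more orthonormal kernel vector can always be added.\<close>

lemma orthonormal_in_kernel:
  fixes A :: "'a::{real_inner,complete_space} \<Rightarrow> 'a"
  assumes A: "bounded_linear A" and sym: "\<And>u v. inner (A u) v = inner u (A v)"
    and eps: "\<epsilon> > 0" and gap: "\<And>u. \<epsilon> * norm (A u) \<le> norm (A (A u))"
    and f1: "\<And>n. norm (f n) = 1" and Af: "(\<lambda>n. A (f n)) \<longlonglongrightarrow> 0"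
    and weak: "\<And>h. (\<lambda>n. inner (f n) h) \<longlonglongrightarrow> 0"
  shows "\<exists>E. finite E \<and> card E = k \<and> (\<forall>e\<in>E. A e = 0 \<and> norm e = 1) \<and>
           pairwise (\<lambda>e e'. inner e e' = 0) E"
proof -
  interpret A: bounded_linear A by fact
  define N where "N = {u. A u = 0}"
  have N: "subspace N" "closed N"
  proof -
    show "subspace N" unfolding N_def using A.linear_axioms by (rule linear_subspace_kernel)
    show "closed N" unfolding N_def
      by (intro closed_Collect_eq A.continuous_on continuous_intros)
  qed
  define X where "X = closure (range A)"
  have X: "subspace X" "closed X"
    unfolding X_def using A.linear_axioms by (auto intro!: subspace_closure linear_subspace_image)
  have XA: "\<epsilon> * norm x \<le> norm (A x)" if "x \<in> X" for x
  proof -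
    have "closed {u. \<epsilon> * norm u \<le> norm (A u)}"
      by (intro closed_Collect_le continuous_intros A.continuous_on)
    moreover have "range A \<subseteq> {u. \<epsilon> * norm u \<le> norm (A u)}" using gap by auto
    ultimately have "X \<subseteq> {u. \<epsilon> * norm u \<le> norm (A u)}" unfolding X_def by (simp add: closure_minimal)
    with that show ?thesis by blast
  qed
  \<comment> \<open>Subtracting from \<open>q\<close> its projection x onto \<open>X\<close> leaves
    a vector that A kills, by symmetry. It lies in \<open>N\<close> and is orthogonal to both
    \<open>q\<close> and x, so it vanishes.\<close>
  have orth_in_X: "q \<in> X" if q: "\<And>y. y \<in> N \<Longrightarrow> inner q y = 0" for q
  proof -
    obtain x where x: "x \<in> X" "\<And>y. y \<in> X \<Longrightarrow> inner (q - x) y = 0"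
      using orthogonal_projection_exists[OF X, of q] by blast
    have "A (A (q - x)) \<in> X" unfolding X_def using closure_subset[of "range A"] by (auto intro: subsetD)
    then have "inner (A (q - x)) (A (q - x)) = 0"
      using x(2) sym[of "q - x" "A (q - x)"] by simp
    then have "q - x \<in> N" by (simp add: N_def)
    then have "inner (q - x) (q - x) = 0"
      using q[of "q - x"] x(2)[of x] x(1) by (simp add: inner_diff_left inner_diff_right inner_commute)
    then show ?thesis using x(1) by simp
  qed
  have "\<exists>p\<in>N. \<forall>x\<in>N. inner (f n - p) x = 0" for n by (rule orthogonal_projection_exists[OF N])
  then obtain p where p: "\<And>n. p n \<in> N" "\<And>n x. x \<in> N \<Longrightarrow> inner (f n - p n) x = 0" by metis
  have pN: "A (p n) = 0" for n using p(1) by (simp add: N_def)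
  have q: "\<epsilon> * norm (f n - p n) \<le> norm (A (f n))" for n
    using XA[OF orth_in_X[OF p(2)], of n] by (simp add: A.diff pN)
  have q0: "(\<lambda>n. f n - p n) \<longlonglongrightarrow> 0"
  proof (rule Lim_null_comparison)
    show "\<forall>\<^sub>F n in sequentially. norm (f n - p n) \<le> norm (A (f n)) / \<epsilon>"
      using q eps by (simp add: field_simps)
    show "(\<lambda>n. norm (A (f n)) / \<epsilon>) \<longlonglongrightarrow> 0"
      using tendsto_divide[OF tendsto_norm[OF Af] tendsto_const[of \<epsilon>]] eps by simp
  qed
  show ?thesis
  proof (induction k)
    case 0 then show ?case by (intro exI[of _ "{}"]) auto
  next
    case (Suc k)
    then obtain E where E: "finite E" "card E = k" "\<And>e. e \<in> E \<Longrightarrow> A e = 0" "\<And>e. e \<in> E \<Longrightarrow> norm e = 1"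
      "pairwise (\<lambda>e e'. inner e e' = 0) E" by blast
    \<comment> \<open>Gram-Schmidt against \<open>E\<close>. The coefficients are taken from
      \<open>f n\<close>, which is weakly null; they agree with those of \<open>p n\<close> because
      \<open>E\<close> lies in the kernel.\<close>
    define w where "w n = p n - (\<Sum>e\<in>E. inner (f n) e *\<^sub>R e)" for n
    have "(\<lambda>n. (\<Sum>e\<in>E. inner (f n) e *\<^sub>R e)) \<longlonglongrightarrow> (\<Sum>e\<in>E. 0 *\<^sub>R e)"
      by (intro tendsto_intros weak)
    then have "(\<lambda>n. - (f n - p n) - (\<Sum>e\<in>E. inner (f n) e *\<^sub>R e)) \<longlonglongrightarrow> - 0 - (\<Sum>e\<in>E. 0 *\<^sub>R e)"
      by (intro tendsto_diff tendsto_minus q0)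
    then have "(\<lambda>n. w n - f n) \<longlonglongrightarrow> 0" by (simp add: w_def algebra_simps)
    then have "\<forall>\<^sub>F n in sequentially. norm (w n - f n) < 1"
      by (auto simp: tendsto_iff dist_norm dest: spec[of _ 1])
    then obtain n where n: "norm (w n - f n) < 1" by (auto simp: eventually_sequentially)
    then have w0: "w n \<noteq> 0" using f1[of n] by auto
    have fp: "inner (f n) e = inner (p n) e" if "e \<in> E" for e
      using p(2)[of e n] E(3)[OF that] by (simp add: N_def inner_diff_left)
    have orth: "inner (w n) e = 0" if e: "e \<in> E" for e
    proof -
      have "inner (\<Sum>e\<in>E. inner (f n) e *\<^sub>R e) e = (\<Sum>e'\<in>E. inner (f n) e' * inner e' e)"
        by (simp add: inner_sum_left)
      also have "\<dots> = (\<Sum>e'\<in>E. if e' = e then inner (f n) e else 0)"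
        using E(4,5) e by (intro sum.cong) (auto simp: pairwise_def norm_eq_sqrt_inner)
      also have "\<dots> = inner (f n) e" using E(1) e by simp
      finally show ?thesis using fp[OF e] by (simp add: w_def inner_diff_left)
    qed
    define e where "e = (1 / norm (w n)) *\<^sub>R w n"
    have e1: "norm e = 1" using w0 by (simp add: e_def)
    have orth_e: "inner e e' = 0" "inner e' e = 0" if "e' \<in> E" for e'
      using orth[OF that] by (auto simp: e_def inner_commute)
    have "e \<notin> E" using orth_e(1)[of e] e1 by auto
    moreover have "A e = 0"
      using E(3) by (simp add: e_def w_def A.scaleR A.diff A.sum pN)
    ultimately show ?case
      using E e1 orth_e by (intro exI[of _ "insert e E"]) (auto simp: pairwise_insert)
  qed
qed

section \<open>Square-summable functions\<close>

text \<open>The functions are complex-valued, but the real part of the Hermitian pairing makes this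
  a real Hilbert space below; complex scalars return as \<open>cscale\<close> and the full pairing
  as \<open>cinner\<close>.\<close>

typedef 'v ell2 = "{u :: 'v \<Rightarrow> complex. (\<lambda>x. (cmod (u x))\<^sup>2) summable_on UNIV}"
  morphisms coord Ell2
  by (rule exI[of _ "\<lambda>_. 0"]) simp

setup_lifting type_definition_ell2

lemma square_summable_mult:
  assumes "(\<lambda>x. (cmod (f x))\<^sup>2) summable_on UNIV" "(\<lambda>x. (cmod (g x))\<^sup>2) summable_on UNIV"
  shows "(\<lambda>x. f x * cnj (g x)) summable_on UNIV"
proof (rule abs_summable_summable, rule Infinite_Sum.abs_summable_on_comparison_test')
  show "(\<lambda>x. (cmod (f x))\<^sup>2 + (cmod (g x))\<^sup>2) summable_on UNIV" using assms by (rule summable_on_add)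
  fix x
  have "2 * (cmod (f x) * cmod (g x)) \<le> (cmod (f x))\<^sup>2 + (cmod (g x))\<^sup>2"
    using sum_squares_bound[of "cmod (f x)" "cmod (g x)"] by simp
  moreover have "0 \<le> cmod (f x) * cmod (g x)" by simp
  ultimately show "norm (f x * cnj (g x)) \<le> (cmod (f x))\<^sup>2 + (cmod (g x))\<^sup>2"
    unfolding norm_mult complex_mod_cnj by linarith
qed

lemma square_summable_add:
  assumes "(\<lambda>x. (cmod (f x))\<^sup>2) summable_on UNIV" "(\<lambda>x. (cmod (g x))\<^sup>2) summable_on UNIV"
  shows "(\<lambda>x. (cmod (f x + g x))\<^sup>2) summable_on UNIV"
proof (rule summable_on_comparison_test)
  show "(\<lambda>x. 2 * (cmod (f x))\<^sup>2 + 2 * (cmod (g x))\<^sup>2) summable_on UNIV"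
    using assms by (intro summable_on_add summable_on_cmult_right)
  fix x
  have "(cmod (f x + g x))\<^sup>2 \<le> (cmod (f x) + cmod (g x))\<^sup>2" by (intro power_mono norm_triangle_ineq) auto
  also have "\<dots> \<le> 2 * (cmod (f x))\<^sup>2 + 2 * (cmod (g x))\<^sup>2"
    using sum_squares_bound[of "cmod (f x)" "cmod (g x)"] by (simp add: power2_sum)
  finally show "(cmod (f x + g x))\<^sup>2 \<le> 2 * (cmod (f x))\<^sup>2 + 2 * (cmod (g x))\<^sup>2" .
qed auto

instantiation ell2 :: (type) real_inner
begin

lift_definition zero_ell2 :: "'a ell2" is "\<lambda>_. 0" by simp

lift_definition plus_ell2 :: "'a ell2 \<Rightarrow> 'a ell2 \<Rightarrow> 'a ell2" is "\<lambda>f g x. f x + g x"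
  by (rule square_summable_add)

lift_definition uminus_ell2 :: "'a ell2 \<Rightarrow> 'a ell2" is "\<lambda>f x. - f x" by simp

lift_definition minus_ell2 :: "'a ell2 \<Rightarrow> 'a ell2 \<Rightarrow> 'a ell2" is "\<lambda>f g x. f x - g x"
  using square_summable_add[of _ "\<lambda>x. - _ x"] by fastforce

lift_definition scaleR_ell2 :: "real \<Rightarrow> 'a ell2 \<Rightarrow> 'a ell2" is "\<lambda>r f x. r *\<^sub>R f x"
  by (simp add: power_mult_distrib summable_on_cmult_right)

lift_definition inner_ell2 :: "'a ell2 \<Rightarrow> 'a ell2 \<Rightarrow> real" is "\<lambda>f g. Re (\<Sum>\<^sub>\<infinity>x. f x * cnj (g x))" .

definition norm_ell2 :: "'a ell2 \<Rightarrow> real" where "norm_ell2 f = sqrt (inner f f)"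
definition dist_ell2 :: "'a ell2 \<Rightarrow> 'a ell2 \<Rightarrow> real" where "dist_ell2 f g = norm (f - g)"
definition sgn_ell2 :: "'a ell2 \<Rightarrow> 'a ell2" where "sgn_ell2 f = inverse (norm f) *\<^sub>R f"
definition uniformity_ell2 :: "('a ell2 \<times> 'a ell2) filter" where
  "uniformity_ell2 = (INF e\<in>{0<..}. principal {(f, g). dist f g < e})"
definition open_ell2 :: "'a ell2 set \<Rightarrow> bool" where
  "open_ell2 U = (\<forall>x\<in>U. \<forall>\<^sub>F (x', y) in uniformity. x' = x \<longrightarrow> y \<in> U)"

instance
proof
  fix f g h :: "'a ell2" and r s :: real
  show "f + g + h = f + (g + h)" "f + g = g + f" "0 + f = f" "- f + f = 0" "f - g = f + - g"
    "r *\<^sub>R (f + g) = r *\<^sub>R f + r *\<^sub>R g" "(r + s) *\<^sub>R f = r *\<^sub>R f + s *\<^sub>R f"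
    "r *\<^sub>R s *\<^sub>R f = (r * s) *\<^sub>R f" "1 *\<^sub>R f = f"
    by (transfer; simp add: algebra_simps scaleR_add_right scaleR_add_left)+
  show "dist f g = norm (f - g)" by (rule dist_ell2_def)
  show "sgn f = inverse (norm f) *\<^sub>R f" by (rule sgn_ell2_def)
  show "uniformity = (INF e\<in>{0<..}. principal {(f, g). dist f (g :: 'a ell2) < e})"
    by (rule uniformity_ell2_def)
  show "open U = (\<forall>x\<in>U. \<forall>\<^sub>F (x', y) in uniformity. x' = x \<longrightarrow> y \<in> U)" for U :: "'a ell2 set"
    by (rule open_ell2_def)
  show "norm f = sqrt (inner f f)" by (rule norm_ell2_def)
  show "inner f g = inner g f"
  proof transfer
    fix f g :: "'a \<Rightarrow> complex"
    have "(\<Sum>\<^sub>\<infinity>x. f x * cnj (g x)) = (\<Sum>\<^sub>\<infinity>x. cnj (g x * cnj (f x)))" by (simp add: mult.commute)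
    then show "Re (\<Sum>\<^sub>\<infinity>x. f x * cnj (g x)) = Re (\<Sum>\<^sub>\<infinity>x. g x * cnj (f x))"
      unfolding infsum_cnj by simp
  qed
  show "inner (f + g) h = inner f h + inner g h"
    by transfer (simp add: distrib_right infsum_add square_summable_mult)
  show "inner (r *\<^sub>R f) g = r * inner f g"
  proof transfer
    fix r f and g :: "'a \<Rightarrow> complex"
    have "(\<Sum>\<^sub>\<infinity>x. r *\<^sub>R f x * cnj (g x)) = (\<Sum>\<^sub>\<infinity>x. complex_of_real r * (f x * cnj (g x)))"
      by (simp add: scaleR_conv_of_real mult.assoc)
    then show "Re (\<Sum>\<^sub>\<infinity>x. r *\<^sub>R f x * cnj (g x)) = r * Re (\<Sum>\<^sub>\<infinity>x. f x * cnj (g x))"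
      by (simp add: infsum_cmult_right')
  qed
  have sq: "Re (\<Sum>\<^sub>\<infinity>x. f x * cnj (f x)) = (\<Sum>\<^sub>\<infinity>x. (cmod (f x))\<^sup>2)"
    if "(\<lambda>x. (cmod (f x))\<^sup>2) summable_on UNIV" for f :: "'a \<Rightarrow> complex"
    using square_summable_mult[OF that that]
    by (simp add: infsum_Re[symmetric] complex_norm_square[symmetric] del: of_real_power)
  show "0 \<le> inner f f" by transfer (simp add: sq infsum_nonneg)
  show "inner f f = 0 \<longleftrightarrow> f = 0"
  proof transfer
    fix f :: "'a \<Rightarrow> complex" assume f: "(\<lambda>x. (cmod (f x))\<^sup>2) summable_on UNIV"
    show "Re (\<Sum>\<^sub>\<infinity>x. f x * cnj (f x)) = 0 \<longleftrightarrow> f = (\<lambda>_. 0)"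
    proof
      assume "Re (\<Sum>\<^sub>\<infinity>x. f x * cnj (f x)) = 0"
      then have "(\<Sum>\<^sub>\<infinity>x. (cmod (f x))\<^sup>2) \<le> 0" using f sq by simp
      then have "(cmod (f x))\<^sup>2 = 0" for x
        using f by (intro nonneg_infsum_le_0D[of "\<lambda>x. (cmod (f x))\<^sup>2" UNIV]) auto
      then show "f = (\<lambda>_. 0)" by auto
    qed simp
  qed
qed

end

lemma ell2_eqI: "(\<And>x. coord f x = coord g x) \<Longrightarrow> f = g"
  by (simp add: coord_inject[symmetric] fun_eq_iff)

lemma coord_zero [simp]: "coord 0 x = 0" by transfer simp
lemma coord_add [simp]: "coord (f + g) x = coord f x + coord g x" by transfer simp
lemma coord_diff [simp]: "coord (f - g) x = coord f x - coord g x" by transfer simp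
lemma coord_scaleR [simp]: "coord (r *\<^sub>R f) x = r *\<^sub>R coord f x" by transfer simp
lemma coord_sum [simp]: "coord (sum f A) x = (\<Sum>a\<in>A. coord (f a) x)"
  by (induction A rule: infinite_finite_induct) auto

lemma coord_summable: "(\<lambda>x. (cmod (coord f x))\<^sup>2) summable_on UNIV"
  by transfer simp

lemma norm_ell2_sq: "(norm f)\<^sup>2 = (\<Sum>\<^sub>\<infinity>x. (cmod (coord f x))\<^sup>2)"
  unfolding power2_norm_eq_inner[of f] inner_ell2.rep_eq
  using square_summable_mult[OF coord_summable coord_summable, of f f]
  by (subst infsum_Re[symmetric]) (simp_all add: complex_norm_square[symmetric] del: of_real_power)

lemma sum_coord_le_norm: "finite F \<Longrightarrow> (\<Sum>x\<in>F. (cmod (coord f x))\<^sup>2) \<le> (norm f)\<^sup>2"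
  unfolding norm_ell2_sq by (intro finite_sum_le_infsum coord_summable) auto

lemma coord_le_norm: "cmod (coord f x) \<le> norm f"
  using sum_coord_le_norm[of "{x}" f] by (auto intro: power2_le_imp_le[OF _ norm_ge_zero])

lemma norm_ell2_leI:
  assumes "M \<ge> 0" "\<And>F. finite F \<Longrightarrow> (\<Sum>x\<in>F. (cmod (coord f x))\<^sup>2) \<le> M\<^sup>2"
  shows "norm f \<le> M"
proof (rule power2_le_imp_le)
  show "(norm f)\<^sup>2 \<le> M\<^sup>2" unfolding norm_ell2_sq
    using assms by (intro infsum_le_finite_sums coord_summable) auto
qed fact

lemma square_summableI:
  assumes "\<And>F. finite F \<Longrightarrow> (\<Sum>x\<in>F. (cmod (u x))\<^sup>2) \<le> M"
  shows "(\<lambda>x. (cmod (u x))\<^sup>2) summable_on UNIV"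
  by (rule nonneg_bounded_partial_sums_imp_summable_on[where C=M])
     (use assms in \<open>auto intro!: eventually_finite_subsets_at_top_weakI\<close>)

lemma coord_Ell2: "(\<lambda>x. (cmod (u x))\<^sup>2) summable_on UNIV \<Longrightarrow> coord (Ell2 u) = u"
  by (simp add: Ell2_inverse)

lemma bounded_linear_coord: "bounded_linear (\<lambda>f. coord f x)"
  by (rule bounded_linear_intro[where K=1]) (auto simp: coord_le_norm)

lemmas tendsto_coord = bounded_linear.tendsto[OF bounded_linear_coord]

instance ell2 :: (type) complete_space
proof
  fix X :: "nat \<Rightarrow> 'a ell2" assume X: "Cauchy X"
  have "Cauchy (\<lambda>n. coord (X n) x)" for x
    by (rule bounded_linear.Cauchy[OF bounded_linear_coord X])
  then have "\<exists>l. (\<lambda>n. coord (X n) x) \<longlonglongrightarrow> l" for x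
    by (simp add: Cauchy_convergent_iff convergent_def)
  then obtain u where u: "\<And>x. (\<lambda>n. coord (X n) x) \<longlonglongrightarrow> u x" by metis
  \<comment> \<open>The bound on \<open>X n - X k\<close> is passed to the limit in k over a finite
    set \<open>F\<close>. It does not depend on \<open>F\<close>, so it yields both
    square-summability of the pointwise limit and convergence in norm.\<close>
  have bound: "(\<Sum>x\<in>F. (cmod (coord (X n) x - u x))\<^sup>2) \<le> e\<^sup>2"
    if "\<And>k. k \<ge> N \<Longrightarrow> norm (X n - X k) \<le> e" "finite F" for N n e F
  proof (rule LIMSEQ_le_const2)
    show "(\<lambda>k. \<Sum>x\<in>F. (cmod (coord (X n) x - coord (X k) x))\<^sup>2) \<longlonglongrightarrow> (\<Sum>x\<in>F. (cmod (coord (X n) x - u x))\<^sup>2)"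
      by (intro tendsto_intros u)
    have "(\<Sum>x\<in>F. (cmod (coord (X n) x - coord (X k) x))\<^sup>2) \<le> e\<^sup>2" if "k \<ge> N" for k
      using sum_coord_le_norm[of F "X n - X k"] power_mono[OF \<open>k \<ge> N \<Longrightarrow> norm (X n - X k) \<le> e\<close>[OF that], of 2] \<open>finite F\<close>
      by simp
    then show "\<exists>N. \<forall>k\<ge>N. (\<Sum>x\<in>F. (cmod (coord (X n) x - coord (X k) x))\<^sup>2) \<le> e\<^sup>2" by blast
  qed
  have X': "\<exists>N. \<forall>n\<ge>N. \<forall>k\<ge>N. norm (X n - X k) \<le> e" if "e > 0" for e
    using metric_CauchyD[OF X that] by (metis dist_norm less_imp_le)
  obtain N where N: "\<And>n k. n \<ge> N \<Longrightarrow> k \<ge> N \<Longrightarrow> norm (X n - X k) \<le> 1" using X'[of 1] by auto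
  have "(\<lambda>x. (cmod (coord (X N) x - u x))\<^sup>2) summable_on UNIV"
    using bound[of N N 1] N by (intro square_summableI[where M="1\<^sup>2"]) auto
  from square_summable_add[OF coord_summable, of "\<lambda>x. - (coord (X N) x - u x)" "X N"] this
  have us: "(\<lambda>x. (cmod (u x))\<^sup>2) summable_on UNIV" by (simp add: norm_minus_commute)
  have "X \<longlonglongrightarrow> Ell2 u"
  proof (rule metric_LIMSEQ_I)
    fix r :: real assume "r > 0"
    then obtain N where N: "\<And>n k. n \<ge> N \<Longrightarrow> k \<ge> N \<Longrightarrow> norm (X n - X k) \<le> r/2" using X'[of "r/2"] by auto
    have "norm (X n - Ell2 u) \<le> r/2" if "n \<ge> N" for n
      using bound[of N n "r/2"] N[OF that] \<open>r > 0\<close> by (intro norm_ell2_leI) (auto simp: coord_Ell2[OF us])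
    then show "\<exists>no. \<forall>n\<ge>no. dist (X n) (Ell2 u) < r" using \<open>r > 0\<close> by (force simp: dist_norm)
  qed
  then show "convergent X" by (auto simp: convergent_def)
qed

section \<open>Complex scalars and the Hermitian pairing\<close>

lift_definition cscale :: "complex \<Rightarrow> 'v ell2 \<Rightarrow> 'v ell2" is "\<lambda>w f x. w * f x"
  by (simp add: norm_mult power_mult_distrib summable_on_cmult_right)

lemma coord_cscale [simp]: "coord (cscale w f) x = w * coord f x" by transfer simp

lemma inner_cscale: "inner (cscale w f) g = inner f (cscale (cnj w) g)"
  unfolding inner_ell2.rep_eq by (simp add: algebra_simps)

lemma cscale_cscale: "cscale w (cscale z f) = cscale (w * z) f"
  by (rule ell2_eqI) simp

lemma cscale_of_real: "cscale (complex_of_real r) f = r *\<^sub>R f"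
  by (rule ell2_eqI) (simp add: scaleR_conv_of_real)

lemma norm_cscale: "norm (cscale w f) = cmod w * norm f"
proof -
  have "(norm (cscale w f))\<^sup>2 = (cmod w * norm f)\<^sup>2"
    unfolding norm_ell2_sq power_mult_distrib by (simp add: norm_mult power_mult_distrib infsum_cmult_right')
  then show ?thesis by simp
qed

lemma bounded_linear_cscale: "bounded_linear (cscale w)"
  by (rule bounded_linear_intro[where K="cmod w"])
     (auto simp: norm_cscale intro!: ell2_eqI simp: algebra_simps)

definition cinner :: "'v ell2 \<Rightarrow> 'v ell2 \<Rightarrow> complex" where
  "cinner f g = (\<Sum>\<^sub>\<infinity>x. coord f x * cnj (coord g x))"

text \<open>The imaginary part of z is the real part of -i z, and -i arises by conjugating i in the
  second argument. This transfers linearity and continuity from the real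
  \<open>inner\<close>.\<close>

lemma cinner_conv_inner: "cinner f g = Complex (inner f g) (inner f (cscale \<i> g))"
proof -
  have "(\<Sum>\<^sub>\<infinity>x. coord f x * cnj (coord (cscale \<i> g) x)) = - \<i> * (\<Sum>\<^sub>\<infinity>x. coord f x * cnj (coord g x))"
    by (simp add: infsum_cmult_right' mult.left_commute flip: infsum_cmult_right')
  then show ?thesis unfolding cinner_def inner_ell2.rep_eq by (simp add: complex_eq_iff)
qed

lemma tendsto_cinner:
  assumes "(f \<longlongrightarrow> a) F" "(g \<longlongrightarrow> b) F" shows "((\<lambda>x. cinner (f x) (g x)) \<longlongrightarrow> cinner a b) F"
  unfolding cinner_conv_inner
  by (intro tendsto_Complex tendsto_inner assms bounded_linear.tendsto[OF bounded_linear_cscale])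

lemma cinner_eqI:
  assumes "\<And>g. cinner f g = cinner f' g" shows "f = f'"
proof -
  have "inner (f - f') (f - f') = 0"
    using assms[of "f - f'"] by (simp add: cinner_conv_inner inner_diff_left)
  then show ?thesis by simp
qed

lemma cinner_add_left: "cinner (f + g) h = cinner f h + cinner g h"
  by (simp add: cinner_conv_inner inner_add_left complex_eq_iff)

section \<open>Multiplication operators, restrictions and coordinate vectors\<close>

definition diag :: "('v \<Rightarrow> real) \<Rightarrow> 'v ell2 \<Rightarrow> 'v ell2" where
  "diag \<theta> f = Ell2 (\<lambda>x. complex_of_real (\<theta> x) * coord f x)"

lemma coord_diag:
  assumes "\<And>x. \<bar>\<theta> x\<bar> \<le> c" shows "coord (diag \<theta> f) x = complex_of_real (\<theta> x) * coord f x"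
proof -
  have "(\<lambda>x. (cmod (complex_of_real (\<theta> x) * coord f x))\<^sup>2) summable_on UNIV"
  proof (rule summable_on_comparison_test)
    show "(\<lambda>x. c\<^sup>2 * (cmod (coord f x))\<^sup>2) summable_on UNIV"
      by (intro summable_on_cmult_right coord_summable)
    show "(cmod (complex_of_real (\<theta> x) * coord f x))\<^sup>2 \<le> c\<^sup>2 * (cmod (coord f x))\<^sup>2" for x
      using power_mono[OF assms, of x 2] by (simp add: norm_mult power_mult_distrib mult_right_mono)
  qed auto
  then show ?thesis by (simp add: diag_def coord_Ell2)
qed

lemma norm_diag_le:
  assumes "\<And>x. \<bar>\<theta> x\<bar> \<le> c" shows "norm (diag \<theta> f) \<le> c * norm f"
proof (rule norm_ell2_leI)
  have c: "c \<ge> 0" using assms abs_ge_zero order_trans by blast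
  then show "0 \<le> c * norm f" by simp
  fix F :: "'a set" assume F: "finite F"
  have "(\<Sum>x\<in>F. (cmod (coord (diag \<theta> f) x))\<^sup>2) \<le> (\<Sum>x\<in>F. c\<^sup>2 * (cmod (coord f x))\<^sup>2)"
    using power_mono[OF assms, of _ 2]
    by (intro sum_mono) (simp add: coord_diag[OF assms] norm_mult power_mult_distrib mult_right_mono)
  also have "\<dots> \<le> c\<^sup>2 * (norm f)\<^sup>2"
    using sum_coord_le_norm[OF F] by (simp add: mult_left_mono flip: sum_distrib_left)
  finally show "(\<Sum>x\<in>F. (cmod (coord (diag \<theta> f) x))\<^sup>2) \<le> (c * norm f)\<^sup>2" by (simp add: power_mult_distrib)
qed

lemma bounded_linear_diag:
  assumes "\<And>x. \<bar>\<theta> x\<bar> \<le> c" shows "bounded_linear (diag \<theta>)"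
  using norm_diag_le[OF assms]
  by (intro bounded_linear_intro[where K=c])
     (auto intro!: ell2_eqI simp: coord_diag[OF assms] algebra_simps)

lemma inner_diag:
  assumes "\<And>x. \<bar>\<theta> x\<bar> \<le> c" shows "inner (diag \<theta> f) g = inner f (diag \<theta> g)"
  unfolding inner_ell2.rep_eq by (simp add: coord_diag[OF assms] algebra_simps)

lemma cinner_diag:
  assumes "\<And>x. \<bar>\<theta> x\<bar> \<le> c" shows "cinner (diag \<theta> f) g = cinner f (diag \<theta> g)"
  unfolding cinner_def by (simp add: coord_diag[OF assms] algebra_simps)

lemma diag_cscale:
  assumes "\<And>x. \<bar>\<theta> x\<bar> \<le> c" shows "diag \<theta> (cscale w f) = cscale w (diag \<theta> f)"
  by (rule ell2_eqI) (simp add: coord_diag[OF assms])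

definition restr :: "'v set \<Rightarrow> 'v ell2 \<Rightarrow> 'v ell2" where
  "restr K = diag (\<lambda>x. if x \<in> K then 1 else 0)"

lemma coord_restr [simp]: "coord (restr K f) x = (if x \<in> K then coord f x else 0)"
  unfolding restr_def by (subst coord_diag[where c=1]) auto

lemma bounded_linear_restr: "bounded_linear (restr K)"
  unfolding restr_def by (rule bounded_linear_diag[where c=1]) auto

lemma norm_restr_le: "norm (restr K f) \<le> norm f"
  unfolding restr_def using norm_diag_le[where c=1 and \<theta>="\<lambda>x. if x \<in> K then 1 else 0"] by auto

lemma inner_restr: "inner (restr K f) g = inner f (restr K g)"
  unfolding restr_def by (rule inner_diag[where c=1]) auto

lemma restr_restr: "restr K (restr L f) = restr (K \<inter> L) f"
  by (rule ell2_eqI) simp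

lemma restr_Compl: "restr (- K) f = f - restr K f"
  by (rule ell2_eqI) simp

lemma norm_restr_finite: "finite K \<Longrightarrow> (norm (restr K f))\<^sup>2 = (\<Sum>x\<in>K. (cmod (coord f x))\<^sup>2)"
  unfolding norm_ell2_sq
  by (subst infsum_cong_neutral[where T=K and g="\<lambda>x. (cmod (coord f x))\<^sup>2"]) auto

text \<open>Pythagoras turns the error into the difference between the squared norm and its finite
  partial sums.\<close>

lemma restr_tendsto: "((\<lambda>K. restr K f) \<longlongrightarrow> f) (finite_subsets_at_top UNIV)"
proof -
  have pyth: "(norm (restr K f - f))\<^sup>2 = (norm f)\<^sup>2 - (norm (restr K f))\<^sup>2" for K
  proof -
    have "inner (restr K f) (restr K f) = inner (restr K f) f"
      unfolding inner_restr restr_restr by simp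
    then show ?thesis
      unfolding power2_norm_eq_inner by (simp add: inner_diff_left inner_diff_right inner_commute)
  qed
  have "((\<lambda>K. \<Sum>x\<in>K. (cmod (coord f x))\<^sup>2) \<longlongrightarrow> (norm f)\<^sup>2) (finite_subsets_at_top UNIV)"
    unfolding norm_ell2_sq by (rule infsum_tendsto[OF coord_summable])
  then have "((\<lambda>K. (norm (restr K f))\<^sup>2) \<longlongrightarrow> (norm f)\<^sup>2) (finite_subsets_at_top UNIV)"
    by (rule Lim_transform_eventually)
       (auto intro!: eventually_finite_subsets_at_top_weakI simp: norm_restr_finite)
  from tendsto_diff[OF tendsto_const[of "(norm f)\<^sup>2"] this]
  have "((\<lambda>K. (norm (restr K f - f))\<^sup>2) \<longlongrightarrow> 0) (finite_subsets_at_top UNIV)"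
    unfolding pyth by simp
  from tendsto_real_sqrt[OF this]
  have "((\<lambda>K. norm (restr K f - f)) \<longlongrightarrow> 0) (finite_subsets_at_top UNIV)" by simp
  then show ?thesis by (rule LIM_zero_cancel[OF tendsto_norm_zero_cancel])
qed

lemma restr_lessThan_tendsto:
  assumes v: "bij (v :: nat \<Rightarrow> 'v)"
  shows "(\<lambda>n. restr (v ` {..<n}) f) \<longlonglongrightarrow> f"
proof -
  have "filterlim (\<lambda>n. v ` {..<n}) (finite_subsets_at_top UNIV) sequentially"
  proof (rule filterlim_finite_subsets_at_top[THEN iffD2], intro allI impI)
    fix X :: "'v set" assume "finite X \<and> X \<subseteq> UNIV"
    then obtain N where "inv v ` X \<subseteq> {..<N}" using finite_nat_bounded by blast
    note N = this
    have "X \<subseteq> v ` {..<n}" if "n \<ge> N" for n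
    proof
      fix x assume "x \<in> X"
      with N that have "inv v x \<in> {..<n}" by fastforce
      then show "x \<in> v ` {..<n}"
        using v by (intro image_eqI[where x="inv v x"]) (auto simp: bij_def surj_f_inv_f)
    qed
    then show "\<forall>\<^sub>F n in sequentially. finite (v ` {..<n}) \<and> X \<subseteq> v ` {..<n} \<and> v ` {..<n} \<subseteq> UNIV"
      by (auto simp: eventually_sequentially)
  qed
  from filterlim_compose[OF restr_tendsto this] show ?thesis .
qed

definition basis_vec :: "'v \<Rightarrow> complex \<Rightarrow> 'v ell2" where
  "basis_vec x z = Ell2 (\<lambda>y. if y = x then z else 0)"

lemma coord_basis_vec [simp]: "coord (basis_vec x z) y = (if y = x then z else 0)"
proof -
  have "(\<lambda>y. (cmod (if y = x then z else 0))\<^sup>2) summable_on UNIV"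
    by (rule finite_nonzero_values_imp_summable_on, rule finite_subset[of _ "{x}"]) auto
  then show ?thesis by (simp add: basis_vec_def coord_Ell2)
qed

lemma norm_basis_vec [simp]: "norm (basis_vec x z) = cmod z"
proof -
  have "restr {x} (basis_vec x z) = basis_vec x z" by (rule ell2_eqI) simp
  with norm_restr_finite[of "{x}" "basis_vec x z"] show ?thesis by simp
qed

lemma bounded_linear_eq_on_finite_support:
  fixes P Q :: "'v ell2 \<Rightarrow> 'b::real_normed_vector"
  assumes "bounded_linear P" "bounded_linear Q"
    and eq: "\<And>K. finite K \<Longrightarrow> P (restr K f) = Q (restr K f)"
  shows "P f = Q f"
proof (rule tendsto_unique)
  show "((\<lambda>K. P (restr K f)) \<longlongrightarrow> P f) (finite_subsets_at_top UNIV)"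
    by (rule bounded_linear.tendsto[OF assms(1) restr_tendsto])
  have "((\<lambda>K. Q (restr K f)) \<longlongrightarrow> Q f) (finite_subsets_at_top UNIV)"
    by (rule bounded_linear.tendsto[OF assms(2) restr_tendsto])
  then show "((\<lambda>K. P (restr K f)) \<longlongrightarrow> Q f) (finite_subsets_at_top UNIV)"
    by (rule Lim_transform_eventually) (auto intro!: eventually_finite_subsets_at_top_weakI simp: eq)
qed simp

section \<open>Compact self-adjoint operators\<close>

lemma inner_basis_vec: "inner f (basis_vec x z) = Re (coord f x * cnj z)"
proof -
  have "(\<Sum>\<^sub>\<infinity>y. coord f y * cnj (coord (basis_vec x z) y)) = (\<Sum>\<^sub>\<infinity>y\<in>{x}. coord f y * cnj z)"
    by (rule infsum_cong_neutral) auto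
  then show ?thesis unfolding inner_ell2.rep_eq by simp
qed

lemma bounded_linear_basis_vec: "bounded_linear (basis_vec x)"
  by (rule bounded_linear_intro[where K=1]) (auto intro!: ell2_eqI)

lemma basis_vec_zero: "basis_vec x 0 = 0"
  by (rule ell2_eqI) simp

lemma restr_eq_sum: "finite K \<Longrightarrow> restr K f = (\<Sum>x\<in>K. basis_vec x (coord f x))"
  by (rule ell2_eqI) (auto simp: sum.delta)

lemma tendsto_restr_finite:
  assumes "finite K" "\<And>x. x \<in> K \<Longrightarrow> ((\<lambda>n. coord (f n) x) \<longlongrightarrow> u x) F"
  shows "((\<lambda>n. restr K (f n)) \<longlongrightarrow> (\<Sum>x\<in>K. basis_vec x (u x))) F"
  unfolding restr_eq_sum[OF assms(1)]
  by (intro tendsto_sum bounded_linear.tendsto[OF bounded_linear_basis_vec] assms)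

lemma cscale_zero: "cscale w 0 = 0"
  by (rule ell2_eqI) simp

lemma inner_cscale_self: "inner (cscale z g) g = Re z * (norm g)\<^sup>2"
proof -
  \<comment> \<open>Multiplication by i is skew for the real inner product.\<close>
  have "inner (cscale \<i> g) g = 0"
    using inner_cscale[of \<i> g g] bounded_linear.linear[OF bounded_linear_cscale]
      cscale_cscale[of "-1" \<i> g] cscale_of_real[of "-1" "cscale \<i> g"]
    by (simp add: inner_commute)
  moreover have "cscale z g = Re z *\<^sub>R g + Im z *\<^sub>R cscale \<i> g"
    by (rule ell2_eqI) (simp add: scaleR_conv_of_real complex_eq_iff)
  ultimately show ?thesis by (simp add: inner_add_left power2_norm_eq_inner)
qed

text \<open>Large values of \<theta> occur at finitely many points only, where coordinatewise
  convergence along a diagonal subsequence suffices; at all other points multiplication by \<theta>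
  is uniformly small.\<close>

lemma diag_compact:
  fixes v :: "nat \<Rightarrow> 'v" and f :: "nat \<Rightarrow> 'v ell2"
  assumes \<theta>: "\<And>x. \<bar>\<theta> x\<bar> \<le> c" and small: "\<And>e. e > 0 \<Longrightarrow> finite {x. \<bar>\<theta> x\<bar> \<ge> e}"
    and v: "bij v" and f: "\<And>n. norm (f n) \<le> M"
  shows "\<exists>r l. strict_mono r \<and> (\<lambda>n. diag \<theta> (f (r n))) \<longlonglongrightarrow> l"
proof -
  interpret S: bounded_linear "diag \<theta>" by (rule bounded_linear_diag[OF \<theta>])
  define P where "P n s \<longleftrightarrow> convergent (\<lambda>i. coord (f (s i)) (v n))" for n and s :: "nat \<Rightarrow> nat"
  interpret subseqs P
  proof
    fix n and s :: "nat \<Rightarrow> nat"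
    have "bounded (range (\<lambda>i. coord (f (s i)) (v n)))"
      by (rule boundedI[of _ M]) (auto intro: order_trans[OF coord_le_norm f])
    from bounded_imp_convergent_subsequence[OF this]
    obtain l r where "strict_mono r" "((\<lambda>i. coord (f (s i)) (v n)) \<circ> r) \<longlonglongrightarrow> l" by blast
    then show "\<exists>r'. strict_mono r' \<and> P n (s \<circ> r')"
      unfolding P_def convergent_def by (intro exI[of _ r]) (auto simp: o_def)
  qed
  have "convergent (\<lambda>i. coord (f (diagseq i)) (v n))" for n
  proof -
    have "P n (diagseq \<circ> ((+) (Suc n)))"
    proof (rule diagseq_holds)
      show "P n (s \<circ> r)" if "strict_mono r" "P n s" for r s n
        using convergent_subseq_convergent[OF that(2)[unfolded P_def] that(1)]
        by (simp add: P_def o_def)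
    qed
    then have "convergent (\<lambda>i. coord (f (diagseq (i + Suc n))) (v n))"
      by (simp add: P_def o_def add.commute)
    then show ?thesis by (subst (asm) convergent_ignore_initial_segment)
  qed
  then have "\<exists>l. (\<lambda>i. coord (f (diagseq i)) x) \<longlonglongrightarrow> l" for x
    using v bij_pointE[OF v, of x] unfolding convergent_def by metis
  then obtain u where u: "\<And>x. (\<lambda>i. coord (f (diagseq i)) x) \<longlonglongrightarrow> u x" by metis
  have c: "c \<ge> 0" using \<theta> abs_ge_zero order_trans by blast
  have M: "M \<ge> 0" using f[of 0] norm_ge_zero order_trans by blast
  have "Cauchy (\<lambda>n. diag \<theta> (f (diagseq n)))"
  proof (rule metric_CauchyI)
    fix e :: real assume e: "e > 0"
    \<comment> \<open>At most e/2 comes from the points outside \<open>K\<close>, since differences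
      have norm at most 2 M; the summand 4 keeps the denominator positive when M = 0. Likewise e /
      (2 c + 2) below leaves less than e/2 for the points of \<open>K\<close>.\<close>
    define e' where "e' = e / (4 * M + 4)"
    have e': "e' > 0" "e' * (2 * M) \<le> e / 2" using e M by (auto simp: e'_def field_simps)
    define K where "K = {x. \<bar>\<theta> x\<bar> \<ge> e'}"
    have K: "finite K" unfolding K_def using small e' by blast
    have "convergent (\<lambda>n. restr K (f (diagseq n)))"
      using tendsto_restr_finite[OF K u] by (auto simp: convergent_def)
    then have "Cauchy (\<lambda>n. restr K (f (diagseq n)))" by (rule convergent_Cauchy)
    from metric_CauchyD[OF this, of "e / (2 * c + 2)"] obtain N where
      N: "\<And>n k. n \<ge> N \<Longrightarrow> k \<ge> N \<Longrightarrow> dist (restr K (f (diagseq n))) (restr K (f (diagseq k))) < e / (2 * c + 2)"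
      using e c by (auto simp: divide_pos_pos)
    have "dist (diag \<theta> (f (diagseq n))) (diag \<theta> (f (diagseq k))) < e" if nk: "n \<ge> N" "k \<ge> N" for n k
    proof -
      define g where "g = f (diagseq n) - f (diagseq k)"
      have gM: "norm g \<le> 2 * M" unfolding g_def
        using norm_triangle_ineq4[of "f (diagseq n)" "f (diagseq k)"] f[of "diagseq n"] f[of "diagseq k"] by linarith
      have "diag \<theta> g = diag \<theta> (restr K g) + diag (\<lambda>x. if x \<in> K then 0 else \<theta> x) g"
        using \<theta> c by (intro ell2_eqI) (simp add: coord_diag[where c=c])
      also have "norm \<dots> \<le> norm (diag \<theta> (restr K g)) + norm (diag (\<lambda>x. if x \<in> K then 0 else \<theta> x) g)"
        by (rule norm_triangle_ineq)
      also have "norm (diag \<theta> (restr K g)) \<le> c * norm (restr K g)" by (rule norm_diag_le[OF \<theta>])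
      also have "norm (diag (\<lambda>x. if x \<in> K then 0 else \<theta> x) g) \<le> e' * norm g"
        using e' by (intro norm_diag_le) (auto simp: K_def)
      also have "e' * norm g \<le> e / 2" using mult_left_mono[OF gM, of e'] e' by linarith
      also have "c * norm (restr K g) \<le> c * (e / (2 * c + 2))"
        using N[OF nk] c unfolding dist_norm g_def linear_diff[OF bounded_linear.linear[OF bounded_linear_restr]]
        by (intro mult_left_mono) (auto intro: less_imp_le)
      also have "\<dots> < e / 2" using e c by (simp add: field_simps)
      finally show ?thesis by (simp add: dist_norm g_def S.diff)
    qed
    then show "\<exists>N. \<forall>n\<ge>N. \<forall>k\<ge>N. dist (diag \<theta> (f (diagseq n))) (diag \<theta> (f (diagseq k))) < e" by blast
  qed
  then obtain l where "(\<lambda>n. diag \<theta> (f (diagseq n))) \<longlonglongrightarrow> l"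
    using Cauchy_convergent_iff convergent_def by blast
  with subseq_diagseq show ?thesis by blast
qed

text \<open>Once R is the resolvent, this is (L - z) (L + 1)^-1 at w = z + 1. Unlike R - 1/w it
  makes sense at w = 0.\<close>

definition pencil :: "('v ell2 \<Rightarrow> 'v ell2) \<Rightarrow> complex \<Rightarrow> 'v ell2 \<Rightarrow> 'v ell2" where
  "pencil R w f = f - cscale w (R f)"

text \<open>The lower bound accompanies the bijection to match the bounded inverse demanded in
  \<open>spectrum_L\<close>.\<close>

definition regular :: "('v ell2 \<Rightarrow> 'v ell2) \<Rightarrow> complex \<Rightarrow> bool" where
  "regular R w \<longleftrightarrow> bij (pencil R w) \<and> (\<exists>c>0. \<forall>f. c * norm f \<le> norm (pencil R w f))"

locale selfadjoint_ell2 =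
  fixes R :: "'v ell2 \<Rightarrow> 'v ell2"
  assumes bl: "bounded_linear R"
    and sym: "inner (R f) g = inner f (R g)"
    and R_cscale: "R (cscale w f) = cscale w (R f)"
begin

sublocale R: bounded_linear R by (rule bl)

lemma bounded_linear_pencil: "bounded_linear (pencil R w)"
  unfolding pencil_def
  by (intro bounded_linear_sub bounded_linear_ident bounded_linear_compose[OF bounded_linear_cscale bl])

lemma inner_pencil: "inner (pencil R w f) g = inner f (pencil R (cnj w) g)"
  by (simp add: pencil_def inner_diff_left inner_diff_right inner_cscale sym R_cscale)

text \<open>R is symmetric and commutes with i, so \<open>e\<close> and i R e are orthogonal;
  inserting e = w R e, this inner product is Im w times the squared norm of R e.\<close>

lemma eigen_real:
  assumes e: "e \<noteq> 0" "pencil R w e = 0" shows "Im w = 0"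
proof -
  have ew: "e = cscale w (R e)" using e(2) by (simp add: pencil_def)
  have "R e \<noteq> 0"
  proof
    assume "R e = 0"
    then have "e = 0" using ew by (simp add: cscale_zero)
    then show False using e by simp
  qed
  have "inner e (cscale \<i> (R e)) = inner (R e) (cscale \<i> e)" by (simp add: sym flip: R_cscale)
  also have "\<dots> = inner (cscale (- \<i>) (R e)) e" by (simp add: inner_cscale)
  also have "cscale (- \<i>) (R e) = - cscale \<i> (R e)"
    using cscale_cscale[of "-1" \<i> "R e"] cscale_of_real[of "-1" "cscale \<i> (R e)"] by simp
  finally have "inner e (cscale \<i> (R e)) = 0" by (simp add: inner_commute)
  then have "inner (cscale w (R e)) (cscale \<i> (R e)) = 0" using ew by simp
  then have "inner (cscale (- \<i> * w) (R e)) (R e) = 0"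
    using inner_cscale[of "- \<i>" "cscale w (R e)" "R e"] by (simp add: cscale_cscale)
  then show ?thesis using \<open>R e \<noteq> 0\<close> by (simp add: inner_cscale_self)
qed

end

locale compact_selfadjoint_ell2 = selfadjoint_ell2 R for R :: "'v ell2 \<Rightarrow> 'v ell2" +
  assumes compact: "(\<And>n. norm (f n) \<le> M) \<Longrightarrow> \<exists>r l. strict_mono (r :: nat \<Rightarrow> nat) \<and> (\<lambda>n. R (f (r n))) \<longlonglongrightarrow> l"
begin

text \<open>\<open>f n\<close> is its pencil value plus w n times R (f n), and compactness makes the
  second summand converge along a subsequence.\<close>

lemma approximate_kernel_convergent:
  assumes f: "\<And>n. norm (f n) = 1" and w: "w \<longlonglongrightarrow> w0" and 0: "(\<lambda>n. pencil R (w n) (f n)) \<longlonglongrightarrow> 0"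
  shows "\<exists>r l. strict_mono r \<and> (\<lambda>n. f (r n)) \<longlonglongrightarrow> l \<and> norm l = 1 \<and> pencil R w0 l = 0"
proof -
  obtain r l where r: "strict_mono (r :: nat \<Rightarrow> nat)" and l: "(\<lambda>n. R (f (r n))) \<longlonglongrightarrow> l"
    using compact[of f 1] f by auto
  have wr: "(\<lambda>n. w (r n)) \<longlonglongrightarrow> w0" and 0: "(\<lambda>n. pencil R (w (r n)) (f (r n))) \<longlonglongrightarrow> 0"
    using LIMSEQ_subseq_LIMSEQ[OF w r] LIMSEQ_subseq_LIMSEQ[OF 0 r] by (auto simp: o_def)
  have "(\<lambda>n. cscale (w (r n)) (R (f (r n)))) \<longlonglongrightarrow> cscale w0 l"
  proof (rule Lim_transform2)
    show "(\<lambda>n. cscale w0 (R (f (r n)))) \<longlonglongrightarrow> cscale w0 l"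
      by (rule bounded_linear.tendsto[OF bounded_linear_cscale l])
    have "(\<lambda>n. cmod (w0 - w (r n)) * norm (R (f (r n)))) \<longlonglongrightarrow> cmod (w0 - w0) * norm l"
      by (intro tendsto_intros wr l)
    moreover have "norm (cscale w0 (R (f (r n))) - cscale (w (r n)) (R (f (r n)))) = cmod (w0 - w (r n)) * norm (R (f (r n)))" for n
    proof -
      have "cscale w0 (R (f (r n))) - cscale (w (r n)) (R (f (r n))) = cscale (w0 - w (r n)) (R (f (r n)))"
        by (rule ell2_eqI) (simp add: algebra_simps)
      then show ?thesis by (simp add: norm_cscale)
    qed
    ultimately have "(\<lambda>n. norm (cscale w0 (R (f (r n))) - cscale (w (r n)) (R (f (r n))))) \<longlonglongrightarrow> 0"
      by simp
    then show "(\<lambda>n. cscale w0 (R (f (r n))) - cscale (w (r n)) (R (f (r n)))) \<longlonglongrightarrow> 0"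
      by (rule tendsto_norm_zero_cancel)
  qed
  from tendsto_add[OF 0 this] have lim: "(\<lambda>n. f (r n)) \<longlonglongrightarrow> cscale w0 l" by (simp add: pencil_def)
  from tendsto_norm[OF this] have "norm (cscale w0 l) = 1" using f by (simp add: LIMSEQ_const_iff)
  moreover have "R (cscale w0 l) = l" using R.tendsto[OF lim] l LIMSEQ_unique by blast
  ultimately show ?thesis using r lim by (intro exI[of _ r] exI[of _ "cscale w0 l"]) (simp add: pencil_def)
qed

lemma bounded_below_if_injective:
  assumes inj: "\<And>f. pencil R w f = 0 \<Longrightarrow> f = 0"
  shows "\<exists>c>0. \<forall>f. c * norm f \<le> norm (pencil R w f)"
proof (rule ccontr)
  interpret T: bounded_linear "pencil R w" by (rule bounded_linear_pencil)
  assume neg: "\<not> ?thesis"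
  have "\<exists>f. norm f = 1 \<and> norm (pencil R w f) < inverse (real (Suc n))" for n
  proof -
    obtain f where f: "norm (pencil R w f) < inverse (real (Suc n)) * norm f"
      using neg by (meson not_le inverse_positive_iff_positive of_nat_0_less_iff zero_less_Suc)
    then have "f \<noteq> 0" by (auto simp: T.zero)
    then show ?thesis using f
      by (intro exI[of _ "(1 / norm f) *\<^sub>R f"]) (auto simp: T.scaleR field_simps)
  qed
  then obtain f where f: "\<And>n. norm (f n) = 1" "\<And>n. norm (pencil R w (f n)) < inverse (real (Suc n))" by metis
  have "(\<lambda>n. pencil R w (f n)) \<longlonglongrightarrow> 0"
    using f(2) by (intro Lim_null_comparison[OF _ LIMSEQ_inverse_real_of_nat]) (auto intro!: always_eventually less_imp_le simp del: of_nat_Suc)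
  from approximate_kernel_convergent[of f, OF f(1) tendsto_const this] inj
  obtain l :: "'v ell2" where "norm l = 1" "l = 0" by blast
  then show False by simp
qed

text \<open>Fredholm alternative. The adjoint is the pencil at \<open>cnj w\<close>; a nonzero
  kernel vector of it would make w real by \<open>eigen_real\<close>, hence \<open>cnj w\<close>
  equal to w, so injectivity carries over to the adjoint.\<close>

lemma not_regular_eigen:
  assumes "\<not> regular R w"
  shows "\<exists>e. norm e = 1 \<and> pencil R w e = 0 \<and> Im w = 0"
proof (rule ccontr)
  assume neg: "\<not> ?thesis"
  have inj: "f = 0" if "pencil R w f = 0" for f
  proof (rule ccontr)
    assume "f \<noteq> 0"
    then have "norm ((1 / norm f) *\<^sub>R f) = 1" "pencil R w ((1 / norm f) *\<^sub>R f) = 0" "Im w = 0"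
      using that eigen_real linear_scale[OF bounded_linear.linear[OF bounded_linear_pencil, of w]] by auto
    with neg show False by blast
  qed
  have inj': "f = 0" if "pencil R (cnj w) f = 0" for f
  proof (cases "f = 0")
    case False
    then have "Im (cnj w) = 0" using that by (rule eigen_real)
    then have "cnj w = w" by (simp add: complex_eq_iff)
    then show ?thesis using inj that by simp
  qed
  obtain c where c: "c > 0" "\<And>f. c * norm f \<le> norm (pencil R w f)"
    using bounded_below_if_injective[OF inj] by blast
  have "surj (pencil R w)"
    by (rule bounded_below_imp_surj[OF bounded_linear_pencil inner_pencil c inj'])
  moreover have "inj (pencil R w)"
    using inj bounded_linear.linear[OF bounded_linear_pencil] by (auto simp: linear_injective_0)
  ultimately show False using assms c unfolding regular_def bij_def by blast
qed

text \<open>Unit eigenvectors for parameters tending to \<open>w\<close> would subconverge to a unit vector, but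
  eigenvectors for different parameters are orthogonal.\<close>
lemma regular_punctured_nbhd: "\<exists>\<epsilon>>0. \<forall>w'. w' \<noteq> w \<and> cmod (w' - w) < \<epsilon> \<longrightarrow> regular R w'"
proof (rule ccontr)
  assume neg: "\<not> ?thesis"
  have "\<exists>w'. w' \<noteq> w \<and> cmod (w' - w) < inverse (real (Suc n)) \<and> \<not> regular R w'" for n
    using neg by (meson inverse_positive_iff_positive of_nat_0_less_iff zero_less_Suc)
  then obtain z where z: "\<And>n. z n \<noteq> w" "\<And>n. cmod (z n - w) < inverse (real (Suc n))" "\<And>n. \<not> regular R (z n)"
    by metis
  obtain e where e: "\<And>n. norm (e n) = 1" "\<And>n. pencil R (z n) (e n) = 0" "\<And>n. Im (z n) = 0"
    using not_regular_eigen[OF z(3)] by metis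
  have "(\<lambda>n. z n - w) \<longlonglongrightarrow> 0"
    using z(2) by (intro Lim_null_comparison[OF _ LIMSEQ_inverse_real_of_nat])
      (auto intro!: always_eventually less_imp_le simp del: of_nat_Suc)
  then have zw: "z \<longlonglongrightarrow> w" by (rule LIM_zero_cancel)
  have eR: "e n = Re (z n) *\<^sub>R R (e n)" for n
  proof -
    have "z n = complex_of_real (Re (z n))" using e(3) by (simp add: complex_eq_iff)
    then have "cscale (z n) (R (e n)) = Re (z n) *\<^sub>R R (e n)" using cscale_of_real by metis
    then show ?thesis using e(2)[of n] by (simp add: pencil_def)
  qed
  \<comment> \<open>The parameters are real, so distinct ones have distinct real parts, and by
    symmetry of R the inner product would equal two different multiples of one number.\<close>
  have orth: "inner (e n) (e k) = 0" if "z n \<noteq> z k" for n k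
  proof -
    have "inner (e n) (e k) = Re (z n) * inner (e n) (R (e k))"
      by (subst eR[of n]) (simp add: sym)
    moreover have "inner (e n) (e k) = Re (z k) * inner (e n) (R (e k))"
      by (subst eR[of k]) simp
    moreover have "Re (z n) \<noteq> Re (z k)" using that e(3) by (simp add: complex_eq_iff)
    ultimately show ?thesis by (metis mult_cancel_right mult_zero_right)
  qed
  obtain r l where r: "strict_mono r" and l: "(\<lambda>n. e (r n)) \<longlonglongrightarrow> l" "norm l = 1"
    using approximate_kernel_convergent[of e, OF e(1) zw] e(2) by auto
  \<comment> \<open>Since \<open>z n\<close> differs from the limit w, eventually
    \<open>z (r k)\<close> differs from \<open>z n\<close>. So l is orthogonal to every
    \<open>e n\<close> and thereby to itself.\<close>
  have "inner (e n) l = 0" for n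
  proof (rule LIMSEQ_unique)
    show "(\<lambda>k. inner (e n) (e (r k))) \<longlonglongrightarrow> inner (e n) l" by (intro tendsto_intros l)
    have "(\<lambda>k. z (r k)) \<longlonglongrightarrow> w" using LIMSEQ_subseq_LIMSEQ[OF zw r] by (simp add: o_def)
    then have "\<forall>\<^sub>F k in sequentially. z (r k) \<noteq> z n" using z(1)[of n] tendsto_imp_eventually_ne by metis
    then have "\<forall>\<^sub>F k in sequentially. inner (e n) (e (r k)) = 0" by eventually_elim (metis orth)
    then show "(\<lambda>k. inner (e n) (e (r k))) \<longlonglongrightarrow> 0" by (rule tendsto_eventually)
  qed
  then have "(\<lambda>n. inner (e (r n)) l) \<longlonglongrightarrow> 0" by simp
  moreover have "(\<lambda>n. inner (e (r n)) l) \<longlonglongrightarrow> inner l l" by (intro tendsto_intros l)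
  ultimately have "inner l l = 0" using LIMSEQ_unique by blast
  then show False using l(2) by simp
qed

text \<open>Otherwise for every n some unit kernel vector vanishes on the first n points, and a
  limit of these would vanish everywhere yet have norm 1. This form of finite-dimensionality is the
  one that \<open>finite_dimensional_if_determined\<close> accepts.\<close>

lemma kernel_determined_on_finite_set:
  fixes v :: "nat \<Rightarrow> 'v"
  assumes v: "bij v"
  shows "\<exists>K. finite K \<and> (\<forall>f. pencil R w f = 0 \<and> restr K f = 0 \<longrightarrow> f = 0)"
proof (rule ccontr)
  interpret T: bounded_linear "pencil R w" by (rule bounded_linear_pencil)
  assume neg: "\<not> ?thesis"
  have "\<exists>f. pencil R w f = 0 \<and> restr (v ` {..<n}) f = 0 \<and> norm f = 1" for n
  proof -
    obtain f where f: "pencil R w f = 0" "restr (v ` {..<n}) f = 0" "f \<noteq> 0"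
      using neg by (metis finite_imageI finite_lessThan)
    then show ?thesis
      by (intro exI[of _ "(1 / norm f) *\<^sub>R f"])
        (auto simp: T.scaleR linear_scale[OF bounded_linear.linear[OF bounded_linear_restr]])
  qed
  then obtain f where f: "\<And>n. pencil R w (f n) = 0" "\<And>n. restr (v ` {..<n}) (f n) = 0" "\<And>n. norm (f n) = 1"
    by metis
  obtain r l where r: "strict_mono r" and l: "(\<lambda>n. f (r n)) \<longlonglongrightarrow> l" "norm l = 1"
    using approximate_kernel_convergent[of f, OF f(3) tendsto_const, of w] f(1) by auto
  have "coord l (v k) = 0" for k
  proof (rule LIMSEQ_unique)
    show "(\<lambda>n. coord (f (r n)) (v k)) \<longlonglongrightarrow> coord l (v k)" by (rule tendsto_coord[OF l(1)])
    have "coord (f (r n)) (v k) = 0" if "n > k" for n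
    proof -
      have "k < r n" using that seq_suble[OF r, of n] by simp
      then have "coord (f (r n)) (v k) = coord (restr (v ` {..<r n}) (f (r n))) (v k)" by simp
      then show ?thesis unfolding f(2) by simp
    qed
    then show "(\<lambda>n. coord (f (r n)) (v k)) \<longlonglongrightarrow> 0"
      by (intro tendsto_eventually) (auto simp: eventually_at_top_dense)
  qed
  then have "l = 0" using v by (intro ell2_eqI) (metis bij_pointE coord_zero)
  then show False using l(2) by simp
qed

end

section \<open>Singular sequences and multiplicities\<close>

context selfadjoint_ell2
begin

text \<open>\<open>\<mu>\<close> is the infimum over finite \<open>K\<close> of the supremum of the form over unit vectors vanishing on
  \<open>K\<close>, i.e. the top of the essential spectrum.\<close>
lemma singular_sequence:
  fixes v :: "nat \<Rightarrow> 'v"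
  assumes v: "bij v"
    and low: "\<And>K. finite K \<Longrightarrow> \<exists>f. norm f = 1 \<and> restr K f = 0 \<and> c0 \<le> inner (R f) f"
  shows "\<exists>\<mu>\<ge>c0. \<exists>f. (\<forall>n. norm (f n) = 1) \<and> (\<forall>h. (\<lambda>n. inner (f n) h) \<longlonglongrightarrow> 0) \<and>
           (\<lambda>n. R (f n) - \<mu> *\<^sub>R f n) \<longlonglongrightarrow> 0"
proof -
  obtain M where M: "M > 0" "\<And>f. norm (R f) \<le> M * norm f"
    using R.pos_bounded by (metis mult.commute)
  define U where "U K = {f :: 'v ell2. norm f = 1 \<and> restr K f = 0}" for K
  define top where "top K = (SUP f\<in>U K. inner (R f) f)" for K
  define \<mu> where "\<mu> = (INF K\<in>{K. finite K}. top K)"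
  have form_le: "inner (R f) f \<le> M * (norm f)\<^sup>2" for f
    using norm_cauchy_schwarz[of "R f" f] mult_right_mono[OF M(2)[of f] norm_ge_zero[of f]]
    by (simp add: power2_eq_square algebra_simps)
  have bdd: "bdd_above ((\<lambda>f. inner (R f) f) ` U K)" for K
  proof (intro bdd_aboveI[of _ M], elim imageE)
    show "y \<le> M" if "y = inner (R f) f" "f \<in> U K" for y f
      using form_le[of f] that by (simp add: U_def)
  qed
  have top_low: "c0 \<le> top K" if "finite K" for K
  proof -
    obtain f where "f \<in> U K" "c0 \<le> inner (R f) f" using low[OF \<open>finite K\<close>] by (auto simp: U_def)
    then show ?thesis unfolding top_def by (rule cSUP_upper2[OF bdd])
  qed
  have bdd2: "bdd_below (top ` {K. finite K})" using top_low by (intro bdd_belowI[of _ c0]) auto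
  have \<mu>_le: "\<mu> \<le> top K" if "finite K" for K
    unfolding \<mu>_def using that by (intro cINF_lower[OF bdd2]) auto
  have \<mu>_ge: "c0 \<le> \<mu>" unfolding \<mu>_def using top_low by (intro cINF_greatest) auto
  \<comment> \<open>\<open>f n\<close> nearly maximises the form among unit vectors vanishing on the
    first n points; the supremum over these is at least \<mu>.\<close>
  have "\<exists>f. f \<in> U (v ` {..<n}) \<and> \<mu> - inverse (real (Suc n)) < inner (R f) f" for n
  proof -
    have "\<mu> - inverse (real (Suc n)) < \<mu>" by simp
    also have "\<dots> \<le> top (v ` {..<n})" by (intro \<mu>_le) simp
    finally have *: "\<mu> - inverse (real (Suc n)) < top (v ` {..<n})" .
    have "U (v ` {..<n}) \<noteq> {}" using low[of "v ` {..<n}"] by (auto simp: U_def)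
    from less_cSUP_iff[OF this bdd, of "\<mu> - inverse (real (Suc n))"] * show ?thesis
      unfolding top_def by blast
  qed
  then obtain f where fU: "\<And>n. f n \<in> U (v ` {..<n})" and f\<mu>: "\<And>n. \<mu> - inverse (real (Suc n)) < inner (R (f n)) (f n)"
    by metis
  have f1: "norm (f n) = 1" and f0: "restr (v ` {..<n}) (f n) = 0" for n
    using fU[of n] by (auto simp: U_def)
  have weak: "(\<lambda>n. inner (f n) h) \<longlonglongrightarrow> 0" for h
  proof (rule Lim_null_comparison)
    have "inner (f n) h = inner (f n) (h - restr (v ` {..<n}) h)" for n
      using inner_restr[of "v ` {..<n}" "f n" h] f0 by (simp add: inner_diff_right)
    then have "norm (inner (f n) h) \<le> norm (restr (v ` {..<n}) h - h)" for n
      using Cauchy_Schwarz_ineq2[of "f n" "h - restr (v ` {..<n}) h"] f1[of n]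
      by (simp add: norm_minus_commute)
    then show "\<forall>\<^sub>F n in sequentially. norm (inner (f n) h) \<le> norm (restr (v ` {..<n}) h - h)" by simp
    show "(\<lambda>n. norm (restr (v ` {..<n}) h - h)) \<longlonglongrightarrow> 0"
      by (rule tendsto_norm_zero[OF LIM_zero[OF restr_lessThan_tendsto[OF v]]])
  qed
  \<comment> \<open>By symmetry R preserves weak convergence to 0, and testing against
    \<open>basis_vec x 1\<close> and \<open>basis_vec x \<i>\<close> picks out the real and
    imaginary parts of a coordinate.\<close>
  have Rf0: "(\<lambda>n. restr K (R (f n))) \<longlonglongrightarrow> 0" if K: "finite K" for K
  proof -
    have re: "Re (coord (R (f n)) x) = inner (f n) (R (basis_vec x 1))"
      and im: "Im (coord (R (f n)) x) = inner (f n) (R (basis_vec x \<i>))" for n x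
      by (simp_all add: inner_basis_vec flip: sym)
    have "(\<lambda>n. coord (R (f n)) x) \<longlonglongrightarrow> Complex 0 0" for x
      using tendsto_Complex[OF weak[of "R (basis_vec x 1)"] weak[of "R (basis_vec x \<i>)"]]
      by (simp flip: re im)
    from tendsto_restr_finite[of K "\<lambda>n. R (f n)" "\<lambda>_. Complex 0 0", OF K this]
    show ?thesis by (simp add: basis_vec_zero flip: zero_complex.code)
  qed
  have "(\<lambda>n. R (f n) - \<mu> *\<^sub>R f n) \<longlonglongrightarrow> 0"
  proof (rule metric_LIMSEQ_I)
    fix \<delta> :: real assume \<delta>: "\<delta> > 0"
    define L where "L = \<bar>\<mu>\<bar> + 1 + M"
    have L: "L > 0" using M by (simp add: L_def)
    \<comment> \<open>The cap 1 makes L a norm bound for \<open>B\<close>, \<delta>/8 bounds the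
      term \<epsilon> f n, and the last value gives L (2 \<epsilon>) \<le> (\<delta>/4)^2, so that
      \<open>B (f n)\<close> has norm at most \<delta>/4.\<close>
    define \<epsilon> where "\<epsilon> = min 1 (min (\<delta> / 8) (\<delta>\<^sup>2 / (32 * L)))"
    have \<epsilon>: "\<epsilon> > 0" "\<epsilon> \<le> 1" "\<epsilon> \<le> \<delta> / 8" "\<epsilon> \<le> \<delta>\<^sup>2 / (32 * L)" using \<delta> L by (auto simp: \<epsilon>_def)
    have "\<mu> < \<mu> + \<epsilon>" using \<epsilon> by simp
    then obtain K where K: "finite K" "top K < \<mu> + \<epsilon>"
      using cINF_less_iff[OF _ bdd2, of "\<mu> + \<epsilon>"] unfolding \<mu>_def by auto
    \<comment> \<open>The compression of \<mu> + \<epsilon> - R to vectors vanishing on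
      \<open>K\<close>. It is nonnegative because \<open>top K\<close> is below \<mu> + \<epsilon>,
      and for such an operator a small form value forces a small image.\<close>
    define B where "B u = restr (- K) ((\<mu> + \<epsilon>) *\<^sub>R restr (- K) u - R (restr (- K) u))" for u
    have B_bound: "(norm (B u))\<^sup>2 \<le> L * inner (B u) u" for u
    proof (rule nonneg_form_norm_bound)
      show "linear B" unfolding B_def
        by (intro bounded_linear.linear bounded_linear_compose[OF bounded_linear_restr] bounded_linear_sub
            bounded_linear_compose[OF bounded_linear_scaleR_right] bounded_linear_compose[OF bl] bounded_linear_restr)
      have B_inner: "inner (B u) w = (\<mu> + \<epsilon>) * inner (restr (- K) u) (restr (- K) w) - inner (R (restr (- K) u)) (restr (- K) w)" for u w
        unfolding B_def by (subst inner_restr) (simp add: inner_diff_left)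
      show "inner (B u) w = inner u (B w)" for u w
        using B_inner[of u w] B_inner[of w u] sym[of "restr (- K) u" "restr (- K) w"] by (simp add: inner_commute)
      show "0 \<le> inner (B u) u" for u
      proof (cases "restr (- K) u = 0")
        case False
        define w where "w = restr (- K) u"
        have w0: "norm w > 0" using False by (simp add: w_def)
        have "restr K w = 0" by (rule ell2_eqI) (simp add: w_def)
        then have "(1 / norm w) *\<^sub>R w \<in> U K"
          using w0 by (simp add: U_def linear_scale[OF bounded_linear.linear[OF bounded_linear_restr]])
        then have "inner (R ((1 / norm w) *\<^sub>R w)) ((1 / norm w) *\<^sub>R w) \<le> top K"
          unfolding top_def by (rule cSUP_upper[OF _ bdd])
        also have "\<dots> \<le> \<mu> + \<epsilon>" using K by simp
        finally have "inner (R w) w \<le> (\<mu> + \<epsilon>) * (norm w)\<^sup>2"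
          using w0 by (simp add: R.scaleR field_simps power2_eq_square)
        then show ?thesis unfolding B_inner w_def[symmetric] power2_norm_eq_inner by simp
      qed (simp add: B_inner)
      show "norm (B u) \<le> L * norm u" for u
      proof -
        have "norm (B u) \<le> norm ((\<mu> + \<epsilon>) *\<^sub>R restr (- K) u - R (restr (- K) u))"
          unfolding B_def by (rule norm_restr_le)
        also have "\<dots> \<le> norm ((\<mu> + \<epsilon>) *\<^sub>R restr (- K) u) + norm (R (restr (- K) u))" by (rule norm_triangle_ineq4)
        also have "\<dots> \<le> \<bar>\<mu> + \<epsilon>\<bar> * norm (restr (- K) u) + M * norm (restr (- K) u)"
          using M(2)[of "restr (- K) u"] by simp
        also have "\<dots> = (\<bar>\<mu> + \<epsilon>\<bar> + M) * norm (restr (- K) u)" by (simp add: algebra_simps)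
        also have "\<dots> \<le> L * norm u"
          using \<epsilon> M L norm_restr_le[of "- K" u] by (intro mult_mono) (auto simp: L_def)
        finally show ?thesis .
      qed
    qed (fact L)
    have KN: "\<exists>N. K \<subseteq> v ` {..<N}"
    proof -
      obtain N where N: "inv v ` K \<subseteq> {..<N}" using K(1) finite_nat_bounded by blast
      have "x \<in> v ` {..<N}" if "x \<in> K" for x
        using v N that by (intro image_eqI[where x="inv v x"]) (auto simp: bij_def surj_f_inv_f)
      then show ?thesis by blast
    qed
    then obtain N1 where N1: "K \<subseteq> v ` {..<N1}" by blast
    obtain N2 where N2: "\<And>n. n \<ge> N2 \<Longrightarrow> norm (restr K (R (f n))) < \<delta> / 4"
      using metric_LIMSEQ_D[OF Rf0[OF K(1)], of "\<delta> / 4"] \<delta> by auto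
    obtain N3 where N3: "inverse (real (Suc N3)) < \<epsilon>" using reals_Archimedean[OF \<epsilon>(1)] by blast
    have "norm (R (f n) - \<mu> *\<^sub>R f n) < \<delta>" if n: "n \<ge> N1" "n \<ge> N2" "n \<ge> N3" for n
    proof -
      have "K \<subseteq> v ` {..<n}" using N1 n(1) by (meson image_mono lessThan_subset_iff order_trans)
      then have "restr K (f n) = restr K (restr (v ` {..<n}) (f n))" by (simp add: restr_restr Int_absorb2)
      then have rK: "restr K (f n) = 0" unfolding f0
        by (simp add: linear_0[OF bounded_linear.linear[OF bounded_linear_restr]])
      then have rmK: "restr (- K) (f n) = f n" by (simp add: restr_Compl)
      have Bf: "B (f n) = (\<mu> + \<epsilon>) *\<^sub>R f n - R (f n) + restr K (R (f n))"
        unfolding B_def rmK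
        by (simp add: restr_Compl rK linear_diff[OF bounded_linear.linear[OF bounded_linear_restr]]
            linear_scale[OF bounded_linear.linear[OF bounded_linear_restr]])
      have "inner (B (f n)) (f n) = \<mu> + \<epsilon> - inner (R (f n)) (f n)"
        unfolding Bf using f1[of n] inner_restr[of K "R (f n)" "f n"] rK
        by (simp add: inner_add_left inner_diff_left dot_square_norm)
      also have "\<dots> \<le> 2 * \<epsilon>"
      proof -
        have "inverse (real (Suc n)) \<le> inverse (real (Suc N3))" using n(3) by (intro le_imp_inverse_le) auto
        then show ?thesis using f\<mu>[of n] N3 by linarith
      qed
      finally have "(norm (B (f n)))\<^sup>2 \<le> L * (2 * \<epsilon>)"
        using B_bound[of "f n"] L by (meson mult_le_cancel_left_pos order_trans)
      also have "\<dots> \<le> L * (2 * (\<delta>\<^sup>2 / (32 * L)))" using \<epsilon> L by (intro mult_left_mono) auto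
      also have "\<dots> = (\<delta> / 4)\<^sup>2" using L by (simp add: power2_eq_square)
      finally have "norm (B (f n)) \<le> \<delta> / 4" using \<delta> by (auto intro: power2_le_imp_le)
      moreover have "R (f n) - \<mu> *\<^sub>R f n = \<epsilon> *\<^sub>R f n + restr K (R (f n)) - B (f n)"
        unfolding Bf by (simp add: algebra_simps)
      then have "norm (R (f n) - \<mu> *\<^sub>R f n) \<le> \<epsilon> * norm (f n) + norm (restr K (R (f n))) + norm (B (f n))"
        using norm_triangle_ineq4[of "\<epsilon> *\<^sub>R f n + restr K (R (f n))" "B (f n)"]
          norm_triangle_ineq[of "\<epsilon> *\<^sub>R f n" "restr K (R (f n))"] \<epsilon>(1) by simp
      ultimately show ?thesis using N2[OF n(2)] \<epsilon> f1[of n] \<delta> by simp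
    qed
    then show "\<exists>no. \<forall>n\<ge>no. dist (R (f n) - \<mu> *\<^sub>R f n) 0 < \<delta>"
      by (intro exI[of _ "max N1 (max N2 N3)"]) simp
  qed
  with \<mu>_ge f1 weak show ?thesis by blast
qed

lemma pencil_of_real:
  assumes "t \<noteq> 0"
  shows "R f - t *\<^sub>R f = (- t) *\<^sub>R pencil R (complex_of_real (1 / t)) f"
  unfolding pencil_def cscale_of_real using assms by (simp add: scaleR_diff_right)

text \<open>With A = R - \<mu>, regularity at 1/(\<mu> + s) bounds A - s from below. Isolation thus
  provides the hypothesis of \<open>spectral_gap_around_zero\<close>, and the gap is what
  \<open>orthonormal_in_kernel\<close> needs.\<close>

lemma infinite_multiplicity_if_isolated:
  assumes \<mu>: "\<mu> > 0" and f: "\<And>n. norm (f n) = 1" "\<And>h. (\<lambda>n. inner (f n) h) \<longlonglongrightarrow> 0"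
    "(\<lambda>n. R (f n) - \<mu> *\<^sub>R f n) \<longlonglongrightarrow> 0"
    and eps: "\<epsilon> > 0"
    and iso: "\<And>w. w \<noteq> complex_of_real (1 / \<mu>) \<Longrightarrow> cmod (w - complex_of_real (1 / \<mu>)) < \<epsilon> \<Longrightarrow> regular R w"
  shows "\<exists>E. finite E \<and> card E = k \<and> (\<forall>e\<in>E. pencil R (complex_of_real (1 / \<mu>)) e = 0 \<and> norm e = 1) \<and>
           pairwise (\<lambda>e e'. inner e e' = 0) E"
proof -
  define A where "A u = R u - \<mu> *\<^sub>R u" for u
  have A: "bounded_linear A" unfolding A_def
    by (intro bounded_linear_sub bl bounded_linear_scaleR_right)
  have A_sym: "inner (A u) w = inner u (A w)" for u w
    by (simp add: A_def inner_diff_left inner_diff_right sym)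
  have "((\<lambda>s. 1 / (\<mu> + s)) \<longlongrightarrow> 1 / (\<mu> + 0)) (nhds 0)" using \<mu> by (intro tendsto_intros filterlim_ident) auto
  then have "\<forall>\<^sub>F s in nhds 0. dist (1 / (\<mu> + s)) (1 / \<mu>) < \<epsilon>" using eps by (auto simp: tendsto_iff)
  then obtain d where d: "d > 0" "\<And>s. \<bar>s\<bar> < d \<Longrightarrow> dist (1 / (\<mu> + s)) (1 / \<mu>) < \<epsilon>"
    by (auto simp: eventually_nhds_metric)
  \<comment> \<open>\<open>d\<close> comes from continuity of 1/(\<mu> + s) in s; the cap \<mu>
    keeps \<mu> + s positive.\<close>
  have gap: "\<exists>c>0. \<forall>u. c * norm u \<le> norm (A u - s *\<^sub>R u)" if s: "0 < \<bar>s\<bar>" "\<bar>s\<bar> < min d \<mu>" for s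
  proof -
    have t: "\<mu> + s > 0" using s by auto
    have "complex_of_real (1 / (\<mu> + s)) \<noteq> complex_of_real (1 / \<mu>)"
      unfolding of_real_eq_iff using t \<mu> s by (auto simp: field_simps)
    moreover have "cmod (complex_of_real (1 / (\<mu> + s)) - complex_of_real (1 / \<mu>)) < \<epsilon>"
      using d(2)[of s] s unfolding of_real_diff[symmetric] norm_of_real dist_real_def by simp
    ultimately have "regular R (complex_of_real (1 / (\<mu> + s)))" by (rule iso)
    then obtain c where c: "c > 0" "\<And>u. c * norm u \<le> norm (pencil R (complex_of_real (1 / (\<mu> + s))) u)"
      unfolding regular_def by blast
    have "A u - s *\<^sub>R u = (- (\<mu> + s)) *\<^sub>R pencil R (complex_of_real (1 / (\<mu> + s))) u" for u
      using pencil_of_real[of "\<mu> + s" u] t by (simp add: A_def algebra_simps)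
    then have "norm (A u - s *\<^sub>R u) = (\<mu> + s) * norm (pencil R (complex_of_real (1 / (\<mu> + s))) u)" for u
      using t by simp
    then have "((\<mu> + s) * c) * norm u \<le> norm (A u - s *\<^sub>R u)" for u
      using mult_left_mono[OF c(2)[of u], of "\<mu> + s"] t by (simp add: mult.assoc)
    moreover have "(\<mu> + s) * c > 0" using t c by simp
    ultimately show ?thesis by blast
  qed
  have "min d \<mu> > 0" using d \<mu> by simp
  note g = spectral_gap_around_zero[OF A A_sym this gap]
  have "A e = 0 \<longleftrightarrow> pencil R (complex_of_real (1 / \<mu>)) e = 0" for e
    using pencil_of_real[of \<mu> e] \<mu> by (simp add: A_def)
  then show ?thesis
    using orthonormal_in_kernel[OF A A_sym \<open>min d \<mu> > 0\<close> g f(1), folded A_def] f(2,3)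
    by (simp add: A_def[symmetric])
qed

end

section \<open>Counting dimensions\<close>

lemma homogeneous_system_nontrivial:
  fixes a :: "'e \<Rightarrow> 's \<Rightarrow> 'k::field"
  assumes "finite S" "finite E" "card S < card E"
  shows "\<exists>r. (\<exists>e\<in>E. r e \<noteq> 0) \<and> (\<forall>s\<in>S. (\<Sum>e\<in>E. r e * a e s) = 0)"
  using assms
proof (induction S arbitrary: E a rule: finite_induct)
  case empty
  then obtain e where "e \<in> E" by (metis card.empty card_gt_0_iff all_not_in_conv)
  then show ?case by (intro exI[of _ "\<lambda>_. 1"]) auto
next
  case (insert t S)
  show ?case
  proof (cases "\<forall>e\<in>E. a e t = 0")
    case True
    have "card S < card E" using insert by simp
    from insert.IH[OF insert.prems(1) this, of a] True show ?thesis by auto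
  next
    case False
    then obtain e0 where e0: "e0 \<in> E" "a e0 t \<noteq> 0" by blast
    define E' where "E' = E - {e0}"
    have E': "finite E'" "card S < card E'" using insert e0 by (auto simp: E'_def)
    \<comment> \<open>Gaussian elimination: equation \<open>t\<close> is solved for the unknown at
      \<open>e0\<close>, which is then removed from the remaining equations; \<open>r'\<close>
      recovers its value afterwards.\<close>
    define a' where "a' e s = a e s - a e t / a e0 t * a e0 s" for e s
    obtain r where r: "\<exists>e\<in>E'. r e \<noteq> 0" "\<And>s. s \<in> S \<Longrightarrow> (\<Sum>e\<in>E'. r e * a' e s) = 0"
      using insert.IH[OF E', of a'] by blast
    define r' where "r' e = (if e = e0 then - (\<Sum>e\<in>E'. r e * a e t) / a e0 t else r e)" for e
    have split: "(\<Sum>e\<in>E. r' e * a e s) = r' e0 * a e0 s + (\<Sum>e\<in>E'. r e * a e s)" for s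
    proof -
      have "(\<Sum>e\<in>E'. r' e * a e s) = (\<Sum>e\<in>E'. r e * a e s)"
        by (rule sum.cong) (auto simp: r'_def E'_def)
      then show ?thesis using insert.prems(1) e0(1) by (simp add: sum.remove[of E e0] E'_def)
    qed
    have "(\<Sum>e\<in>E. r' e * a e s) = 0" if "s \<in> insert t S" for s
    proof (cases "s = t")
      case True
      then show ?thesis unfolding split using e0 by (simp add: r'_def)
    next
      case False
      then have "(\<Sum>e\<in>E'. r e * a' e s) = 0" using that r(2) by blast
      then have "(\<Sum>e\<in>E'. r e * a e s) = (\<Sum>e\<in>E'. r e * a e t) / a e0 t * a e0 s"
        by (simp add: a'_def algebra_simps sum_subtractf sum_distrib_left sum_divide_distrib)
      then show ?thesis unfolding split by (simp add: r'_def)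
    qed
    moreover have "\<exists>e\<in>E. r' e \<noteq> 0" using r(1) by (auto simp: r'_def E'_def)
    ultimately show ?thesis by blast
  qed
qed

text \<open>Over the reals each spanning function counts twice.\<close>
lemma orthonormal_card_le:
  assumes S: "finite S" and E: "finite E" "\<And>e. e \<in> E \<Longrightarrow> norm e = 1" "pairwise (\<lambda>e e'. inner e e' = 0) E"
    and span: "\<And>e. e \<in> E \<Longrightarrow> \<exists>a. \<forall>x. coord e x = (\<Sum>s\<in>S. a s * g s x)"
  shows "card E \<le> 2 * card S"
proof (rule ccontr)
  assume "\<not> ?thesis"
  then have card: "card (S \<times> (UNIV :: bool set)) < card E" by (simp add: card_cartesian_product)
  obtain a where a: "\<And>e x. e \<in> E \<Longrightarrow> coord e x = (\<Sum>s\<in>S. a e s * g s x)" using span by metis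
  define a' where "a' e p = (if snd p then Re (a e (fst p)) else Im (a e (fst p)))" for e and p :: "_ \<times> bool"
  obtain r :: "_ \<Rightarrow> real" where r: "\<exists>e\<in>E. r e \<noteq> 0" "\<And>p. p \<in> S \<times> UNIV \<Longrightarrow> (\<Sum>e\<in>E. r e * a' e p) = 0"
    using homogeneous_system_nontrivial[OF _ E(1) card, of a'] S by auto
  have "(\<Sum>e\<in>E. complex_of_real (r e) * a e s) = 0" if "s \<in> S" for s
    using r(2)[of "(s, True)"] r(2)[of "(s, False)"] that by (simp add: a'_def complex_eq_iff)
  then have "coord (\<Sum>e\<in>E. r e *\<^sub>R e) x = 0" for x
  proof -
    assume 0: "\<And>s. s \<in> S \<Longrightarrow> (\<Sum>e\<in>E. complex_of_real (r e) * a e s) = 0"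
    have "coord (\<Sum>e\<in>E. r e *\<^sub>R e) x = (\<Sum>e\<in>E. \<Sum>s\<in>S. complex_of_real (r e) * a e s * g s x)"
      by (simp add: a scaleR_conv_of_real sum_distrib_left mult.assoc)
    also have "\<dots> = (\<Sum>s\<in>S. (\<Sum>e\<in>E. complex_of_real (r e) * a e s) * g s x)"
      by (subst sum.swap) (simp add: sum_distrib_right)
    finally show ?thesis using 0 by simp
  qed
  then have zero: "(\<Sum>e\<in>E. r e *\<^sub>R e) = 0" by (intro ell2_eqI) simp
  have "r e0 = 0" if e0: "e0 \<in> E" for e0
  proof -
    have "inner (\<Sum>e\<in>E. r e *\<^sub>R e) e0 = (\<Sum>e\<in>E. if e = e0 then r e0 else 0)"
      using E(2,3) e0 unfolding inner_sum_left
      by (intro sum.cong) (auto simp: pairwise_def dot_square_norm)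
    then show ?thesis using zero E(1) e0 by simp
  qed
  with r(1) show False by blast
qed

text \<open>Induction on \<open>K\<close>: the functions vanishing at one more point form a subspace
  of codimension at most one, so one extra spanning function suffices.\<close>

lemma finite_dimensional_if_determined:
  fixes H :: "('v \<Rightarrow> complex) set"
  assumes "finite K" and "\<And>u w z. u \<in> H \<Longrightarrow> w \<in> H \<Longrightarrow> (\<lambda>x. u x - z * w x) \<in> H"
    and "\<And>u. u \<in> H \<Longrightarrow> (\<forall>x\<in>K. u x = 0) \<Longrightarrow> u = (\<lambda>_. 0)"
  shows "\<exists>S. finite S \<and> (\<forall>u\<in>H. \<exists>a. u = (\<lambda>x. \<Sum>s\<in>S. a s * s x))"
  using assms
proof (induction K arbitrary: H rule: finite_induct)
  case empty
  then show ?case by (intro exI[of _ "{}"]) auto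
next
  case (insert y K)
  define H' where "H' = {u \<in> H. u y = 0}"
  have "\<exists>S. finite S \<and> (\<forall>u\<in>H'. \<exists>a. u = (\<lambda>x. \<Sum>s\<in>S. a s * s x))"
  proof (rule insert.IH)
    show "(\<lambda>x. u x - z * w x) \<in> H'" if "u \<in> H'" "w \<in> H'" for u w z
      using that insert.prems(1) by (auto simp: H'_def)
    show "u = (\<lambda>_. 0)" if "u \<in> H'" "\<forall>x\<in>K. u x = 0" for u
      using that insert.prems(2)[of u] by (auto simp: H'_def)
  qed
  then obtain S where S: "finite S" "\<And>u. u \<in> H' \<Longrightarrow> \<exists>a. u = (\<lambda>x. \<Sum>s\<in>S. a s * s x)" by blast
  show ?case
  proof (cases "\<exists>e\<in>H. e y \<noteq> 0")
    case False
    then have "H' = H" by (auto simp: H'_def)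
    with S show ?thesis by blast
  next
    case True
    then obtain e where e: "e \<in> H" "e y \<noteq> 0" by blast
    have "\<exists>a. u = (\<lambda>x. \<Sum>s\<in>insert e S. a s * s x)" if u: "u \<in> H" for u
    proof -
      have "(\<lambda>x. u x - u y / e y * e x) \<in> H'"
        using insert.prems(1)[OF u e(1), of "u y / e y"] e(2) by (simp add: H'_def)
      then obtain a where a: "(\<lambda>x. u x - u y / e y * e x) = (\<lambda>x. \<Sum>s\<in>S. a s * s x)" using S(2) by blast
      have u_eq: "u x = u y / e y * e x + (\<Sum>s\<in>S. a s * s x)" for x
        using fun_cong[OF a, of x] by (simp add: algebra_simps)
      \<comment> \<open>\<open>e\<close> may already belong to the spanning set, which cannot hold
        it twice; its two coefficients are then added.\<close>
      define a' where "a' s = (if s = e then u y / e y + (if e \<in> S then a e else 0) else a s)" for s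
      have "u x = (\<Sum>s\<in>insert e S. a' s * s x)" for x
      proof -
        have *: "(\<Sum>s\<in>S - {e}. a' s * s x) = (\<Sum>s\<in>S - {e}. a s * s x)"
          by (rule sum.cong) (auto simp: a'_def)
        show ?thesis
        proof (cases "e \<in> S")
          case True
          then show ?thesis unfolding u_eq[of x] using * S(1)
            by (simp add: insert_absorb sum.remove[of S e] a'_def algebra_simps)
        next
          case False
          then show ?thesis unfolding u_eq[of x] using * S(1) by (simp add: a'_def)
        qed
      qed
      then show ?thesis by (intro exI[of _ a']) (rule ext)
    qed
    with S(1) show ?thesis by (intro exI[of _ "insert e S"]) auto
  qed
qed

section \<open>Cheeger's inequality\<close>

text \<open>Layer-cake argument as an induction: peeling off the lowest positive level t, times the
  indicator of the set \<open>W\<close> where g is positive, leaves fewer positive values, and each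
  layer contributes one isoperimetric inequality. Every such \<open>W\<close> lies in
  \<open>F0\<close>, because g vanishes on the rest of \<open>F\<close>.\<close>

lemma coarea_inequality:
  fixes b :: "'v \<Rightarrow> 'v \<Rightarrow> real" and c n g :: "'v \<Rightarrow> real"
  assumes F: "finite F" and b: "\<And>x y. 0 \<le> b x y" "\<And>x y. b x y = b y x"
    and iso: "\<And>W. W \<subseteq> F0 \<Longrightarrow> W \<noteq> {} \<Longrightarrow> \<alpha> * (\<Sum>x\<in>W. n x) \<le> (\<Sum>x\<in>W. \<Sum>y\<in>F - W. b x y) + (\<Sum>x\<in>W. c x)"
    and F0: "F0 \<subseteq> F" and g: "\<And>x. 0 \<le> g x" "\<And>x. x \<in> F \<Longrightarrow> x \<notin> F0 \<Longrightarrow> g x = 0"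
  shows "\<alpha> * (\<Sum>x\<in>F. n x * g x) \<le> (\<Sum>x\<in>F. \<Sum>y\<in>F. b x y / 2 * \<bar>g x - g y\<bar>) + (\<Sum>x\<in>F. c x * g x)"
  using g
proof (induction "card {x\<in>F. g x > 0}" arbitrary: g rule: less_induct)
  case less
  define W where "W = {x\<in>F. g x > 0}"
  have W: "finite W" "W \<subseteq> F" "W \<subseteq> F0" using F less.prems by (force simp: W_def)+
  show ?case
  proof (cases "W = {}")
    case True
    then have "g x = 0" if "x \<in> F" for x using less.prems(1)[of x] that by (auto simp: W_def less_le)
    then show ?thesis by simp
  next
    case False
    define t where "t = Min (g ` W)"
    have t: "t > 0" "\<And>x. x \<in> W \<Longrightarrow> t \<le> g x" using W False by (auto simp: t_def W_def)
    have "t \<in> g ` W" unfolding t_def using W False by (intro Min_in) auto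
    then obtain x0 where x0: "x0 \<in> W" "g x0 = t" by blast
    define i where "i x = (if x \<in> W then 1 else 0 :: real)" for x
    define g' where "g' x = g x - t * i x" for x
    have g'_nonneg: "0 \<le> g' x" for x using less.prems(1)[of x] t(2)[of x] by (simp add: g'_def i_def)
    have g'0: "g' x = 0" if "x \<in> F" "x \<notin> F0" for x
      using less.prems(2)[OF that] W(3) that by (auto simp: g'_def i_def)
    have "{x\<in>F. g' x > 0} \<subseteq> W - {x0}" using x0 t(1) by (auto simp: g'_def i_def W_def split: if_splits)
    then have "{x\<in>F. g' x > 0} \<subset> W" using x0 by blast
    then have "card {x\<in>F. g' x > 0} < card {x\<in>F. g x > 0}"
      using W(1) unfolding W_def by (intro psubset_card_mono) auto
    note IH = less.hyps[OF this g'_nonneg g'0]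
    \<comment> \<open>Inside \<open>W\<close> the level t cancels; across the boundary of
      \<open>W\<close> it adds t, because the value on the other side is 0.\<close>
    have abs: "\<bar>g x - g y\<bar> = \<bar>g' x - g' y\<bar> + t * (i x * (1 - i y) + i y * (1 - i x))"
      if "x \<in> F" "y \<in> F" for x y
      using that t(1) t(2)[of x] t(2)[of y] less.prems(1)[of x] less.prems(1)[of y]
      by (auto simp: g'_def i_def W_def not_less)
    have "(\<Sum>x\<in>F. \<Sum>y\<in>F. b x y / 2 * \<bar>g x - g y\<bar>)
        = (\<Sum>x\<in>F. \<Sum>y\<in>F. b x y / 2 * \<bar>g' x - g' y\<bar>)
          + t / 2 * ((\<Sum>x\<in>F. \<Sum>y\<in>F. b x y * (i x * (1 - i y))) + (\<Sum>x\<in>F. \<Sum>y\<in>F. b x y * (i y * (1 - i x))))"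
      by (simp add: abs algebra_simps sum.distrib sum_distrib_left sum_subtractf)
    \<comment> \<open>Each boundary edge is met once from either end, which cancels the factor
      1/2.\<close>
    also have "(\<Sum>x\<in>F. \<Sum>y\<in>F. b x y * (i y * (1 - i x))) = (\<Sum>x\<in>F. \<Sum>y\<in>F. b x y * (i x * (1 - i y)))"
      by (subst sum.swap) (simp add: b(2))
    also have "(\<Sum>x\<in>F. \<Sum>y\<in>F. b x y * (i x * (1 - i y))) = (\<Sum>x\<in>W. \<Sum>y\<in>F - W. b x y)"
    proof -
      have "(\<Sum>y\<in>F. b x y * (i x * (1 - i y))) = i x * (\<Sum>y\<in>F - W. b x y)" for x
        unfolding sum_distrib_left using F by (intro sum.mono_neutral_cong_right) (auto simp: i_def)
      then show ?thesis
        using F W by (simp add: i_def if_distrib[of "\<lambda>z. z * _"] sum.If_cases Int_absorb1)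
    qed
    finally have E1: "(\<Sum>x\<in>F. \<Sum>y\<in>F. b x y / 2 * \<bar>g x - g y\<bar>)
        = (\<Sum>x\<in>F. \<Sum>y\<in>F. b x y / 2 * \<bar>g' x - g' y\<bar>) + t * (\<Sum>x\<in>W. \<Sum>y\<in>F - W. b x y)" by simp
    have lin: "(\<Sum>x\<in>F. h x * g x) = (\<Sum>x\<in>F. h x * g' x) + t * (\<Sum>x\<in>W. h x)" for h
    proof -
      have "(\<Sum>x\<in>F. h x * i x) = (\<Sum>x\<in>W. h x)"
        using F W by (simp add: i_def if_distrib[of "\<lambda>z. _ * z"] sum.If_cases Int_absorb1)
      then show ?thesis by (simp add: g'_def algebra_simps sum_subtractf sum_distrib_left[symmetric])
    qed
    have "t * (\<alpha> * (\<Sum>x\<in>W. n x)) \<le> t * ((\<Sum>x\<in>W. \<Sum>y\<in>F - W. b x y) + (\<Sum>x\<in>W. c x))"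
      using t(1) W(3) False by (intro mult_left_mono iso) auto
    then show ?thesis using IH unfolding E1 lin by (simp add: algebra_simps)
  qed
qed

text \<open>The coarea inequality is applied to the squared modulus of u. Each difference of squares
  factors into a difference and a sum; AM-GM sends the difference to the energy and the sum to at
  most half of \<alpha> N, which is absorbed on the left and leaves the constant
  \<alpha>^2/2.\<close>

lemma cheeger_inequality:
  fixes b :: "'v \<Rightarrow> 'v \<Rightarrow> real" and c n :: "'v \<Rightarrow> real" and u :: "'v \<Rightarrow> complex"
  assumes F: "finite F" and b: "\<And>x y. 0 \<le> b x y" "\<And>x y. b x y = b y x"
    and c: "\<And>x. 0 \<le> c x" and n: "\<And>x. x \<in> F0 \<Longrightarrow> (\<Sum>y\<in>F. b x y) + c x = n x"
    and iso: "\<And>W. W \<subseteq> F0 \<Longrightarrow> W \<noteq> {} \<Longrightarrow> \<alpha> * (\<Sum>x\<in>W. n x) \<le> (\<Sum>x\<in>W. \<Sum>y\<in>F - W. b x y) + (\<Sum>x\<in>W. c x)"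
    and F0: "F0 \<subseteq> F" and u: "\<And>x. x \<in> F \<Longrightarrow> x \<notin> F0 \<Longrightarrow> u x = 0" and \<alpha>: "\<alpha> > 0"
  shows "\<alpha>\<^sup>2 / 2 * (\<Sum>x\<in>F. n x * (cmod (u x))\<^sup>2)
     \<le> (\<Sum>x\<in>F. \<Sum>y\<in>F. b x y / 2 * (cmod (u x - u y))\<^sup>2) + (\<Sum>x\<in>F. c x * (cmod (u x))\<^sup>2)"
proof -
  define g where "g x = (cmod (u x))\<^sup>2" for x
  define N where "N = (\<Sum>x\<in>F. n x * g x)"
  define E where "E = (\<Sum>x\<in>F. \<Sum>y\<in>F. b x y / 2 * (cmod (u x - u y))\<^sup>2)"
  define C where "C = (\<Sum>x\<in>F. c x * g x)"
  define D where "D = (\<Sum>x\<in>F. \<Sum>y\<in>F. b x y * g x)"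
  have C0: "0 \<le> C" unfolding C_def g_def using c by (intro sum_nonneg) auto
  have N: "N = D + C"
  proof -
    have "n x * g x = (\<Sum>y\<in>F. b x y * g x) + c x * g x" if "x \<in> F" for x
    proof (cases "x \<in> F0")
      case True
      show ?thesis unfolding n[OF True, symmetric] distrib_right sum_distrib_right ..
    qed (use u[OF that] in \<open>simp add: g_def\<close>)
    then show ?thesis by (simp add: N_def D_def C_def sum.distrib)
  qed
  \<comment> \<open>AM-GM with the parameter \<open>\<alpha> / 2\<close>\<close>
  have amgm: "b x y / 2 * \<bar>g x - g y\<bar> \<le> 1 / \<alpha> * (b x y / 2 * (cmod (u x - u y))\<^sup>2) + \<alpha> / 4 * (b x y * g x + b x y * g y)" for x y
  proof -
    define p where "p = cmod (u x - u y)"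
    define q where "q = cmod (u x) + cmod (u y)"
    have "g x - g y = (cmod (u x) - cmod (u y)) * q" by (simp add: g_def q_def power2_eq_square algebra_simps)
    moreover have "q \<ge> 0" by (simp add: q_def)
    ultimately have "\<bar>g x - g y\<bar> = \<bar>cmod (u x) - cmod (u y)\<bar> * q" by (simp add: abs_mult)
    also have "\<dots> \<le> p * q" unfolding p_def q_def by (intro mult_right_mono norm_triangle_ineq3) auto
    also have "\<dots> \<le> p\<^sup>2 / \<alpha> + \<alpha> / 4 * q\<^sup>2"
    proof -
      have "0 \<le> (p - \<alpha> / 2 * q)\<^sup>2 / \<alpha>" using \<alpha> by simp
      also have "\<dots> = p\<^sup>2 / \<alpha> + \<alpha> / 4 * q\<^sup>2 - p * q" using \<alpha> by (simp add: field_simps power2_eq_square)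
      finally show ?thesis by simp
    qed
    also have "q\<^sup>2 \<le> 2 * g x + 2 * g y"
      using sum_squares_bound[of "cmod (u x)" "cmod (u y)"] by (simp add: q_def g_def power2_sum)
    finally have "\<bar>g x - g y\<bar> \<le> p\<^sup>2 / \<alpha> + \<alpha> / 4 * (2 * g x + 2 * g y)" using \<alpha> by (simp add: mult_left_mono)
    then have "b x y / 2 * \<bar>g x - g y\<bar> \<le> b x y / 2 * (p\<^sup>2 / \<alpha> + \<alpha> / 4 * (2 * g x + 2 * g y))"
      using b(1)[of x y] by (intro mult_left_mono) auto
    then show ?thesis by (simp add: p_def algebra_simps)
  qed
  have swap: "(\<Sum>x\<in>F. \<Sum>y\<in>F. b x y * g y) = D" unfolding D_def by (subst sum.swap) (simp add: b(2))
  \<comment> \<open>Lets the potential term \<open>C\<close> be divided in the same way as the edge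
    terms; it is the inequality 0 \<le> (1 - \<alpha>/2)^2.\<close>
  have one: "1 \<le> 1 / \<alpha> + \<alpha> / 4"
  proof -
    have "0 \<le> (1 - \<alpha> / 2)\<^sup>2 / \<alpha>" using \<alpha> by simp
    also have "\<dots> = 1 / \<alpha> + \<alpha> / 4 - 1" using \<alpha> by (simp add: field_simps power2_eq_square)
    finally show ?thesis by simp
  qed
  have "\<alpha> * N \<le> (\<Sum>x\<in>F. \<Sum>y\<in>F. b x y / 2 * \<bar>g x - g y\<bar>) + C"
    unfolding N_def C_def
    by (rule coarea_inequality[OF F b iso F0]) (use u in \<open>auto simp: g_def\<close>)
  also have "(\<Sum>x\<in>F. \<Sum>y\<in>F. b x y / 2 * \<bar>g x - g y\<bar>)
     \<le> (\<Sum>x\<in>F. \<Sum>y\<in>F. 1 / \<alpha> * (b x y / 2 * (cmod (u x - u y))\<^sup>2) + \<alpha> / 4 * (b x y * g x + b x y * g y))"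
    by (intro sum_mono amgm)
  also have "\<dots> = 1 / \<alpha> * E + \<alpha> / 4 * (D + (\<Sum>x\<in>F. \<Sum>y\<in>F. b x y * g y))"
    unfolding E_def D_def by (simp only: sum.distrib sum_distrib_left distrib_left)
  also have "\<dots> = 1 / \<alpha> * E + \<alpha> / 2 * D" unfolding swap by simp
  also have "C \<le> (1 / \<alpha> + \<alpha> / 4) * C" using mult_right_mono[OF one C0] by simp
  finally have "\<alpha> * N \<le> 1 / \<alpha> * (E + C) + \<alpha> / 2 * N - \<alpha> / 4 * C" unfolding N by (simp add: algebra_simps add_divide_distrib)
  also have "\<dots> \<le> 1 / \<alpha> * (E + C) + \<alpha> / 2 * N" using \<alpha> C0 by simp
  finally have "\<alpha> / 2 * N \<le> 1 / \<alpha> * (E + C)" by linarith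
  from mult_left_mono[OF this, of \<alpha>] \<alpha> have "\<alpha>\<^sup>2 / 2 * N \<le> E + C" by (simp add: power2_eq_square)
  then show ?thesis by (simp add: N_def E_def C_def g_def)
qed

section \<open>Weighted square-summable functions in unweighted coordinates\<close>

definition emb :: "('v \<Rightarrow> real) \<Rightarrow> ('v \<Rightarrow> complex) \<Rightarrow> 'v ell2" where
  "emb w u = Ell2 (\<lambda>x. complex_of_real (sqrt (w x)) * u x)"

lemma coord_emb:
  assumes "\<And>x. w x > 0" "u \<in> l2 w"
  shows "coord (emb w u) x = complex_of_real (sqrt (w x)) * u x"
proof -
  have "(\<lambda>x. (cmod (complex_of_real (sqrt (w x)) * u x))\<^sup>2) summable_on UNIV"
    using assms by (simp add: l2_def norm_mult power_mult_distrib less_imp_le)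
  then show ?thesis by (simp add: emb_def coord_Ell2)
qed

lemma emb_surj:
  assumes "\<And>x. w x > 0"
  shows "(\<lambda>x. coord f x / complex_of_real (sqrt (w x))) \<in> l2 w"
    and "emb w (\<lambda>x. coord f x / complex_of_real (sqrt (w x))) = f"
proof -
  have nz: "sqrt (w x) \<noteq> 0" and w0: "w x \<noteq> 0" "0 \<le> w x" for x using assms[of x] by auto
  show *: "(\<lambda>x. coord f x / complex_of_real (sqrt (w x))) \<in> l2 w"
    using coord_summable[of f] w0 by (simp add: l2_def norm_divide power_divide)
  show "emb w (\<lambda>x. coord f x / complex_of_real (sqrt (w x))) = f"
    by (rule ell2_eqI) (use nz in \<open>simp add: coord_emb[OF assms *]\<close>)
qed

lemma emb_inj:
  assumes "\<And>x. w x > 0" "u \<in> l2 w" "u' \<in> l2 w" "emb w u = emb w u'"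
  shows "u = u'"
proof
  fix x
  have "sqrt (w x) \<noteq> 0" using assms(1)[of x] by simp
  moreover have "complex_of_real (sqrt (w x)) * u x = complex_of_real (sqrt (w x)) * u' x"
    using coord_emb[OF assms(1,2), of x] coord_emb[OF assms(1,3), of x] assms(4) by metis
  ultimately show "u x = u' x" by auto
qed

lemma norm_emb:
  assumes "\<And>x. w x > 0" "u \<in> l2 w"
  shows "norm (emb w u) = l2norm w u"
proof -
  have "(norm (emb w u))\<^sup>2 = (\<Sum>\<^sub>\<infinity>x. w x * (cmod (u x))\<^sup>2)"
    unfolding norm_ell2_sq coord_emb[OF assms] using assms(1)
    by (simp add: norm_mult power_mult_distrib less_imp_le)
  then show ?thesis unfolding l2norm_def by (metis norm_ge_zero real_sqrt_unique)
qed

lemma cinner_emb: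
  assumes "\<And>x. w x > 0" "u \<in> l2 w" "v \<in> l2 w"
  shows "cinner (emb w u) (emb w v) = l2inner w u v"
proof -
  have "complex_of_real (sqrt (w x)) * u x * cnj (complex_of_real (sqrt (w x)) * v x)
      = complex_of_real (w x) * u x * cnj (v x)" for x
  proof -
    have "complex_of_real (sqrt (w x)) * complex_of_real (sqrt (w x)) = complex_of_real (w x)"
      using assms(1)[of x] by (simp flip: of_real_mult)
    then show ?thesis by (simp add: algebra_simps)
  qed
  then show ?thesis unfolding cinner_def l2inner_def coord_emb[OF assms(1,2)] coord_emb[OF assms(1,3)] by presburger
qed

lemma l2_lincomb:
  assumes "\<And>x. w x > 0" "u \<in> l2 w" "v \<in> l2 w"
  shows "(\<lambda>x. u x + z * v x) \<in> l2 w" "emb w (\<lambda>x. u x + z * v x) = emb w u + cscale z (emb w v)"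
proof -
  define f where "f = emb w u + cscale z (emb w v)"
  have nz: "complex_of_real (sqrt (w x)) \<noteq> 0" for x using assms(1)[of x] by simp
  have "(\<lambda>x. coord f x / complex_of_real (sqrt (w x))) = (\<lambda>x. u x + z * v x)"
    using nz by (intro ext) (simp add: f_def coord_emb[OF assms(1,2)] coord_emb[OF assms(1,3)] field_simps)
  with emb_surj[of w f, OF assms(1)] show "(\<lambda>x. u x + z * v x) \<in> l2 w" "emb w (\<lambda>x. u x + z * v x) = f" by auto
qed

lemma fin_supp_l2: "fin_supp u \<Longrightarrow> u \<in> l2 w"
  unfolding fin_supp_def l2_def mem_Collect_eq
  by (rule finite_nonzero_values_imp_summable_on, erule finite_subset[rotated]) auto

section \<open>The resolvent\<close>

locale isoperimetric_graph =
  fixes b :: "'v \<Rightarrow> 'v \<Rightarrow> real" and c m :: "'v \<Rightarrow> real"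
  assumes graph: "weighted_graph b c" and lf: "locally_finite b"
    and deg: "\<forall>x. gdeg b c x > 0" and meas: "pos_measure m" and ch: "cheeger b c UNIV > 0"
begin

abbreviation n :: "'v \<Rightarrow> real" where "n \<equiv> gdeg b c"

text \<open>Q plus the squared \<open>m\<close>-norm is comparable with the squared norm of this
  weight; hence \<open>l2 k\<close> turns out to be the form domain in
  \<open>formdom_eq\<close>.\<close>

definition k :: "'v \<Rightarrow> real" where "k x = n x + m x"

definition nb :: "'v \<Rightarrow> 'v set" where "nb x = {y. b x y > 0}"

lemma b_nonneg: "0 \<le> b x y" and c_nonneg: "0 \<le> c x" and b_sym: "b x y = b y x"
  using graph by (auto simp: weighted_graph_def)

lemma n_pos: "n x > 0" and m_pos: "m x > 0" and k_pos: "k x > 0"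
  using deg meas by (auto simp: pos_measure_def k_def add_pos_pos)

lemma finite_nb: "finite (nb x)" using lf by (simp add: locally_finite_def nb_def)

lemma b_eq_0: "y \<notin> nb x \<Longrightarrow> b x y = 0" using b_nonneg[of x y] by (simp add: nb_def)

lemma nb_sym: "y \<in> nb x \<longleftrightarrow> x \<in> nb y" using b_sym by (simp add: nb_def)

lemma gdeg_sum:
  assumes "finite F" "nb x \<subseteq> F" shows "n x = (\<Sum>y\<in>F. b x y) + c x"
proof -
  have "(\<Sum>\<^sub>\<infinity>y. b x y) = (\<Sum>\<^sub>\<infinity>y\<in>F. b x y)"
    using assms b_eq_0 by (intro infsum_cong_neutral) auto
  then show ?thesis using assms by (simp add: gdeg_def)
qed

lemma sum_b_le: assumes "finite F" shows "(\<Sum>y\<in>F. b x y) \<le> n x"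
proof -
  have "(\<Sum>y\<in>F. b x y) \<le> (\<Sum>y\<in>F \<union> nb x. b x y)"
    using assms finite_nb b_nonneg by (intro sum_mono2) auto
  then show ?thesis using gdeg_sum[of "F \<union> nb x" x] assms finite_nb[of x] c_nonneg[of x] by simp
qed

lemma cheeger_isoperimetric:
  assumes F: "finite F" "\<And>x. x \<in> W \<Longrightarrow> nb x \<subseteq> F" and W: "W \<subseteq> F" "W \<noteq> {}"
  shows "cheeger b c UNIV * (\<Sum>x\<in>W. n x) \<le> (\<Sum>x\<in>W. \<Sum>y\<in>F - W. b x y) + (\<Sum>x\<in>W. c x)"
proof -
  have fW: "finite W" using F W finite_subset by blast
  have "(\<Sum>\<^sub>\<infinity>y\<in>UNIV - W. b x y) = (\<Sum>y\<in>F - W. b x y)" if "x \<in> W" for x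
  proof -
    have "(\<Sum>\<^sub>\<infinity>y\<in>UNIV - W. b x y) = (\<Sum>\<^sub>\<infinity>y\<in>F - W. b x y)"
      using F(2)[OF that] b_eq_0 by (intro infsum_cong_neutral) auto
    then show ?thesis using F by simp
  qed
  then have bd: "bdry_size b c W = (\<Sum>x\<in>W. \<Sum>y\<in>F - W. b x y) + (\<Sum>x\<in>W. c x)"
    by (simp add: bdry_size_def)
  have bd_nonneg: "0 \<le> bdry_size b c W" for W
    unfolding bdry_size_def using b_nonneg c_nonneg by (intro add_nonneg_nonneg sum_nonneg infsum_nonneg) auto
  have n_nonneg: "0 \<le> (\<Sum>x\<in>W. n x)" for W using n_pos by (intro sum_nonneg) (auto intro: less_imp_le)
  have "cheeger b c UNIV \<le> bdry_size b c W / (\<Sum>x\<in>W. n x)"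
    unfolding cheeger_def
  proof (rule cInf_lower)
    show "bdd_below {bdry_size b c W / (\<Sum>x\<in>W. n x) |W. W \<subseteq> UNIV \<and> finite W \<and> W \<noteq> {}}"
      using bd_nonneg n_nonneg by (intro bdd_belowI[of _ 0]) (auto intro!: divide_nonneg_nonneg)
  qed (use fW W in auto)
  moreover have "(\<Sum>x\<in>W. n x) > 0" using n_pos fW W by (intro sum_pos) auto
  ultimately show ?thesis unfolding bd by (simp add: pos_le_divide_eq)
qed

text \<open>Besides the support, \<open>F\<close> holds all its neighbours: every edge with a
  nonzero contribution then lies in F \<times> F, and the full degree of a support point is seen
  inside \<open>F\<close>. Local finiteness provides such an \<open>F\<close>.\<close>

definition core :: "'v set \<Rightarrow> ('v \<Rightarrow> complex) \<Rightarrow> bool" where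
  "core F u \<longleftrightarrow> finite F \<and> (\<forall>x. u x \<noteq> 0 \<longrightarrow> x \<in> F \<and> nb x \<subseteq> F)"

lemma core_exists:
  assumes "fin_supp u" "fin_supp v" obtains F where "core F u" "core F v"
proof
  define S where "S = {x. u x \<noteq> 0} \<union> {x. v x \<noteq> 0}"
  show "core (S \<union> (\<Union>x\<in>S. nb x)) u" "core (S \<union> (\<Union>x\<in>S. nb x)) v"
    using assms finite_nb by (auto simp: core_def S_def fin_supp_def)
qed

lemma core_edge:
  assumes "core F u" "(x, y) \<notin> F \<times> F" "b x y \<noteq> 0" shows "u x = 0" "u y = 0"
  using assms b_eq_0[of y x] nb_sym[of y x] by (auto simp: core_def)

text \<open>Discrete Green formula: expanding the product and exchanging x and y turns the symmetric
  sum into a Laplacian of u paired with v, where the edge weights at x and \<open>c x\<close> add up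
  to \<open>n x\<close>.\<close>

lemma qmax_core:
  assumes u: "core F u" and v: "core F v"
  shows "qmax b c u v = (\<Sum>x\<in>F. (complex_of_real (n x) * u x - (\<Sum>y\<in>F. complex_of_real (b x y) * u y)) * cnj (v x))"
proof -
  let ?b = "\<lambda>x y. complex_of_real (b x y)"
  have F: "finite F" using u by (simp add: core_def)
  have "(\<Sum>\<^sub>\<infinity>(x,y). complex_of_real (b x y / 2) * (u x - u y) * cnj (v x - v y))
      = (\<Sum>\<^sub>\<infinity>(x,y)\<in>F \<times> F. complex_of_real (b x y / 2) * (u x - u y) * cnj (v x - v y))"
    using core_edge[OF u] core_edge[OF v] by (intro infsum_cong_neutral) fastforce+
  also have "\<dots> = (\<Sum>x\<in>F. \<Sum>y\<in>F. complex_of_real (b x y / 2) * (u x - u y) * cnj (v x - v y))"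
    using F by (simp add: sum.cartesian_product)
  also have "\<dots> = (\<Sum>x\<in>F. \<Sum>y\<in>F. ?b x y / 2 * (u x * cnj (v x))) + (\<Sum>x\<in>F. \<Sum>y\<in>F. ?b x y / 2 * (u y * cnj (v y)))
      - (\<Sum>x\<in>F. \<Sum>y\<in>F. ?b x y / 2 * (u y * cnj (v x))) - (\<Sum>x\<in>F. \<Sum>y\<in>F. ?b x y / 2 * (u x * cnj (v y)))"
    unfolding sum.distrib[symmetric] sum_subtractf[symmetric]
    by (intro sum.cong refl) (simp add: algebra_simps add_divide_distrib diff_divide_distrib)
  also have "(\<Sum>x\<in>F. \<Sum>y\<in>F. ?b x y / 2 * (u y * cnj (v y))) = (\<Sum>x\<in>F. \<Sum>y\<in>F. ?b x y / 2 * (u x * cnj (v x)))"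
    by (subst sum.swap) (simp add: b_sym)
  also have "(\<Sum>x\<in>F. \<Sum>y\<in>F. ?b x y / 2 * (u x * cnj (v y))) = (\<Sum>x\<in>F. \<Sum>y\<in>F. ?b x y / 2 * (u y * cnj (v x)))"
    by (subst sum.swap) (simp add: b_sym)
  finally have 1: "(\<Sum>\<^sub>\<infinity>(x,y). complex_of_real (b x y / 2) * (u x - u y) * cnj (v x - v y))
      = (\<Sum>x\<in>F. (\<Sum>y\<in>F. ?b x y * (u x * cnj (v x))) - (\<Sum>y\<in>F. ?b x y * (u y * cnj (v x))))"
    by (simp add: sum_subtractf sum_divide_distrib[symmetric])
  have "(\<Sum>\<^sub>\<infinity>x. complex_of_real (c x) * u x * cnj (v x)) = (\<Sum>\<^sub>\<infinity>x\<in>F. complex_of_real (c x) * u x * cnj (v x))"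
    using u by (intro infsum_cong_neutral) (auto simp: core_def)
  then have 2: "(\<Sum>\<^sub>\<infinity>x. complex_of_real (c x) * u x * cnj (v x)) = (\<Sum>x\<in>F. complex_of_real (c x) * u x * cnj (v x))"
    using F by simp
  have "(\<Sum>y\<in>F. ?b x y * (u x * cnj (v x))) - (\<Sum>y\<in>F. ?b x y * (u y * cnj (v x))) + complex_of_real (c x) * u x * cnj (v x)
     = (complex_of_real (n x) * u x - (\<Sum>y\<in>F. ?b x y * u y)) * cnj (v x)" for x
  proof (cases "v x = 0")
    case False
    then have "n x = (\<Sum>y\<in>F. b x y) + c x" using v by (intro gdeg_sum) (auto simp: core_def)
    then have "complex_of_real (n x) = (\<Sum>y\<in>F. ?b x y) + complex_of_real (c x)" by simp
    then show ?thesis by (simp add: algebra_simps sum_distrib_left sum_distrib_right)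
  qed simp
  then show ?thesis unfolding qmax_def 1 2 sum.distrib[symmetric] by simp
qed

lemma Qmax_core:
  assumes u: "core F u"
  shows "Qmax b c u = (\<Sum>x\<in>F. \<Sum>y\<in>F. b x y / 2 * (cmod (u x - u y))\<^sup>2) + (\<Sum>x\<in>F. c x * (cmod (u x))\<^sup>2)"
proof -
  have F: "finite F" using u by (simp add: core_def)
  have "(\<Sum>\<^sub>\<infinity>(x,y). b x y / 2 * (cmod (u x - u y))\<^sup>2) = (\<Sum>\<^sub>\<infinity>(x,y)\<in>F \<times> F. b x y / 2 * (cmod (u x - u y))\<^sup>2)"
    using core_edge[OF u] by (intro infsum_cong_neutral) fastforce+
  then have 1: "(\<Sum>\<^sub>\<infinity>(x,y). b x y / 2 * (cmod (u x - u y))\<^sup>2) = (\<Sum>x\<in>F. \<Sum>y\<in>F. b x y / 2 * (cmod (u x - u y))\<^sup>2)"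
    using F by (simp add: sum.cartesian_product)
  have "(\<Sum>\<^sub>\<infinity>x. c x * (cmod (u x))\<^sup>2) = (\<Sum>\<^sub>\<infinity>x\<in>F. c x * (cmod (u x))\<^sup>2)"
    using u by (intro infsum_cong_neutral) (auto simp: core_def)
  with 1 F show ?thesis by (simp add: Qmax_def)
qed

lemma Qmax_eq_qmax:
  assumes "fin_supp u" shows "Qmax b c u = Re (qmax b c u u)"
proof -
  obtain F where u: "core F u" using core_exists[OF assms assms] .
  have F: "finite F" using u by (simp add: core_def)
  have 1: "(\<Sum>\<^sub>\<infinity>(x,y). complex_of_real (b x y / 2) * (u x - u y) * cnj (u x - u y))
      = (\<Sum>x\<in>F. \<Sum>y\<in>F. complex_of_real (b x y / 2) * (u x - u y) * cnj (u x - u y))"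
  proof -
    have "(\<Sum>\<^sub>\<infinity>(x,y). complex_of_real (b x y / 2) * (u x - u y) * cnj (u x - u y))
      = (\<Sum>\<^sub>\<infinity>(x,y)\<in>F \<times> F. complex_of_real (b x y / 2) * (u x - u y) * cnj (u x - u y))"
      using core_edge[OF u] by (intro infsum_cong_neutral) fastforce+
    then show ?thesis using F by (simp add: sum.cartesian_product)
  qed
  have 2: "(\<Sum>\<^sub>\<infinity>x. complex_of_real (c x) * u x * cnj (u x)) = (\<Sum>x\<in>F. complex_of_real (c x) * u x * cnj (u x))"
  proof -
    have "(\<Sum>\<^sub>\<infinity>x. complex_of_real (c x) * u x * cnj (u x)) = (\<Sum>\<^sub>\<infinity>x\<in>F. complex_of_real (c x) * u x * cnj (u x))"
      using u by (intro infsum_cong_neutral) (auto simp: core_def)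
    then show ?thesis using F by simp
  qed
  have "complex_of_real r * z * cnj z = complex_of_real (r * (cmod z)\<^sup>2)" for r z
    unfolding of_real_mult complex_norm_square by (simp add: mult.assoc)
  then show ?thesis unfolding qmax_def 1 2 Qmax_core[OF u] by (simp only: Re_sum plus_complex.sel Re_complex_of_real)
qed

lemma Qmax_cheeger:
  assumes u: "core F u"
  shows "(cheeger b c UNIV)\<^sup>2 / 2 * (\<Sum>x\<in>F. n x * (cmod (u x))\<^sup>2) \<le> Qmax b c u"
  unfolding Qmax_core[OF u]
proof (rule cheeger_inequality[where F=F and b=b and c=c and n=n and u=u and F0="{x. u x \<noteq> 0}"])
  show "finite F" "{x. u x \<noteq> 0} \<subseteq> F" using u by (auto simp: core_def)
  show "(\<Sum>y\<in>F. b x y) + c x = n x" if "x \<in> {x. u x \<noteq> 0}" for x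
    using that u by (intro gdeg_sum[symmetric]) (auto simp: core_def)
  show "cheeger b c UNIV * (\<Sum>x\<in>W. n x) \<le> (\<Sum>x\<in>W. \<Sum>y\<in>F - W. b x y) + (\<Sum>x\<in>W. c x)"
    if "W \<subseteq> {x. u x \<noteq> 0}" "W \<noteq> {}" for W
    using that u by (intro cheeger_isoperimetric) (auto simp: core_def)
qed (use b_nonneg b_sym c_nonneg ch in auto)

section \<open>The form and the resolvent in \<open>k\<close>-coordinates\<close>

definition \<beta> :: "'v \<Rightarrow> 'v \<Rightarrow> real" where "\<beta> x y = b x y / (sqrt (k x) * sqrt (k y))"

lemma \<beta>_sym: "\<beta> x y = \<beta> y x" by (simp add: \<beta>_def b_sym mult.commute)

lemma \<beta>_nonneg: "0 \<le> \<beta> x y"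
  using b_nonneg[of x y] k_pos[of x] k_pos[of y] by (simp add: \<beta>_def)

definition adj :: "'v ell2 \<Rightarrow> 'v ell2" where
  "adj f = Ell2 (\<lambda>x. \<Sum>y\<in>nb x. complex_of_real (\<beta> x y) * coord f y)"

text \<open>Schur test.\<close>
lemma adj_bound:
  assumes F: "finite F"
  shows "(\<Sum>x\<in>F. (cmod (\<Sum>y\<in>nb x. complex_of_real (\<beta> x y) * coord f y))\<^sup>2) \<le> (norm f)\<^sup>2"
proof -
  have sk: "sqrt (k x) > 0" "sqrt (k x) * sqrt (k x) = k x" for x using k_pos[of x] by auto
  have 1: "(cmod (\<Sum>y\<in>nb x. complex_of_real (\<beta> x y) * coord f y))\<^sup>2 \<le> (\<Sum>y\<in>nb x. b x y / k y * (cmod (coord f y))\<^sup>2)" for x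
  proof -
    \<comment> \<open>Cauchy-Schwarz with these two factors produces the row sum of \<open>b\<close>
      at x divided by \<open>k x\<close>, at most 1 because n \<le> k; the later sum over x uses the
      same bound at y.\<close>
    have split: "\<beta> x y * r = (sqrt (b x y) / sqrt (k x)) * (sqrt (b x y) / sqrt (k y) * r)" for y r
      using b_nonneg[of x y] by (simp add: \<beta>_def)
    have "cmod (\<Sum>y\<in>nb x. complex_of_real (\<beta> x y) * coord f y) \<le> (\<Sum>y\<in>nb x. \<beta> x y * cmod (coord f y))"
      using \<beta>_nonneg by (intro order_trans[OF norm_sum] sum_mono) (simp add: norm_mult)
    then have "(cmod (\<Sum>y\<in>nb x. complex_of_real (\<beta> x y) * coord f y))\<^sup>2
        \<le> (\<Sum>y\<in>nb x. (sqrt (b x y) / sqrt (k x)) * (sqrt (b x y) / sqrt (k y) * cmod (coord f y)))\<^sup>2"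
      unfolding split by (intro power_mono) auto
    also have "\<dots> \<le> (\<Sum>y\<in>nb x. (sqrt (b x y) / sqrt (k x))\<^sup>2) * (\<Sum>y\<in>nb x. (sqrt (b x y) / sqrt (k y) * cmod (coord f y))\<^sup>2)"
      by (rule Cauchy_Schwarz_ineq_sum)
    also have "(\<Sum>y\<in>nb x. (sqrt (b x y) / sqrt (k y) * cmod (coord f y))\<^sup>2) = (\<Sum>y\<in>nb x. b x y / k y * (cmod (coord f y))\<^sup>2)"
      using b_nonneg k_pos by (intro sum.cong refl) (simp add: power_mult_distrib power_divide less_imp_le)
    also have "(\<Sum>y\<in>nb x. (sqrt (b x y) / sqrt (k x))\<^sup>2) = (\<Sum>y\<in>nb x. b x y) / k x"
      using b_nonneg k_pos[of x] by (simp add: power_divide sum_divide_distrib)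
    also have "(\<Sum>y\<in>nb x. b x y) / k x * (\<Sum>y\<in>nb x. b x y / k y * (cmod (coord f y))\<^sup>2)
        \<le> 1 * (\<Sum>y\<in>nb x. b x y / k y * (cmod (coord f y))\<^sup>2)"
    proof (rule mult_right_mono)
      show "(\<Sum>y\<in>nb x. b x y) / k x \<le> 1"
        using sum_b_le[OF finite_nb, of x x] k_pos[of x] m_pos[of x] by (simp add: k_def)
    qed (use b_nonneg k_pos in \<open>auto intro!: sum_nonneg mult_nonneg_nonneg simp: less_imp_le\<close>)
    finally show ?thesis by simp
  qed
  define Y where "Y = (\<Union>x\<in>F. nb x)"
  have Y: "finite Y" using F finite_nb by (simp add: Y_def)
  have "(\<Sum>x\<in>F. (cmod (\<Sum>y\<in>nb x. complex_of_real (\<beta> x y) * coord f y))\<^sup>2)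
      \<le> (\<Sum>x\<in>F. \<Sum>y\<in>nb x. b x y / k y * (cmod (coord f y))\<^sup>2)" by (intro sum_mono 1)
  also have "\<dots> = (\<Sum>x\<in>F. \<Sum>y\<in>Y. b x y / k y * (cmod (coord f y))\<^sup>2)"
    using Y b_eq_0 by (intro sum.cong refl sum.mono_neutral_left) (auto simp: Y_def)
  also have "\<dots> = (\<Sum>y\<in>Y. (\<Sum>x\<in>F. b y x) / k y * (cmod (coord f y))\<^sup>2)"
    by (subst sum.swap) (simp add: b_sym[of _ "_ :: 'v"] sum_distrib_right sum_divide_distrib)
  also have "\<dots> \<le> (\<Sum>y\<in>Y. 1 * (cmod (coord f y))\<^sup>2)"
  proof (intro sum_mono mult_right_mono)
    show "(\<Sum>x\<in>F. b y x) / k y \<le> 1" for y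
      using sum_b_le[OF F, of y] k_pos[of y] m_pos[of y] by (simp add: k_def)
  qed auto
  also have "\<dots> \<le> (norm f)\<^sup>2" using sum_coord_le_norm[OF Y] by simp
  finally show ?thesis .
qed

lemma coord_adj: "coord (adj f) x = (\<Sum>y\<in>nb x. complex_of_real (\<beta> x y) * coord f y)"
  unfolding adj_def by (subst coord_Ell2) (rule square_summableI[OF adj_bound], simp_all)

lemma norm_adj_le: "norm (adj f) \<le> norm f"
  by (rule norm_ell2_leI) (use adj_bound in \<open>auto simp: coord_adj\<close>)

lemma bounded_linear_adj: "bounded_linear adj"
  by (rule bounded_linear_intro[where K=1])
     (auto intro!: ell2_eqI simp: coord_adj norm_adj_le algebra_simps sum.distrib scaleR_sum_right)

lemma adj_cscale: "adj (cscale w f) = cscale w (adj f)"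
  by (rule ell2_eqI) (simp add: coord_adj sum_distrib_left mult.left_commute)

lemma coord_adj_restr:
  assumes "finite K" shows "coord (adj (restr K f)) x = (\<Sum>y\<in>K. complex_of_real (\<beta> x y) * coord f y)"
  unfolding coord_adj using assms finite_nb b_eq_0[of _ x]
  by (intro sum.mono_neutral_cong) (auto simp: \<beta>_def)

lemma inner_restr_finite:
  assumes "finite K" shows "inner f (restr K g) = (\<Sum>x\<in>K. Re (coord f x * cnj (coord g x)))"
proof -
  have "(\<Sum>\<^sub>\<infinity>x. coord f x * cnj (coord (restr K g) x)) = (\<Sum>\<^sub>\<infinity>x\<in>K. coord f x * cnj (coord g x))"
    by (rule infsum_cong_neutral) auto
  then show ?thesis using assms by (simp add: inner_ell2.rep_eq)
qed

text \<open>Symmetry of \<beta> gives the claim for finite supports, and boundedness extends it one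
  argument at a time.\<close>

lemma inner_adj: "inner (adj f) g = inner f (adj g)"
proof -
  have fin: "inner (adj (restr K f)) (restr L g) = inner (restr K f) (adj (restr L g))"
    if "finite K" "finite L" for K L
  proof -
    have "inner (adj (restr K f)) (restr L g) = (\<Sum>x\<in>L. \<Sum>y\<in>K. \<beta> x y * Re (coord f y * cnj (coord g x)))"
      using that by (simp add: inner_restr_finite coord_adj_restr sum_distrib_right)
        (simp add: sum_distrib_right sum_distrib_left algebra_simps sum_subtractf sum.distrib)
    also have "\<dots> = (\<Sum>y\<in>K. \<Sum>x\<in>L. \<beta> y x * Re (coord g x * cnj (coord f y)))"
      by (subst sum.swap) (simp add: \<beta>_sym algebra_simps)
    also have "\<dots> = inner (adj (restr L g)) (restr K f)"
      using that by (simp add: inner_restr_finite coord_adj_restr sum_distrib_right)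
        (simp add: sum_distrib_right sum_distrib_left algebra_simps sum_subtractf sum.distrib)
    finally show ?thesis by (simp add: inner_commute)
  qed
  have "inner (adj (restr K f)) g = inner (restr K f) (adj g)" if K: "finite K" for K
    by (rule bounded_linear_eq_on_finite_support[of "inner (adj (restr K f))" "\<lambda>g. inner (restr K f) (adj g)"])
       (intro bounded_linear_inner_right bounded_linear_compose[OF bounded_linear_inner_right bounded_linear_adj] fin K)+
  then show ?thesis
    by (rule bounded_linear_eq_on_finite_support[OF
        bounded_linear_compose[OF bounded_linear_inner_left bounded_linear_adj] bounded_linear_inner_left])
qed

definition G :: "'v ell2 \<Rightarrow> 'v ell2" where "G f = f - adj f"

lemma bounded_linear_G: "bounded_linear G"
  unfolding G_def by (intro bounded_linear_sub bounded_linear_ident bounded_linear_adj)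

lemma inner_G: "inner (G f) g = inner f (G g)"
  by (simp add: G_def inner_diff_left inner_diff_right inner_adj)

lemma G_cscale: "G (cscale w f) = cscale w (G f)"
  by (rule ell2_eqI) (simp add: G_def adj_cscale algebra_simps)

lemma norm_G_le: "norm (G f) \<le> 2 * norm f"
  unfolding G_def using norm_triangle_ineq4[of f "adj f"] norm_adj_le[of f] by simp

definition \<theta> :: "'v \<Rightarrow> real" where "\<theta> x = sqrt (m x / k x)"

lemma \<theta>_pos: "\<theta> x > 0" and \<theta>_le: "\<bar>\<theta> x\<bar> \<le> 1" and \<theta>_sq: "(\<theta> x)\<^sup>2 = 1 / (wdeg b c m x + 1)"
  using m_pos[of x] n_pos[of x] k_pos[of x] by (auto simp: \<theta>_def k_def wdeg_def field_simps)

abbreviation S :: "'v ell2 \<Rightarrow> 'v ell2" where "S \<equiv> diag \<theta>"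

lemmas coord_S = coord_diag[of \<theta>, OF \<theta>_le]
  and norm_S_le = norm_diag_le[of \<theta>, OF \<theta>_le]
  and bounded_linear_S = bounded_linear_diag[of \<theta>, OF \<theta>_le]
  and inner_S = inner_diag[of \<theta>, OF \<theta>_le]
  and cinner_S = cinner_diag[of \<theta>, OF \<theta>_le]
  and S_cscale = diag_cscale[of \<theta>, OF \<theta>_le]

lemma l2_k_imp_m: "u \<in> l2 k \<Longrightarrow> u \<in> l2 m"
  unfolding l2_def mem_Collect_eq
  by (rule summable_on_comparison_test[of "\<lambda>x. k x * (cmod (u x))\<^sup>2"])
     (use n_pos m_pos in \<open>auto intro!: mult_right_mono simp: k_def less_imp_le\<close>)

lemma emb_m_eq_S:
  assumes "u \<in> l2 k" shows "emb m u = S (emb k u)"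
proof (rule ell2_eqI)
  fix x
  have "sqrt (m x) = \<theta> x * sqrt (k x)" using k_pos[of x] by (simp add: \<theta>_def real_sqrt_divide)
  then show "coord (emb m u) x = coord (S (emb k u)) x"
    by (simp add: coord_S coord_emb[OF m_pos l2_k_imp_m[OF assms]] coord_emb[OF k_pos assms])
qed

text \<open>\<open>G\<close> represents Q plus the inner product of \<open>l2 m\<close>. As
  \<open>S\<close> takes \<open>k\<close>-coordinates to \<open>m\<close>-coordinates, the second
  term removes that inner product again.\<close>

definition qhat :: "'v ell2 \<Rightarrow> 'v ell2 \<Rightarrow> complex" where
  "qhat f g = cinner (G f) g - cinner (S f) (S g)"

lemma tendsto_qhat:
  "(f \<longlongrightarrow> f0) F \<Longrightarrow> (g \<longlongrightarrow> g0) F \<Longrightarrow> ((\<lambda>x. qhat (f x) (g x)) \<longlongrightarrow> qhat f0 g0) F"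
  unfolding qhat_def
  by (intro tendsto_diff tendsto_cinner bounded_linear.tendsto[OF bounded_linear_G]
      bounded_linear.tendsto[OF bounded_linear_S])

lemma cinner_emb_core:
  assumes "core F v" shows "cinner f (emb k v) = (\<Sum>x\<in>F. coord f x * complex_of_real (sqrt (k x)) * cnj (v x))"
proof -
  have v: "v \<in> l2 k" using assms by (intro fin_supp_l2) (auto simp: core_def fin_supp_def intro: finite_subset)
  have "cinner f (emb k v) = (\<Sum>\<^sub>\<infinity>x. coord f x * complex_of_real (sqrt (k x)) * cnj (v x))"
    unfolding cinner_def coord_emb[OF k_pos v] by (simp add: mult.assoc)
  also have "\<dots> = (\<Sum>\<^sub>\<infinity>x\<in>F. coord f x * complex_of_real (sqrt (k x)) * cnj (v x))"
    using assms by (intro infsum_cong_neutral) (auto simp: core_def)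
  finally show ?thesis using assms by (simp add: core_def)
qed

lemma qmax_eq_qhat:
  assumes "fin_supp u" "fin_supp v" shows "qmax b c u v = qhat (emb k u) (emb k v)"
proof -
  obtain F where F: "core F u" "core F v" using core_exists[OF assms] .
  have fF: "finite F" using F by (simp add: core_def)
  have uv: "u \<in> l2 k" "v \<in> l2 k" using assms by (simp_all add: fin_supp_l2)
  have sk: "complex_of_real (sqrt (k x)) \<noteq> 0" "complex_of_real (sqrt (k x)) * complex_of_real (sqrt (k x)) = complex_of_real (k x)" for x
    using k_pos[of x] by (auto simp flip: of_real_mult)
  have restr: "emb k u = restr F (emb k u)"
    using F by (intro ell2_eqI) (auto simp: core_def coord_emb[OF k_pos uv(1)])
  have adj: "coord (adj (emb k u)) x * complex_of_real (sqrt (k x)) = (\<Sum>y\<in>F. complex_of_real (b x y) * u y)" for x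
  proof -
    have "coord (adj (emb k u)) x * complex_of_real (sqrt (k x))
      = (\<Sum>y\<in>F. complex_of_real (\<beta> x y) * (complex_of_real (sqrt (k y)) * u y) * complex_of_real (sqrt (k x)))"
      by (subst restr) (simp add: coord_adj_restr[OF fF] coord_emb[OF k_pos uv(1)] sum_distrib_right)
    also have "\<dots> = (\<Sum>y\<in>F. complex_of_real (b x y) * u y)"
      using sk(1)[of x] sk(1) by (intro sum.cong refl) (simp add: \<beta>_def)
    finally show ?thesis .
  qed
  have 1: "cinner (G (emb k u)) (emb k v) = (\<Sum>x\<in>F. (complex_of_real (k x) * u x - (\<Sum>y\<in>F. complex_of_real (b x y) * u y)) * cnj (v x))"
    unfolding cinner_emb_core[OF F(2)]
  proof (intro sum.cong refl)
    fix x
    have "coord (G (emb k u)) x * complex_of_real (sqrt (k x)) = complex_of_real (k x) * u x - (\<Sum>y\<in>F. complex_of_real (b x y) * u y)"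
      using sk(2)[of x] adj[of x] by (simp add: G_def coord_emb[OF k_pos uv(1)] algebra_simps)
    then show "coord (G (emb k u)) x * complex_of_real (sqrt (k x)) * cnj (v x)
       = (complex_of_real (k x) * u x - (\<Sum>y\<in>F. complex_of_real (b x y) * u y)) * cnj (v x)" by simp
  qed
  have "cinner (S (emb k u)) (S (emb k v)) = l2inner m u v"
    using uv by (simp add: emb_m_eq_S[symmetric] cinner_emb[OF m_pos] l2_k_imp_m)
  also have "\<dots> = (\<Sum>\<^sub>\<infinity>x\<in>F. complex_of_real (m x) * u x * cnj (v x))"
    unfolding l2inner_def using F by (intro infsum_cong_neutral) (auto simp: core_def)
  finally have 2: "cinner (S (emb k u)) (S (emb k v)) = (\<Sum>x\<in>F. complex_of_real (m x) * u x * cnj (v x))"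
    using fF by simp
  show ?thesis unfolding qmax_core[OF F] qhat_def 1 2 sum_subtractf[symmetric]
    by (intro sum.cong refl) (simp add: k_def algebra_simps)
qed

text \<open>The constant of Cheeger's inequality controls the n-part of the weight k, the constant 1
  its m-part.\<close>

definition \<kappa> :: real where "\<kappa> = min 1 ((cheeger b c UNIV)\<^sup>2 / 2)"

lemma \<kappa>_pos: "\<kappa> > 0" using ch by (simp add: \<kappa>_def)

lemma Re_qhat: "Re (qhat f f) = inner (G f) f - (norm (S f))\<^sup>2"
  by (simp add: qhat_def cinner_conv_inner power2_norm_eq_inner)

text \<open>Proved for finite supports, where the form of \<open>G\<close> is \<open>Qmax\<close>
  plus the squared \<open>m\<close>-norm, and extended by continuity of both sides.\<close>

lemma G_coercive: "\<kappa> * (norm f)\<^sup>2 \<le> inner (G f) f"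
proof -
  have fin: "\<kappa> * (norm (restr K f))\<^sup>2 \<le> inner (G (restr K f)) (restr K f)" if K: "finite K" for K
  proof -
    define u where "u x = coord (restr K f) x / complex_of_real (sqrt (k x))" for x
    have eu: "emb k u = restr K f" unfolding u_def by (rule emb_surj[OF k_pos])
    have fu: "fin_supp u" using K by (auto simp: fin_supp_def u_def intro: finite_subset[of _ K])
    obtain F where F: "core F u" using core_exists[OF fu fu] .
    have ul: "u \<in> l2 k" using fu by (rule fin_supp_l2)
    have nrm: "(norm (emb w u))\<^sup>2 = (\<Sum>x\<in>F. w x * (cmod (u x))\<^sup>2)" if w: "\<And>x. w x > 0" for w
    proof -
      have "(norm (emb w u))\<^sup>2 = (\<Sum>\<^sub>\<infinity>x. w x * (cmod (u x))\<^sup>2)"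
        unfolding norm_ell2_sq coord_emb[OF w fin_supp_l2[OF fu]] using w
        by (simp add: norm_mult power_mult_distrib less_imp_le)
      also have "\<dots> = (\<Sum>\<^sub>\<infinity>x\<in>F. w x * (cmod (u x))\<^sup>2)"
        using F by (intro infsum_cong_neutral) (auto simp: core_def)
      finally show ?thesis using F by (simp add: core_def)
    qed
    have "inner (G (emb k u)) (emb k u) = Qmax b c u + (norm (emb m u))\<^sup>2"
      using Re_qhat[of "emb k u"] qmax_eq_qhat[OF fu fu] Qmax_eq_qmax[OF fu] emb_m_eq_S[OF ul] by simp
    moreover have "\<kappa> * (\<Sum>x\<in>F. n x * (cmod (u x))\<^sup>2) \<le> Qmax b c u"
    proof -
      have "\<kappa> * (\<Sum>x\<in>F. n x * (cmod (u x))\<^sup>2) \<le> (cheeger b c UNIV)\<^sup>2 / 2 * (\<Sum>x\<in>F. n x * (cmod (u x))\<^sup>2)"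
        by (intro mult_right_mono sum_nonneg) (use n_pos in \<open>auto simp: \<kappa>_def less_imp_le\<close>)
      then show ?thesis using Qmax_cheeger[OF F] by linarith
    qed
    moreover have "\<kappa> * (\<Sum>x\<in>F. m x * (cmod (u x))\<^sup>2) \<le> 1 * (norm (emb m u))\<^sup>2"
      unfolding nrm[OF m_pos] by (intro mult_right_mono sum_nonneg) (use m_pos in \<open>auto simp: \<kappa>_def less_imp_le\<close>)
    moreover have "(norm (emb k u))\<^sup>2 = (\<Sum>x\<in>F. n x * (cmod (u x))\<^sup>2) + (\<Sum>x\<in>F. m x * (cmod (u x))\<^sup>2)"
      unfolding nrm[OF k_pos] by (simp add: k_def distrib_right sum.distrib)
    ultimately show ?thesis unfolding eu by (simp add: distrib_left)
  qed
  show ?thesis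
  proof (rule tendsto_le)
    show "((\<lambda>K. inner (G (restr K f)) (restr K f)) \<longlongrightarrow> inner (G f) f) (finite_subsets_at_top UNIV)"
      by (intro tendsto_inner bounded_linear.tendsto[OF bounded_linear_G] restr_tendsto)
    show "((\<lambda>K. \<kappa> * (norm (restr K f))\<^sup>2) \<longlongrightarrow> \<kappa> * (norm f)\<^sup>2) (finite_subsets_at_top UNIV)"
      by (intro tendsto_intros restr_tendsto)
  qed (auto intro!: eventually_finite_subsets_at_top_weakI fin)
qed

lemma G_below: "\<kappa> * norm f \<le> norm (G f)"
proof (cases "f = 0")
  case False
  have "\<kappa> * (norm f)\<^sup>2 \<le> norm (G f) * norm f"
    using G_coercive[of f] norm_cauchy_schwarz[of "G f" f] by linarith
  then show ?thesis using False by (simp add: power2_eq_square mult.assoc[symmetric])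
qed simp

lemma G_eq_0: "G f = 0 \<Longrightarrow> f = 0"
  using G_below[of f] \<kappa>_pos by (simp add: mult_le_0_iff)

lemma bij_G: "bij G"
proof (rule bijI)
  show "surj G" by (rule bounded_below_imp_surj[OF bounded_linear_G inner_G \<kappa>_pos G_below G_eq_0])
  show "inj G"
    unfolding linear_injective_0[OF bounded_linear.linear[OF bounded_linear_G]] using G_eq_0 by blast
qed

definition Gi :: "'v ell2 \<Rightarrow> 'v ell2" where "Gi = inv G"

lemma G_Gi [simp]: "G (Gi f) = f" and Gi_G [simp]: "Gi (G f) = f"
  using bij_G by (simp_all add: Gi_def bij_def surj_f_inv_f inv_f_f)

lemma norm_Gi_le: "norm (Gi f) \<le> norm f / \<kappa>"
  using G_below[of "Gi f"] \<kappa>_pos by (simp add: field_simps)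

lemma bounded_linear_Gi: "bounded_linear Gi"
proof (rule bounded_linear_intro[where K="1/\<kappa>"])
  note lin = bounded_linear.linear[OF bounded_linear_G]
  show "Gi (f + g) = Gi f + Gi g" for f g
    using Gi_G[of "Gi f + Gi g"] by (simp add: linear_add[OF lin])
  show "Gi (r *\<^sub>R f) = r *\<^sub>R Gi f" for r f
    using Gi_G[of "r *\<^sub>R Gi f"] by (simp add: linear_scale[OF lin])
qed (use norm_Gi_le in simp)

lemma inner_Gi: "inner (Gi f) g = inner f (Gi g)"
  using inner_G[of "Gi f" "Gi g"] by simp

lemma Gi_cscale: "Gi (cscale w f) = cscale w (Gi f)"
  using Gi_G[of "cscale w (Gi f)"] by (simp add: G_cscale)

definition R :: "'v ell2 \<Rightarrow> 'v ell2" where "R f = S (Gi (S f))"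

sublocale R: selfadjoint_ell2 R
proof (rule selfadjoint_ell2.intro)
  show "bounded_linear R" unfolding R_def
    by (intro bounded_linear_compose[OF bounded_linear_S] bounded_linear_compose[OF bounded_linear_Gi] bounded_linear_S)
  show "inner (R f) g = inner f (R g)" for f g by (simp add: R_def inner_S inner_Gi)
  show "R (cscale w f) = cscale w (R f)" for w f by (simp add: R_def S_cscale Gi_cscale)
qed

lemma S_eq_0: "S f = 0 \<Longrightarrow> f = 0"
proof (rule ell2_eqI)
  fix x assume "S f = 0"
  then have "coord (S f) x = 0" by simp
  then show "coord f x = coord 0 x" using \<theta>_pos[of x] by (simp add: coord_S)
qed

lemma S_inj: "S f = S g \<Longrightarrow> f = g"
  using S_eq_0[of "f - g"] linear_diff[OF bounded_linear.linear[OF bounded_linear_S]] by simp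

lemma R_inj: "R f = R g \<Longrightarrow> f = g"
  unfolding R_def using S_inj G_Gi by metis

text \<open>\<open>G\<close> is nonnegative with norm at most 2, so the squared norm of G g is at
  most twice its form at g. For g = \<open>Gi (S f)\<close> the vector G g is S f and the form is
  that of R at f.\<close>

lemma R_form_lower: "(norm (S f))\<^sup>2 / 2 \<le> inner (R f) f"
proof -
  define g where "g = Gi (S f)"
  have Gg: "G g = S f" by (simp add: g_def)
  have nonneg: "0 \<le> inner (G u) u" for u
    using G_coercive[of u] \<kappa>_pos by (smt (verit) mult_nonneg_nonneg zero_le_power2)
  have "(norm (G g))\<^sup>2 \<le> 2 * inner (G g) g"
    by (rule nonneg_form_norm_bound[OF bounded_linear.linear[OF bounded_linear_G] inner_G nonneg _ norm_G_le]) simp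
  moreover have "inner (R f) f = inner g (G g)" unfolding R_def g_def[symmetric] Gg by (rule inner_S)
  then have "inner (R f) f = inner (G g) g" by (simp only: inner_commute)
  ultimately show ?thesis by (simp add: Gg)
qed

end

section \<open>The operator of the form\<close>

lemma emb_diff:
  assumes "\<And>x. w x > 0" "u \<in> l2 w" "v \<in> l2 w"
  shows "(\<lambda>x. u x - v x) \<in> l2 w" "emb w (\<lambda>x. u x - v x) = emb w u - emb w v"
  using l2_lincomb[OF assms, of "-1"] cscale_of_real[of "-1" "emb w v"] by simp_all

lemma emb_scale:
  assumes "\<And>x. w x > 0" "u \<in> l2 w"
  shows "(\<lambda>x. z * u x) \<in> l2 w" "emb w (\<lambda>x. z * u x) = cscale z (emb w u)"
proof -
  have 0: "(\<lambda>_. 0) \<in> l2 w" by (simp add: l2_def)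
  have "emb w (\<lambda>_. 0) = 0" by (rule ell2_eqI) (simp add: coord_emb[OF assms(1) 0])
  then show "(\<lambda>x. z * u x) \<in> l2 w" "emb w (\<lambda>x. z * u x) = cscale z (emb w u)"
    using l2_lincomb[OF assms(1) 0 assms(2), of z] by simp_all
qed

lemma fin_supp_diff: "fin_supp u \<Longrightarrow> fin_supp v \<Longrightarrow> fin_supp (\<lambda>x. u x - v x)"
  unfolding fin_supp_def by (rule finite_subset[of _ "{x. u x \<noteq> 0} \<union> {x. v x \<noteq> 0}"]) auto

context isoperimetric_graph
begin

text \<open>Detects the form domain: the range of \<open>S\<close> consists precisely of the
  \<open>m\<close>-coordinates of functions in \<open>l2 k\<close>.\<close>

lemma l2_k_if_S:
  assumes u: "u \<in> l2 m" and S: "S h = emb m u"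
  shows "u \<in> l2 k" "emb k u = h"
proof -
  have "coord h x / complex_of_real (sqrt (k x)) = u x" for x
  proof -
    have "complex_of_real (\<theta> x) * coord h x = complex_of_real (sqrt (m x)) * u x"
      using coord_S[of h x] coord_emb[OF m_pos u, of x] S by simp
    moreover have "complex_of_real (sqrt (m x)) = complex_of_real (\<theta> x) * complex_of_real (sqrt (k x))"
      using k_pos[of x] by (simp add: \<theta>_def real_sqrt_divide)
    moreover have "complex_of_real (\<theta> x) \<noteq> 0" "complex_of_real (sqrt (k x)) \<noteq> 0"
      using \<theta>_pos[of x] k_pos[of x] by auto
    ultimately show ?thesis by (simp add: field_simps)
  qed
  then have "(\<lambda>x. coord h x / complex_of_real (sqrt (k x))) = u" by (rule ext)
  with emb_surj[of k h, OF k_pos] show "u \<in> l2 k" "emb k u = h" by auto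
qed

lemma Qmax_fin_supp: "fin_supp u \<Longrightarrow> Qmax b c u = inner (G (emb k u)) (emb k u) - (norm (S (emb k u)))\<^sup>2"
  by (simp add: Qmax_eq_qmax qmax_eq_qhat Re_qhat)

text \<open>By coercivity of \<open>G\<close>, a sequence that is Cauchy both in the form and in the
  \<open>m\<close>-norm is Cauchy in \<open>k\<close>-coordinates. Its limit there is identified
  after applying the injective \<open>S\<close>.\<close>

lemma approx_seq_tendsto:
  assumes u: "u \<in> l2 m" and \<phi>: "approx_seq b c m \<phi> u"
  shows "u \<in> l2 k" "(\<lambda>j. emb k (\<phi> j)) \<longlonglongrightarrow> emb k u"
proof -
  have fs: "fin_supp (\<phi> j)" for j using \<phi> by (simp add: approx_seq_def)
  have \<phi>k: "\<phi> j \<in> l2 k" and \<phi>m: "\<phi> j \<in> l2 m" for j using fs by (simp_all add: fin_supp_l2)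
  have "norm (emb m (\<phi> j) - emb m u) = l2norm m (\<lambda>x. \<phi> j x - u x)" for j
    using emb_diff[of m "\<phi> j" u, OF m_pos \<phi>m u] norm_emb[of m "\<lambda>x. \<phi> j x - u x", OF m_pos] by simp
  then have "(\<lambda>j. norm (emb m (\<phi> j) - emb m u)) \<longlonglongrightarrow> 0" using \<phi> by (simp add: approx_seq_def)
  then have "(\<lambda>j. emb m (\<phi> j)) \<longlonglongrightarrow> emb m u" by (rule LIM_zero_cancel[OF tendsto_norm_zero_cancel])
  then have lim_m: "(\<lambda>j. S (emb k (\<phi> j))) \<longlonglongrightarrow> emb m u" by (simp add: emb_m_eq_S \<phi>k)
  have "Cauchy (\<lambda>j. emb k (\<phi> j))"
  proof (rule metric_CauchyI)
    fix e :: real assume e: "e > 0"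
    \<comment> \<open>The form part and the squared \<open>m\<close>-part of a difference each stay
      below e', so together below \<kappa> e^2.\<close>
    define e' where "e' = \<kappa> * e\<^sup>2 / 2"
    have e': "e' > 0" using e \<kappa>_pos by (simp add: e'_def)
    then have "\<exists>N. \<forall>i\<ge>N. \<forall>j\<ge>N. Qmax b c (\<lambda>x. \<phi> i x - \<phi> j x) < e'" using \<phi> unfolding approx_seq_def by blast
    then obtain N1 where N1: "\<And>i j. i \<ge> N1 \<Longrightarrow> j \<ge> N1 \<Longrightarrow> Qmax b c (\<lambda>x. \<phi> i x - \<phi> j x) < e'" by blast
    have "Cauchy (\<lambda>j. S (emb k (\<phi> j)))" using lim_m by (rule LIMSEQ_imp_Cauchy)
    from metric_CauchyD[OF this, of "sqrt e'"] e' obtain N2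
      where N2: "\<And>i j. i \<ge> N2 \<Longrightarrow> j \<ge> N2 \<Longrightarrow> dist (S (emb k (\<phi> i))) (S (emb k (\<phi> j))) < sqrt e'" by auto
    have "dist (emb k (\<phi> i)) (emb k (\<phi> j)) < e" if ij: "i \<ge> max N1 N2" "j \<ge> max N1 N2" for i j
    proof -
      define d where "d = emb k (\<phi> i) - emb k (\<phi> j)"
      have d: "d = emb k (\<lambda>x. \<phi> i x - \<phi> j x)" using emb_diff(2)[OF k_pos \<phi>k \<phi>k] by (simp add: d_def)
      have "norm (S d) < sqrt e'"
        using N2[of i j] ij by (simp add: d_def dist_norm linear_diff[OF bounded_linear.linear[OF bounded_linear_S]])
      then have "(norm (S d))\<^sup>2 < e'" using power_strict_mono[of "norm (S d)" "sqrt e'" 2] e' by simp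
      moreover have "Qmax b c (\<lambda>x. \<phi> i x - \<phi> j x) < e'" using N1 ij by simp
      moreover have "Qmax b c (\<lambda>x. \<phi> i x - \<phi> j x) = inner (G d) d - (norm (S d))\<^sup>2"
        unfolding d by (rule Qmax_fin_supp[OF fin_supp_diff[OF fs fs]])
      ultimately have "\<kappa> * (norm d)\<^sup>2 < \<kappa> * e\<^sup>2" using G_coercive[of d] by (simp add: e'_def)
      then have "(norm d)\<^sup>2 < e\<^sup>2" using \<kappa>_pos by simp
      then show ?thesis using e by (simp add: dist_norm d_def power2_less_imp_less)
    qed
    then show "\<exists>N. \<forall>i\<ge>N. \<forall>j\<ge>N. dist (emb k (\<phi> i)) (emb k (\<phi> j)) < e" by blast
  qed
  then obtain h where h: "(\<lambda>j. emb k (\<phi> j)) \<longlonglongrightarrow> h" using Cauchy_convergent_iff convergent_def by blast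
  then have "(\<lambda>j. S (emb k (\<phi> j))) \<longlonglongrightarrow> S h" by (rule bounded_linear.tendsto[OF bounded_linear_S])
  then have "S h = emb m u" using lim_m LIMSEQ_unique by blast
  from l2_k_if_S[OF u this] h show "u \<in> l2 k" "(\<lambda>j. emb k (\<phi> j)) \<longlonglongrightarrow> emb k u" by auto
qed

lemma approx_seq_exists:
  assumes v: "bij (v :: nat \<Rightarrow> 'v)" and u: "u \<in> l2 k"
  shows "\<exists>\<phi>. approx_seq b c m \<phi> u"
proof -
  define \<phi> where "\<phi> j x = (if x \<in> v ` {..<j} then u x else 0)" for j :: nat and x
  have fs: "fin_supp (\<phi> j)" for j
    unfolding fin_supp_def by (rule finite_subset[of _ "v ` {..<j}"]) (auto simp: \<phi>_def split: if_splits)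
  have \<phi>k: "\<phi> j \<in> l2 k" and \<phi>m: "\<phi> j \<in> l2 m" for j using fs by (simp_all add: fin_supp_l2)
  have "emb k (\<phi> j) = restr (v ` {..<j}) (emb k u)" for j
    by (rule ell2_eqI) (simp add: coord_emb[OF k_pos u] coord_emb[OF k_pos \<phi>k] \<phi>_def)
  then have lim: "(\<lambda>j. emb k (\<phi> j)) \<longlonglongrightarrow> emb k u" using restr_lessThan_tendsto[OF v] by simp
  have "approx_seq b c m \<phi> u"
    unfolding approx_seq_def
  proof (intro conjI allI impI fs)
    have "(\<lambda>j. S (emb k (\<phi> j))) \<longlonglongrightarrow> S (emb k u)" by (rule bounded_linear.tendsto[OF bounded_linear_S lim])
    then have "(\<lambda>j. emb m (\<phi> j)) \<longlonglongrightarrow> emb m u" by (simp add: emb_m_eq_S \<phi>k u)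
    then have "(\<lambda>j. norm (emb m (\<phi> j) - emb m u)) \<longlonglongrightarrow> 0" by (rule tendsto_norm_zero[OF LIM_zero])
    moreover have "norm (emb m (\<phi> j) - emb m u) = l2norm m (\<lambda>x. \<phi> j x - u x)" for j
      using emb_diff[of m "\<phi> j" u, OF m_pos \<phi>m l2_k_imp_m[OF u]] norm_emb[of m "\<lambda>x. \<phi> j x - u x", OF m_pos] by simp
    ultimately show "(\<lambda>j. l2norm m (\<lambda>x. \<phi> j x - u x)) \<longlonglongrightarrow> 0" by simp
    fix e :: real assume e: "e > 0"
    \<comment> \<open>The form of a difference d is at most \<open>inner (G d) d\<close>, hence at
      most twice its squared norm.\<close>
    then have "sqrt (e / 2) > 0" by simp
    from metric_CauchyD[OF LIMSEQ_imp_Cauchy[OF lim] this] obtain N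
      where N: "\<And>i j. i \<ge> N \<Longrightarrow> j \<ge> N \<Longrightarrow> dist (emb k (\<phi> i)) (emb k (\<phi> j)) < sqrt (e / 2)" by auto
    have "Qmax b c (\<lambda>x. \<phi> i x - \<phi> j x) < e" if ij: "i \<ge> N" "j \<ge> N" for i j
    proof -
      define d where "d = emb k (\<phi> i) - emb k (\<phi> j)"
      have d: "d = emb k (\<lambda>x. \<phi> i x - \<phi> j x)" using emb_diff(2)[OF k_pos \<phi>k \<phi>k] by (simp add: d_def)
      have "(norm d)\<^sup>2 < (sqrt (e / 2))\<^sup>2"
        using N[OF ij] unfolding d_def dist_norm by (intro power_strict_mono) auto
      then have "(norm d)\<^sup>2 < e / 2" using e by simp
      moreover have "Qmax b c (\<lambda>x. \<phi> i x - \<phi> j x) = inner (G d) d - (norm (S d))\<^sup>2"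
        unfolding d by (rule Qmax_fin_supp[OF fin_supp_diff[OF fs fs]])
      moreover have "inner (G d) d \<le> 2 * (norm d)\<^sup>2"
        using norm_cauchy_schwarz[of "G d" d] mult_right_mono[OF norm_G_le[of d] norm_ge_zero[of d]]
        by (simp add: power2_eq_square)
      ultimately show ?thesis using zero_le_power2[of "norm (S d)"] by linarith
    qed
    then show "\<exists>N. \<forall>i\<ge>N. \<forall>j\<ge>N. Qmax b c (\<lambda>x. \<phi> i x - \<phi> j x) < e" by blast
  qed
  then show ?thesis by blast
qed

section \<open>Correspondence between \<open>Lop\<close> and the resolvent\<close>

definition unemb :: "'v ell2 \<Rightarrow> 'v \<Rightarrow> complex" where
  "unemb f x = coord f x / complex_of_real (sqrt (m x))"

lemma unemb_l2: "unemb f \<in> l2 m" and emb_unemb [simp]: "emb m (unemb f) = f"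
  using emb_surj[of m f, OF m_pos] by (simp_all add: unemb_def[abs_def])

lemma unemb_emb: "u \<in> l2 m \<Longrightarrow> unemb (emb m u) = u"
  using emb_inj[OF m_pos unemb_l2] by simp

lemma bij_unemb: "bij_betw unemb UNIV (l2 m)"
  by (rule bij_betw_byWitness[where f'="emb m"]) (auto simp: unemb_l2 unemb_emb)

context
  fixes v :: "nat \<Rightarrow> 'v"
  assumes v: "bij v"
begin

lemma formdom_eq: "formdom b c m = l2 k"
  unfolding formdom_def using approx_seq_tendsto(1) approx_seq_exists[OF v] l2_k_imp_m by blast

text \<open>All approximating sequences lead to the same limit and each argument has one, so the
  definite description denotes.\<close>

lemma Qform_eq:
  assumes u: "u \<in> l2 k" and w: "w \<in> l2 k"
  shows "Qform b c m u w = qhat (emb k u) (emb k w)"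
proof -
  have lim: "(\<lambda>j. qmax b c (\<phi> j) (\<psi> j)) \<longlonglongrightarrow> qhat (emb k u) (emb k w)"
    if \<phi>: "approx_seq b c m \<phi> u" and \<psi>: "approx_seq b c m \<psi> w" for \<phi> \<psi>
  proof -
    have "qmax b c (\<phi> j) (\<psi> j) = qhat (emb k (\<phi> j)) (emb k (\<psi> j))" for j
      using \<phi> \<psi> by (intro qmax_eq_qhat) (auto simp: approx_seq_def)
    then show ?thesis
      using tendsto_qhat[OF approx_seq_tendsto(2)[OF l2_k_imp_m[OF u] \<phi>] approx_seq_tendsto(2)[OF l2_k_imp_m[OF w] \<psi>]]
      by simp
  qed
  obtain \<phi> \<psi> where "approx_seq b c m \<phi> u" "approx_seq b c m \<psi> w"
    using approx_seq_exists[OF v u] approx_seq_exists[OF v w] by blast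
  with lim show ?thesis unfolding Qform_def by (intro the_equality) (blast intro: LIMSEQ_unique)+
qed

text \<open>Adding the \<open>m\<close>-pairing of u and w to both sides turns the form into
  \<open>G\<close>. The vectors \<open>emb k w\<close> exhaust the space, so the weak equation is an
  equation of vectors; inverting \<open>G\<close> and applying \<open>S\<close> then produces
  R.\<close>

lemma weak_equation_iff:
  assumes u: "u \<in> l2 k" and f: "f \<in> l2 m"
  shows "(\<forall>w\<in>formdom b c m. Qform b c m u w = l2inner m f w) \<longleftrightarrow> emb m u = R (emb m f + emb m u)"
proof -
  note linS = bounded_linear.linear[OF bounded_linear_S]
  have eq: "Qform b c m u w = l2inner m f w \<longleftrightarrow>
      cinner (G (emb k u)) (emb k w) = cinner (S (emb m f + emb m u)) (emb k w)" if w: "w \<in> l2 k" for w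
  proof -
    have "l2inner m f w = cinner (S (emb m f)) (emb k w)"
      by (simp add: cinner_emb[OF m_pos f l2_k_imp_m[OF w], symmetric] emb_m_eq_S[OF w] cinner_S)
    moreover have "Qform b c m u w = cinner (G (emb k u)) (emb k w) - cinner (S (emb m u)) (emb k w)"
      by (simp add: Qform_eq[OF u w] qhat_def emb_m_eq_S[OF u] cinner_S)
    ultimately show ?thesis by (simp add: linear_add[OF linS] cinner_add_left diff_eq_eq)
  qed
  have "(\<forall>w\<in>formdom b c m. Qform b c m u w = l2inner m f w) \<longleftrightarrow> G (emb k u) = S (emb m f + emb m u)"
  proof
    assume *: "\<forall>w\<in>formdom b c m. Qform b c m u w = l2inner m f w"
    show "G (emb k u) = S (emb m f + emb m u)"
    proof (rule cinner_eqI)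
      fix g
      let ?w = "\<lambda>x. coord g x / complex_of_real (sqrt (k x))"
      have w: "?w \<in> l2 k" "emb k ?w = g" by (rule emb_surj[OF k_pos])+
      then have "Qform b c m u ?w = l2inner m f ?w" using * formdom_eq by blast
      then show "cinner (G (emb k u)) g = cinner (S (emb m f + emb m u)) g" using eq[OF w(1)] w(2) by simp
    qed
  qed (use eq formdom_eq in auto)
  also have "\<dots> \<longleftrightarrow> emb k u = Gi (S (emb m f + emb m u))" by (metis G_Gi Gi_G)
  also have "\<dots> \<longleftrightarrow> emb m u = R (emb m f + emb m u)"
    unfolding R_def using emb_m_eq_S[OF u] S_inj by metis
  finally show ?thesis .
qed

lemma R_range_l2_k:
  assumes "u \<in> l2 m" "emb m u = R g" shows "u \<in> l2 k"
  using l2_k_if_S(1)[OF assms(1), of "Gi (S g)"] assms(2) by (simp add: R_def)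

lemma opdom_iff: "u \<in> opdom b c m \<longleftrightarrow> u \<in> l2 m \<and> (\<exists>f\<in>l2 m. emb m u = R (emb m f + emb m u))"
proof
  assume "u \<in> opdom b c m"
  then have u: "u \<in> l2 k" and ex: "\<exists>f\<in>l2 m. \<forall>w\<in>formdom b c m. Qform b c m u w = l2inner m f w"
    by (auto simp: opdom_def formdom_eq)
  then show "u \<in> l2 m \<and> (\<exists>f\<in>l2 m. emb m u = R (emb m f + emb m u))"
    using weak_equation_iff[OF u] l2_k_imp_m[OF u] by blast
next
  assume *: "u \<in> l2 m \<and> (\<exists>f\<in>l2 m. emb m u = R (emb m f + emb m u))"
  then have u: "u \<in> l2 k" using R_range_l2_k by blast
  then show "u \<in> opdom b c m" unfolding opdom_def using * weak_equation_iff[OF u] formdom_eq by blast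
qed

text \<open>Injectivity of R determines f, so the choice in \<open>Lop\<close> is forced.\<close>

lemma Lop_eq:
  assumes u: "u \<in> l2 m" and f: "f \<in> l2 m" and eq: "emb m u = R (emb m f + emb m u)"
  shows "u \<in> opdom b c m" "Lop b c m u = f"
proof -
  show "u \<in> opdom b c m" using assms opdom_iff by blast
  have uk: "u \<in> l2 k" using R_range_l2_k[OF u eq] .
  show "Lop b c m u = f"
    unfolding Lop_def
  proof (rule some_equality)
    show "f \<in> l2 m \<and> (\<forall>w\<in>formdom b c m. Qform b c m u w = l2inner m f w)"
      using weak_equation_iff[OF uk f] f eq by blast
    fix f' assume f': "f' \<in> l2 m \<and> (\<forall>w\<in>formdom b c m. Qform b c m u w = l2inner m f' w)"
    then have "R (emb m f' + emb m u) = R (emb m f + emb m u)" using weak_equation_iff[OF uk] eq by metis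
    then have "emb m f' = emb m f" using R_inj by fastforce
    then show "f' = f" using emb_inj[of m f' f, OF m_pos] f f' by simp
  qed
qed

lemma Lop_unemb_R: "unemb (R g) \<in> opdom b c m" "Lop b c m (unemb (R g)) = unemb (g - R g)"
  using Lop_eq[of "unemb (R g)" "unemb (g - R g)"] by (simp_all add: unemb_l2)

lemma bij_unemb_R: "bij_betw (\<lambda>g. unemb (R g)) UNIV (opdom b c m)"
proof (rule bij_betw_imageI)
  show "inj (\<lambda>g. unemb (R g))" by (rule injI) (metis emb_unemb R_inj)
  show "range (\<lambda>g. unemb (R g)) = opdom b c m"
  proof (intro set_eqI iffI)
    fix u assume "u \<in> opdom b c m"
    then obtain f where "u \<in> l2 m" "emb m u = R (emb m f + emb m u)" using opdom_iff by blast
    then have "u = unemb (R (emb m f + emb m u))" using unemb_emb by metis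
    then show "u \<in> range (\<lambda>g. unemb (R g))" by blast
  qed (use Lop_unemb_R in auto)
qed

text \<open>In coordinates L R g = g - R g, hence (L - z) R g = g - (z + 1) R g.\<close>

lemma Lop_shift: "(\<lambda>x. Lop b c m (unemb (R g)) x - z * unemb (R g) x) = unemb (pencil R (z + 1) g)"
  unfolding Lop_unemb_R by (rule ext) (simp add: unemb_def pencil_def algebra_simps diff_divide_distrib add_divide_distrib)

lemma spectrum_iff: "z \<in> spectrum_L b c m \<longleftrightarrow> \<not> regular R (z + 1)"
proof -
  let ?A = "\<lambda>u x. Lop b c m u x - z * u x"
  have "bij_betw ?A (opdom b c m) (l2 m) \<longleftrightarrow> bij_betw (?A \<circ> (\<lambda>g. unemb (R g))) UNIV (l2 m)"
    by (rule bij_betw_comp_iff[OF bij_unemb_R])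
  also have "?A \<circ> (\<lambda>g. unemb (R g)) = unemb \<circ> pencil R (z + 1)"
    by (rule ext) (simp add: Lop_shift)
  also have "bij_betw (unemb \<circ> pencil R (z + 1)) UNIV (l2 m) \<longleftrightarrow> bij (pencil R (z + 1))"
    using bij_betw_comp_iff2[OF bij_unemb, of "pencil R (z + 1)" UNIV] by simp
  finally have bij: "bij_betw ?A (opdom b c m) (l2 m) \<longleftrightarrow> bij (pencil R (z + 1))" .
  have "(\<exists>C. \<forall>u\<in>opdom b c m. l2norm m u \<le> C * l2norm m (?A u))
      \<longleftrightarrow> (\<exists>C. \<forall>g. l2norm m (unemb (R g)) \<le> C * l2norm m (?A (unemb (R g))))"
    unfolding bij_betw_imp_surj_on[OF bij_unemb_R, symmetric] by simp
  also have "\<dots> \<longleftrightarrow> (\<exists>C. \<forall>g. norm (R g) \<le> C * norm (pencil R (z + 1) g))"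
    unfolding Lop_shift norm_emb[OF m_pos unemb_l2, symmetric] by simp
  also have "\<dots> \<longleftrightarrow> (\<exists>c>0. \<forall>g. c * norm g \<le> norm (pencil R (z + 1) g))"
  proof
    assume "\<exists>C. \<forall>g. norm (R g) \<le> C * norm (pencil R (z + 1) g)"
    then obtain C where C: "\<And>g. norm (R g) \<le> C * norm (pencil R (z + 1) g)" by blast
    \<comment> \<open>g is its pencil value plus (z + 1) R g, so a bound on R g is also one on g.
      The absolute value is taken because C may be negative.\<close>
    define D where "D = 1 + cmod (z + 1) * \<bar>C\<bar>"
    have D: "D > 0" unfolding D_def by (intro add_pos_nonneg) auto
    have "norm g \<le> D * norm (pencil R (z + 1) g)" for g
    proof -
      have "norm g = norm (pencil R (z + 1) g + cscale (z + 1) (R g))" by (simp add: pencil_def)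
      also have "\<dots> \<le> norm (pencil R (z + 1) g) + cmod (z + 1) * norm (R g)"
        using norm_triangle_ineq[of "pencil R (z + 1) g" "cscale (z + 1) (R g)"] by (simp add: norm_cscale)
      also have "norm (R g) \<le> \<bar>C\<bar> * norm (pencil R (z + 1) g)"
        using C[of g] mult_right_mono[OF abs_ge_self[of C] norm_ge_zero[of "pencil R (z + 1) g"]] by linarith
      also have "norm (pencil R (z + 1) g) + cmod (z + 1) * (\<bar>C\<bar> * norm (pencil R (z + 1) g))
          = D * norm (pencil R (z + 1) g)" by (simp add: D_def algebra_simps)
      finally show ?thesis by (simp add: mult_left_mono)
    qed
    then show "\<exists>c>0. \<forall>g. c * norm g \<le> norm (pencil R (z + 1) g)"
      using D by (intro exI[of _ "1 / D"]) (simp add: field_simps)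
  next
    assume "\<exists>c>0. \<forall>g. c * norm g \<le> norm (pencil R (z + 1) g)"
    then obtain c where c: "c > 0" "\<And>g. c * norm g \<le> norm (pencil R (z + 1) g)" by blast
    obtain M where M: "M > 0" "\<And>g. norm (R g) \<le> norm g * M" using R.R.pos_bounded by blast
    have "norm (R g) \<le> (M / c) * norm (pencil R (z + 1) g)" for g
    proof -
      have "norm (R g) \<le> norm g * M" by (rule M)
      also have "\<dots> \<le> norm (pencil R (z + 1) g) / c * M"
        using c(1) c(2)[of g] M(1) by (intro mult_right_mono) (auto simp: field_simps)
      finally show ?thesis by (simp add: field_simps)
    qed
    then show "\<exists>C. \<forall>g. norm (R g) \<le> C * norm (pencil R (z + 1) g)" by blast
  qed
  finally have bound: "(\<exists>C. \<forall>u\<in>opdom b c m. l2norm m u \<le> C * l2norm m (?A u))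
      \<longleftrightarrow> (\<exists>c>0. \<forall>g. c * norm g \<le> norm (pencil R (z + 1) g))" .
  show ?thesis unfolding spectrum_L_def mem_Collect_eq regular_def bij bound by (rule refl)
qed

text \<open>Apply the resolvent to L u + u = (z + 1) u.\<close>

lemma eigenspace_iff: "u \<in> eigenspace_L b c m z \<longleftrightarrow> u \<in> l2 m \<and> pencil R (z + 1) (emb m u) = 0"
proof -
  have *: "pencil R (z + 1) (emb m u) = 0 \<longleftrightarrow> emb m u = R (emb m (\<lambda>x. z * u x) + emb m u)" if u: "u \<in> l2 m"
  proof -
    have "emb m (\<lambda>x. z * u x) + emb m u = cscale (z + 1) (emb m u)"
      unfolding emb_scale(2)[OF m_pos u] by (rule ell2_eqI) (simp add: algebra_simps)
    then show ?thesis by (simp add: pencil_def R.R_cscale)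
  qed
  show ?thesis
  proof
    assume "u \<in> eigenspace_L b c m z"
    then have ud: "u \<in> opdom b c m" and L: "Lop b c m u = (\<lambda>x. z * u x)" by (auto simp: eigenspace_L_def)
    then obtain f where f: "u \<in> l2 m" "f \<in> l2 m" "emb m u = R (emb m f + emb m u)" using opdom_iff by blast
    then have "f = (\<lambda>x. z * u x)" using Lop_eq(2)[OF f] L by simp
    with f * show "u \<in> l2 m \<and> pencil R (z + 1) (emb m u) = 0" by blast
  next
    assume a: "u \<in> l2 m \<and> pencil R (z + 1) (emb m u) = 0"
    then have "emb m u = R (emb m (\<lambda>x. z * u x) + emb m u)" using * by blast
    from Lop_eq[OF _ emb_scale(1)[OF m_pos] this] a show "u \<in> eigenspace_L b c m z"
      by (simp add: eigenspace_L_def)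
  qed
qed

section \<open>The two implications\<close>

lemma ess_spectrum_empty_if_compact:
  assumes small: "\<And>e. e > 0 \<Longrightarrow> finite {x. \<bar>\<theta> x\<bar> \<ge> e}"
  shows "ess_spectrum_L b c m = {}"
proof -
  interpret C: compact_selfadjoint_ell2 R
  proof (unfold_locales)
    fix f :: "nat \<Rightarrow> 'v ell2" and M assume "\<And>n. norm (f n) \<le> M"
    from diag_compact[where f=f, OF \<theta>_le small v this]
    obtain r l where r: "strict_mono (r :: nat \<Rightarrow> nat)" and l: "(\<lambda>n. S (f (r n))) \<longlonglongrightarrow> l" by blast
    \<comment> \<open>Compactness of the inner factor \<open>S\<close> is passed on by the bounded
      maps \<open>Gi\<close> and \<open>S\<close>.\<close>
    have "(\<lambda>n. R (f (r n))) \<longlonglongrightarrow> S (Gi l)"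
      unfolding R_def by (intro bounded_linear.tendsto[OF bounded_linear_S] bounded_linear.tendsto[OF bounded_linear_Gi] l)
    with r show "\<exists>r l. strict_mono (r :: nat \<Rightarrow> nat) \<and> (\<lambda>n. R (f (r n))) \<longlonglongrightarrow> l" by blast
  qed
  have "z \<in> disc_spectrum_L b c m" if z: "z \<in> spectrum_L b c m" for z
  proof -
    obtain \<epsilon> where \<epsilon>: "\<epsilon> > 0" "\<And>w'. w' \<noteq> z + 1 \<Longrightarrow> cmod (w' - (z + 1)) < \<epsilon> \<Longrightarrow> regular R w'"
      using C.regular_punctured_nbhd[of "z + 1"] by blast
    have "z' = z" if "z' \<in> ball z \<epsilon>" "z' \<in> spectrum_L b c m" for z'
    proof (rule ccontr)
      assume "z' \<noteq> z"
      then have "regular R (z' + 1)" using that(1) by (intro \<epsilon>(2)) (auto simp: dist_norm norm_minus_commute)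
      then show False using that(2) spectrum_iff by blast
    qed
    then have iso: "ball z \<epsilon> \<inter> spectrum_L b c m = {z}" using z \<epsilon>(1) by auto
    obtain K where K: "finite K" "\<And>f. pencil R (z + 1) f = 0 \<Longrightarrow> restr K f = 0 \<Longrightarrow> f = 0"
      using C.kernel_determined_on_finite_set[OF v, of "z + 1"] by blast
    have "\<exists>S. finite S \<and> (\<forall>u\<in>eigenspace_L b c m z. \<exists>a. u = (\<lambda>x. \<Sum>s\<in>S. a s * s x))"
    proof (rule finite_dimensional_if_determined[OF K(1)])
      fix u w y assume uw: "u \<in> eigenspace_L b c m z" "w \<in> eigenspace_L b c m z"
      then have l2: "u \<in> l2 m" "w \<in> l2 m" using eigenspace_iff by auto
      have lin: "linear (pencil R (z + 1))" using R.bounded_linear_pencil by (rule bounded_linear.linear)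
      have cs: "pencil R t (cscale y f) = cscale y (pencil R t f)" for t y f
        by (rule ell2_eqI) (simp add: pencil_def R.R_cscale algebra_simps)
      have "pencil R (z + 1) (emb m (\<lambda>x. u x + (- y) * w x)) = 0"
        using uw unfolding l2_lincomb(2)[OF m_pos l2] by (simp add: linear_add[OF lin] cs eigenspace_iff cscale_zero)
      then show "(\<lambda>x. u x - y * w x) \<in> eigenspace_L b c m z"
        using l2_lincomb(1)[OF m_pos l2, of "- y"] by (simp add: eigenspace_iff)
    next
      fix u assume u: "u \<in> eigenspace_L b c m z" "\<forall>x\<in>K. u x = 0"
      then have l2: "u \<in> l2 m" and pu: "pencil R (z + 1) (emb m u) = 0" using eigenspace_iff by auto
      have "restr K (emb m u) = 0" using u(2) by (intro ell2_eqI) (simp add: coord_emb[OF m_pos l2])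
      then have e0: "emb m u = 0" using K(2)[OF pu] by blast
      have "u x = 0" for x
      proof -
        have "complex_of_real (sqrt (m x)) * u x = 0" using coord_emb[OF m_pos l2, of x] unfolding e0 by simp
        then show ?thesis using m_pos[of x] by simp
      qed
      then show "u = (\<lambda>_. 0)" by (rule ext)
    qed
    with z \<epsilon>(1) iso show ?thesis unfolding disc_spectrum_L_def by blast
  qed
  then show ?thesis unfolding ess_spectrum_L_def by blast
qed

lemma ess_spectrum_nonempty:
  assumes inf: "infinite {x. wdeg b c m x \<le> C}"
  shows "ess_spectrum_L b c m \<noteq> {}"
proof
  assume ess: "ess_spectrum_L b c m = {}"
  have d_pos: "wdeg b c m x > 0" for x using n_pos m_pos by (simp add: wdeg_def)
  obtain x where "wdeg b c m x \<le> C" using inf not_finite_existsD by auto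
  then have C: "C > 0" using d_pos[of x] by linarith
  \<comment> \<open>1/(C + 1) bounds \<theta>^2 from below where d \<le> C; the further factor 1/2
    is the loss in \<open>R_form_lower\<close>.\<close>
  define c0 where "c0 = 1 / (C + 1) / 2"
  have c0: "c0 > 0" using C by (simp add: c0_def)
  have low: "\<exists>f. norm f = 1 \<and> restr K f = 0 \<and> c0 \<le> inner (R f) f" if K: "finite K" for K
  proof -
    obtain x where x: "x \<notin> K" "wdeg b c m x \<le> C" using inf K by (metis (mono_tags) mem_Collect_eq finite_subset subsetI)
    define f where "f = basis_vec x 1"
    have "S f = basis_vec x (complex_of_real (\<theta> x))" by (rule ell2_eqI) (simp add: coord_S f_def)
    then have "(norm (S f))\<^sup>2 = 1 / (wdeg b c m x + 1)" by (simp add: \<theta>_sq)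
    moreover have "1 / (C + 1) \<le> 1 / (wdeg b c m x + 1)" using x d_pos[of x] by (intro divide_left_mono) auto
    ultimately have "1 / (C + 1) \<le> (norm (S f))\<^sup>2" by simp
    then have "c0 \<le> (norm (S f))\<^sup>2 / 2" unfolding c0_def by (rule divide_right_mono) simp
    also have "\<dots> \<le> inner (R f) f" by (rule R_form_lower)
    finally have "c0 \<le> inner (R f) f" .
    moreover have "restr K f = 0" using x(1) by (intro ell2_eqI) (auto simp: f_def)
    ultimately show ?thesis by (intro exI[of _ f]) (simp add: f_def)
  qed
  obtain \<mu> f where \<mu>: "c0 \<le> \<mu>" and f: "\<And>n. norm (f n) = 1" "\<And>h. (\<lambda>n. inner (f n) h) \<longlonglongrightarrow> 0"
    "(\<lambda>n. R (f n) - \<mu> *\<^sub>R f n) \<longlonglongrightarrow> 0"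
    using R.singular_sequence[OF v low] by blast
  have \<mu>0: "\<mu> > 0" using \<mu> c0 by simp
  define w where "w = complex_of_real (1 / \<mu>)"
  \<comment> \<open>Along the singular sequence the pencil tends to 0 on unit vectors, against the
    lower bound in \<open>regular\<close>.\<close>
  have "\<not> regular R w"
  proof
    assume "regular R w"
    then obtain c where c: "c > 0" "\<And>g. c * norm g \<le> norm (pencil R w g)" by (auto simp: regular_def)
    have "c * \<mu> \<le> norm (R (f j) - \<mu> *\<^sub>R f j)" for j
      using c(2)[of "f j"] f(1)[of j] R.pencil_of_real[of \<mu> "f j"] \<mu>0 by (simp add: w_def mult.commute)
    moreover have "(\<lambda>j. norm (R (f j) - \<mu> *\<^sub>R f j)) \<longlonglongrightarrow> 0" using f(3) by (rule tendsto_norm_zero)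
    ultimately have "c * \<mu> \<le> 0" by (intro LIMSEQ_le_const) auto
    then show False using c(1) \<mu>0 by (simp add: mult_le_0_iff)
  qed
  then have "w - 1 \<in> spectrum_L b c m" using spectrum_iff by simp
  then have "w - 1 \<in> disc_spectrum_L b c m" using ess by (auto simp: ess_spectrum_L_def)
  then obtain \<epsilon> B where \<epsilon>: "\<epsilon> > 0" "ball (w - 1) \<epsilon> \<inter> spectrum_L b c m = {w - 1}"
    and B: "finite B" "\<And>u. u \<in> eigenspace_L b c m (w - 1) \<Longrightarrow> \<exists>a. u = (\<lambda>x. \<Sum>s\<in>B. a s * s x)"
    unfolding disc_spectrum_L_def by blast
  have iso: "regular R w'" if "w' \<noteq> w" "cmod (w' - w) < \<epsilon>" for w'
  proof -
    have "w' - 1 \<in> ball (w - 1) \<epsilon>" using that(2) by (simp add: dist_norm norm_minus_commute)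
    moreover have "w' - 1 \<noteq> w - 1" using that(1) by simp
    ultimately have "w' - 1 \<notin> spectrum_L b c m" using \<epsilon>(2) by blast
    then show ?thesis using spectrum_iff by simp
  qed
  \<comment> \<open>One vector more than \<open>orthonormal_card_le\<close> permits for an
    eigenspace spanned by \<open>B\<close>.\<close>
  obtain E where E: "finite E" "card E = 2 * card B + 1"
      "\<And>e. e \<in> E \<Longrightarrow> pencil R w e = 0" "\<And>e. e \<in> E \<Longrightarrow> norm e = 1" "pairwise (\<lambda>e e'. inner e e' = 0) E"
    using R.infinite_multiplicity_if_isolated[OF \<mu>0 f \<epsilon>(1) iso[unfolded w_def], of "2 * card B + 1"]
    unfolding w_def by blast
  have "card E \<le> 2 * card B"
  proof (rule orthonormal_card_le[OF B(1) E(1,4,5), where g="\<lambda>s x. complex_of_real (sqrt (m x)) * s x"])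
    fix e assume "e \<in> E"
    then have "unemb e \<in> eigenspace_L b c m (w - 1)" using E(3) by (simp add: eigenspace_iff unemb_l2)
    then obtain a where a: "unemb e = (\<lambda>x. \<Sum>s\<in>B. a s * s x)" using B(2) by blast
    have "coord e x = (\<Sum>s\<in>B. a s * (complex_of_real (sqrt (m x)) * s x))" for x
    proof -
      have "coord e x = complex_of_real (sqrt (m x)) * unemb e x" using m_pos[of x] by (simp add: unemb_def)
      then show ?thesis unfolding a by (simp add: sum_distrib_left mult.left_commute)
    qed
    then show "\<exists>a. \<forall>x. coord e x = (\<Sum>s\<in>B. a s * (complex_of_real (sqrt (m x)) * s x))" by blast
  qed
  with E(2) show False by simp
qed

end

section \<open>The weighted degree at infinity\<close>

lemma wdeg_boundary_infinite_iff: "wdeg_boundary b c m = \<infinity> \<longleftrightarrow> (\<forall>C::real. finite {x. wdeg b c m x \<le> C})"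
proof -
  define f where "f K = wdeg_inf b c m (UNIV - K)" for K :: "'v set"
  have mono: "f K \<le> f L" if "K \<subseteq> L" for K L
    unfolding f_def wdeg_inf_def using that by (intro INF_superset_mono) auto
  \<comment> \<open>The net is increasing, so it converges to its supremum, which identifies the
    \<open>Lim\<close> in the definition.\<close>
  have "(f \<longlongrightarrow> (SUP K\<in>{K. finite K}. f K)) (finite_subsets_at_top UNIV)"
  proof (rule order_tendstoI)
    fix a assume "a < (SUP K\<in>{K. finite K}. f K)"
    then obtain K where K: "finite K" "a < f K" by (auto simp: less_SUP_iff)
    then show "\<forall>\<^sub>F L in finite_subsets_at_top UNIV. a < f L"
      unfolding eventually_finite_subsets_at_top using mono less_le_trans by (intro exI[of _ K]) blast
  next
    fix a assume a: "(SUP K\<in>{K. finite K}. f K) < a"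
    have "f L < a" if "finite L" for L
    proof -
      have "f L \<le> (SUP K\<in>{K. finite K}. f K)" using that by (intro SUP_upper) auto
      then show ?thesis using a by (rule le_less_trans)
    qed
    then show "\<forall>\<^sub>F L in finite_subsets_at_top UNIV. f L < a"
      by (intro eventually_finite_subsets_at_top_weakI)
  qed
  then have lim: "wdeg_boundary b c m = (SUP K\<in>{K. finite K}. f K)"
    unfolding wdeg_boundary_def f_def by (intro tendsto_Lim) auto
  show ?thesis
  proof
    assume inf: "wdeg_boundary b c m = \<infinity>"
    show "\<forall>C::real. finite {x. wdeg b c m x \<le> C}"
    proof
      fix C :: real
      have "ereal C < (SUP K\<in>{K. finite K}. f K)" using inf lim by simp
      then obtain K where K: "finite K" "ereal C < f K" by (auto simp: less_SUP_iff)
      have "x \<in> K" if "wdeg b c m x \<le> C" for x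
      proof (rule ccontr)
        assume "x \<notin> K"
        then have "f K \<le> ereal (wdeg b c m x)" unfolding f_def wdeg_inf_def by (intro INF_lower) auto
        then have "ereal C < ereal (wdeg b c m x)" using K(2) by (rule less_le_trans[rotated])
        with that show False by simp
      qed
      then have "{x. wdeg b c m x \<le> C} \<subseteq> K" by blast
      then show "finite {x. wdeg b c m x \<le> C}" using K(1) finite_subset by blast
    qed
  next
    assume fin: "\<forall>C::real. finite {x. wdeg b c m x \<le> C}"
    have "ereal C \<le> wdeg_boundary b c m" for C
    proof -
      \<comment> \<open>The sublevel set is itself a finite set outside of which d exceeds
        C.\<close>
      have "ereal C \<le> f {x. wdeg b c m x \<le> C}"
        unfolding f_def wdeg_inf_def by (intro INF_greatest) auto
      also have "\<dots> \<le> wdeg_boundary b c m" unfolding lim using fin by (intro SUP_upper) auto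
      finally show ?thesis .
    qed
    then show "wdeg_boundary b c m = \<infinity>" by (rule ereal_top)
  qed
qed

end

theorem mainTheorem13:
  fixes b :: "'v \<Rightarrow> 'v \<Rightarrow> real" and c :: "'v \<Rightarrow> real" and m :: "'v \<Rightarrow> real"
  assumes "countable (UNIV :: 'v set)" and "infinite (UNIV :: 'v set)"
    and "weighted_graph b c"
    and "locally_finite b"
    and "\<forall>x. gdeg b c x > 0"
    and "pos_measure m"
    and "cheeger b c UNIV > 0"
  shows "ess_spectrum_L b c m = {} \<longleftrightarrow> wdeg_boundary b c m = \<infinity>"
proof -
  interpret isoperimetric_graph b c m using assms by unfold_locales
  \<comment> \<open>The enumeration supplies the increasing finite sets that exhaust the vertex
    set.\<close>
  have v: "bij (from_nat_into (UNIV :: 'v set))" using bij_betw_from_nat_into[OF assms(1,2)] .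
  show ?thesis
    unfolding wdeg_boundary_infinite_iff
  proof
    assume "ess_spectrum_L b c m = {}"
    then show "\<forall>C. finite {x. wdeg b c m x \<le> C}" using ess_spectrum_nonempty[OF v] by blast
  next
    assume fin: "\<forall>C. finite {x. wdeg b c m x \<le> C}"
    have "finite {x. \<bar>\<theta> x\<bar> \<ge> e}" if e: "e > 0" for e
    proof (rule finite_subset)
      \<comment> \<open>Since \<theta>^2 = 1/(d + 1), the lower bound e on \<theta> means d + 1
        \<le> 1/e^2.\<close>
      show "{x. \<bar>\<theta> x\<bar> \<ge> e} \<subseteq> {x. wdeg b c m x \<le> 1 / e\<^sup>2}"
      proof clarify
        fix x assume "e \<le> \<bar>\<theta> x\<bar>"
        then have "e\<^sup>2 \<le> (\<theta> x)\<^sup>2" using power_mono[of e "\<bar>\<theta> x\<bar>" 2] e by simp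
        then have "e\<^sup>2 \<le> 1 / (wdeg b c m x + 1)" by (simp only: \<theta>_sq)
        moreover have "wdeg b c m x > 0" using n_pos m_pos by (simp add: wdeg_def)
        ultimately have "e\<^sup>2 * (wdeg b c m x + 1) \<le> 1" by (simp add: field_simps)
        moreover have "e\<^sup>2 > 0" using e by simp
        ultimately have "wdeg b c m x + 1 \<le> 1 / e\<^sup>2" by (simp add: field_simps)
        then show "wdeg b c m x \<le> 1 / e\<^sup>2" by simp
      qed
    qed (use fin in blast)
    then show "ess_spectrum_L b c m = {}" by (rule ess_spectrum_empty_if_compact[OF v])
  qed
qed

end
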